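(* Let $a_j=b_j$, $j\in\mathbb N$, for the Jacobi probability measure $\mu=\bigotimes_j\mu_{a_j,b_j}$. Let $X^1,X^2$ be Hilbert spaces and consider a function $v\in\mathcal L_2(X^2)$ represented by the even Jacobi series $v=\sum_{\nu\in\mathbb F_{\rm ev}}v_\nu J_\nu$, $v_\nu\in X^2$, and such that the following holds. (1) $X^2$ is a linear subspace of $X^1$ and there is $C_0>0$ with $\|w\|_{X^1}\le C_0\|w\|_{X^2}$ for all $w\in X^2$. (2) The spatial approximation hypothesis (SA) of the context holds with rate $\alpha>0$. (3) There are numbers $q_1,q_2$ with $0<q_1\le q_2<\infty$ and $q_1<2$, and families $(\sigma_{i;\nu})_{\nu\in\mathbb F_{\rm ev}}\subset(1,\infty)$, $i=1,2$, such that for $i=1,2$ $$\sum_{\nu\in\mathbb F_{\rm ev}}\big(\sigma_{i;\nu}\|v_\nu\|_{X^i}\big)^2\le M_i<\infty\quad\text{and}\quad\big(p_\nu(\theta,\lambda)^{2/q_i}\sigma_{i;\nu}^{-1}\big)_{\nu\in\mathbb F_{\rm ev}}\in\ell_{q_i}(\mathbb F_{\rm ev}),$$ with $\theta,\lambda$ as fixed in the context. For $\xi>1$ let $G_{\rm ev}(\xi)$ be the even thresholded index set and $\mathcal Q_{G_{\rm ev}(\xi)}$ the sparse-grid quadrature operator of the context. Then there is a constant $C>0$ (depending on $v$) such that: (i) For each $n\in\mathbb N$ there exists a number $\xi_n$ such that $\dim\mathcal V(G_{\rm ev}(\xi_n))\le n$ and $$\Big\|\int_{\mathbb I^\infty}v(y)\,d\mu(y)-\mathcal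 Q_{G_{\rm ev}(\xi_n)}v\Big\|_{X^1}\le C\begin{cases}n^{-\alpha}&\text{if }\alpha\le1/q_2-1/2,\\ n^{-\beta}(\log n)^\kappa&\text{if }\alpha>1/q_2-1/2.\end{cases}$$ (ii) Let $\phi\in(X^1)'$ be a bounded linear functional on $X^1$. Then for each $n\in\mathbb N$ there exists $\xi_n\in\mathbb R$ such that $\dim\mathcal V(G_{\rm ev}(\xi_n))\le n$ and $$\Big|\int_{\mathbb I^\infty}\langle\phi,v(y)\rangle\,d\mu(y)-\mathcal Q_{G_{\rm ev}(\xi_n)}\langle\phi,v\rangle\Big|\le C\,\|\phi\|_{(X^1)'}\begin{cases}n^{-\alpha}&\text{if }\alpha\le1/q_2-1/2,\\ n^{-\beta}(\log n)^\kappa&\text{if }\alpha>1/q_2-1/2.\end{cases}$$ Here $\alpha$ is the rate in (SA) and $$\beta:=\Big(\frac1{q_1}-\frac12\Big)\frac{\alpha}{\alpha+\delta},\qquad\delta:=\frac1{q_1}-\frac1{q_2},\qquad0<\kappa:=\frac{\alpha+1/2-1/q_2}{\alpha+1/q_1-1/q_2}<1.$$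
   Context: **Indices.** $\mathbb N=\{1,2,\dots\}$, $\mathbb N_0=\mathbb N\cup\{0\}$. $\mathbb F$ is the set of $\nu=(\nu_j)_{j\in\mathbb N}\in\mathbb N_0^{\mathbb N}$ with $\sum_j\nu_j<\infty$; $\mathbb F_{\rm ev}:=\{\nu\in\mathbb F:\nu_j\in2\mathbb N_0\ \forall j\}$. **Jacobi chaos.** $\mathbb I=[-1,1]$, $\mathbb I^\infty=[-1,1]^{\mathbb N}$ with product topology. $(a_j)_{j\in\mathbb N},(b_j)_{j\in\mathbb N}$ are bounded real sequences with $\inf_ja_j>-1$, $\inf_jb_j>-1$. For $a,b>-1$, $\mu_{a,b}$ is the probability measure on $\mathbb I$ with density proportional to $(1-y)^a(1+y)^b$, and $(J_k^{a,b})_{k\in\mathbb N_0}$ are the Jacobi polynomials ($\deg J^{a,b}_k=k$) normalized to be orthonormal in $L_2(\mathbb I;\mu_{a,b})$, $J_0^{a,b}=1$. $J_\nu(y)=\prod_jJ_{\nu_j}^{a_j,b_j}(y_j)$. For a Hilbert space $X$, $\mathcal L_p(X)=L_p(\mathbb I^\infty,X;\mu)$ is the Bochner space; $v\in\mathcal L_2(X)$ has Jacobi coefficients $v_\nu=\int vJ_\nu\,d\mu$. Where point values of $v$ are used, $v$ is identified with the continuous function given by its Jacobi series. **Weights.** $p_\nu(\theta,\lambda):=\prod_j(1+\lambda\nu_j)^\theta$. For $a,b>-1$, $\lambda_{a,b}>0$ denotes a constant with $\|J_k^{a,b}\|_{L_\infty(\mathbb I)}\le(1+\lambda_{a,b}k)^{\max\{a,b,-1/2\}+1/2}$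 for all $k\in\mathbb N_0$; $\lambda_0:=\sup_j\lambda_{a_j,b_j}<\infty$ and $\theta_0:=\max\{\sup_ja_j,\sup_jb_j,-1/2\}+1/2$. Fix $\varepsilon>0$ and $C_\varepsilon$ with $2(1+\lambda_0k)^{\theta_0}\log(2k+3)\le(C_\varepsilon k+1)^{\theta_0+\varepsilon}$ for all $k\in\mathbb N$, and set $\theta:=\theta_0+1+\varepsilon$, $\lambda:=C_\varepsilon+1$. **(SA) Spatial approximation.** There are a sequence $(V_m)_{m\in\mathbb N_0}$ of subspaces $V_m\subset X^1$ with $\dim V_m\le m$, $V_0=\{0\}$, a sequence $(P_m)_{m\in\mathbb N_0}$ of linear operators $P_m:X^1\to V_m$ with $P_0(w)=0$, a number $\alpha>0$ and constants $C_1,C_2>0$ such that for all $m\in\mathbb N_0$ and $w\in X^2$: $\|P_m(w)\|_{X^1}\le C_1\|w\|_{X^1}$ and $\|w-P_m(w)\|_{X^1}\le C_2m^{-\alpha}\|w\|_{X^2}$ (for $m=0$ the right-hand side is read as $+\infty$). Set $\delta_0:=P_0$ and $\delta_k:=P_{2^k}-P_{2^{k-1}}$ for $k\in\mathbb N$. **Approximation space and index set.** For finite $G\subset\mathbb N_0\times\mathbb F$, $\mathcal V(G):=\{\sum_{(k,\nu)\in G}v_{k,\nu}J_\nu: v_{k,\nu}\in V_{2^k}\}$. With $\tau:=\frac{2\alpha}{2-q_2}$, $\vartheta:=\frac2{2-q_2}\big(\frac1{q_1}-\frac12\big)$, $\eta:=\big(\frac1{q_1}-\frac12\big)^{-1}$,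 for $\xi>1$: $G_{\rm ev}(\xi):=\{(k,\nu)\in\mathbb N_0\times\mathbb F_{\rm ev}:2^k\sigma_{2;\nu}^{q_2}\le\xi\}$ if $\alpha\le1/q_2-1/2$, and $G_{\rm ev}(\xi):=\{(k,\nu)\in\mathbb N_0\times\mathbb F_{\rm ev}:\sigma_{1;\nu}^{q_1}\le\xi(\log\xi)^\eta,\ 2^{\tau k}\sigma_{2;\nu}\le\xi^\vartheta\}$ if $\alpha>1/q_2-1/2$. **Quadrature.** For $m\in\mathbb N_0$ let $y_{m,k}=-\cos\frac{(2k+1)\pi}{2(m+1)}$, $k=0,\dots,m$. $I_m(w)=\sum_{k=0}^mw(y_{m,k})L_{m,k}$ is Lagrange interpolation at these nodes, $L_{m,k}(y)=\prod_{0\le j\le m,\,j\ne k}\frac{y-y_{m,j}}{y_{m,k}-y_{m,j}}$. In the $j$-th variable, $Q_m(w):=\int_{\mathbb I}I_m(w)\,d\mu_{a_j,b_j}$, and for $m\in2\mathbb N_0$, $\Delta^{\rm Q}_m:=Q_m-Q_{m-2}$ with $Q_{-2}:=0$. For $\nu\in\mathbb F_{\rm ev}$, $\Delta^{\rm Q}_\nu:=\bigotimes_j\Delta^{\rm Q}_{\nu_j}$, the $j$-th factor acting in the variable $y_j$. For finite $G\subset\mathbb N_0\times\mathbb F_{\rm ev}$ and $v\in C(\mathbb I^\infty,X^2)$, $\mathcal Q_Gv:=\sum_{(k,\nu)\in G}(\delta_k\otimes\Delta^{\rm Q}_\nu)(v)=\sum_{(k,\nu)\in G}\delta_k(\Delta^{\rm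 Q}_\nu v)$, and for $\phi\in(X^1)'$, $\mathcal Q_G\langle\phi,v\rangle:=\langle\phi,\mathcal Q_Gv\rangle$.
   Formalization: Here δ_0 is P_1 instead of P_0 = 0, the families σ_{i;ν} are assumed nondecreasing in ν on F_ev, q_2 < 2 is assumed, and for n = 1 the factor log n is read as log 2; without these changes the claim fails or the index set is undefined or infinite. *)

theory Defs
  imports "HOL-Probability.Probability"
begin

section \<open>Bochner integration without separability\<close>

text \<open>
  The library's Bochner integral is restricted to second countable target spaces.  The Hilbert
  spaces here are arbitrary, so strong measurability (almost everywhere limit of simple functions)
  and the Bochner integral are defined for all normed spaces, on top of the library's integral of
  simple functions.
\<close>

definition strongly_measurable :: "'a measure \<Rightarrow> ('a \<Rightarrow> 'b::real_normed_vector) \<Rightarrow> bool" where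
  "strongly_measurable M f \<longleftrightarrow>
     (\<exists>s. (\<forall>i::nat. simple_function M (s i)) \<and> (AE x in M. (\<lambda>i. s i x) \<longlonglongrightarrow> f x))"

definition has_bint :: "'a measure \<Rightarrow> ('a \<Rightarrow> 'b::real_normed_vector) \<Rightarrow> 'b \<Rightarrow> bool" where
  "has_bint M f x \<longleftrightarrow> strongly_measurable M f \<and>
     (\<exists>s. (\<forall>i::nat. Bochner_Integration.simple_bochner_integrable M (s i)) \<and>
          (\<lambda>i. \<integral>\<^sup>+y. ennreal (norm (f y - s i y)) \<partial>M) \<longlonglongrightarrow> 0 \<and>
          (\<lambda>i. Bochner_Integration.simple_bochner_integral M (s i)) \<longlonglongrightarrow> x)"

definition bint :: "'a measure \<Rightarrow> ('a \<Rightarrow> 'b::real_normed_vector) \<Rightarrow> 'b" where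
  "bint M f = (THE x. has_bint M f x)"

definition in_L2 :: "'a measure \<Rightarrow> ('a \<Rightarrow> 'b::real_normed_vector) \<Rightarrow> bool" where
  "in_L2 M f \<longleftrightarrow> strongly_measurable M f \<and> (\<integral>\<^sup>+y. ennreal ((norm (f y))\<^sup>2) \<partial>M) < \<infinity>"


section \<open>Multi-indices\<close>

text \<open>Coordinates are numbered from 0, so \<^term>\<open>j :: nat\<close> stands for the \<open>(j + 1)\<close>-st variable.\<close>

definition msupp :: "(nat \<Rightarrow> nat) \<Rightarrow> nat set" where
  "msupp \<nu> = {j. \<nu> j \<noteq> 0}"

definition F_ev :: "(nat \<Rightarrow> nat) set" where
  "F_ev = {\<nu>. finite (msupp \<nu>) \<and> (\<forall>j. even (\<nu> j))}"

definition p_weight :: "real \<Rightarrow> real \<Rightarrow> (nat \<Rightarrow> nat) \<Rightarrow> real" where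
  "p_weight \<theta> lam \<nu> = (\<Prod>j\<in>msupp \<nu>. (1 + lam * real (\<nu> j)) powr \<theta>)"


section \<open>Jacobi measures and polynomials\<close>

definition jacobi_weight :: "real \<Rightarrow> real \<Rightarrow> real \<Rightarrow> real" where
  "jacobi_weight a b y = (1 - y) powr a * (1 + y) powr b"

definition jacobi_measure :: "real \<Rightarrow> real \<Rightarrow> real measure" where
  "jacobi_measure a b = density (restrict_space lborel {-1..1})
     (\<lambda>y. ennreal (jacobi_weight a b y / (LINT t:{-1..1}|lborel. jacobi_weight a b t)))"

text \<open>The classical Jacobi polynomial \<open>P\<^sub>k\<close> with \<open>P\<^sub>k(1) = (k + a choose k)\<close>.\<close>

definition jacobi_P :: "real \<Rightarrow> real \<Rightarrow> nat \<Rightarrow> real \<Rightarrow> real" where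
  "jacobi_P a b k y = (\<Sum>s\<le>k. ((real k + a) gchoose (k - s)) * ((real k + b) gchoose s)
       * ((y - 1) / 2) ^ s * ((y + 1) / 2) ^ (k - s))"

definition jacobi_J :: "real \<Rightarrow> real \<Rightarrow> nat \<Rightarrow> real \<Rightarrow> real" where
  "jacobi_J a b k y = jacobi_P a b k y / sqrt (LINT t|jacobi_measure a b. (jacobi_P a b k t)\<^sup>2)"

text \<open>The factors with \<open>\<nu>\<^sub>j = 0\<close> are omitted because \<open>J\<^sub>0 = 1\<close>.\<close>

definition J_multi :: "(nat \<Rightarrow> real) \<Rightarrow> (nat \<Rightarrow> real) \<Rightarrow> (nat \<Rightarrow> nat) \<Rightarrow> (nat \<Rightarrow> real) \<Rightarrow> real" where
  "J_multi a b \<nu> y = (\<Prod>j\<in>msupp \<nu>. jacobi_J (a j) (b j) (\<nu> j) (y j))"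

text \<open>The space of this measure is \<open>[-1,1]\<^sup>\<nat>\<close>.\<close>

definition jacobi_prod :: "(nat \<Rightarrow> real) \<Rightarrow> (nat \<Rightarrow> real) \<Rightarrow> (nat \<Rightarrow> real) measure" where
  "jacobi_prod a b = PiM UNIV (\<lambda>j. jacobi_measure (a j) (b j))"

definition jacobi_coeff ::
  "(nat \<Rightarrow> real) \<Rightarrow> (nat \<Rightarrow> real) \<Rightarrow> ((nat \<Rightarrow> real) \<Rightarrow> 'b::real_normed_vector) \<Rightarrow> (nat \<Rightarrow> nat) \<Rightarrow> 'b" where
  "jacobi_coeff a b v \<nu> = bint (jacobi_prod a b) (\<lambda>y. J_multi a b \<nu> y *\<^sub>R v y)"

text \<open>The equation \<open>v = \<Sum>\<^bsub>\<nu>\<in>F_ev\<^esub> v\<^sub>\<nu> J\<^sub>\<nu>\<close>, with unconditional convergence in \<open>L\<^sub>2\<close>.\<close>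

definition even_jacobi_expansion ::
  "(nat \<Rightarrow> real) \<Rightarrow> (nat \<Rightarrow> real) \<Rightarrow> ((nat \<Rightarrow> real) \<Rightarrow> 'b::real_normed_vector) \<Rightarrow> bool" where
  "even_jacobi_expansion a b v \<longleftrightarrow>
     ((\<lambda>F. \<integral>\<^sup>+y. ennreal ((norm (v y - (\<Sum>\<nu>\<in>F. J_multi a b \<nu> y *\<^sub>R jacobi_coeff a b v \<nu>)))\<^sup>2)
            \<partial>jacobi_prod a b) \<longlongrightarrow> 0) (finite_subsets_at_top F_ev)"

text \<open>The continuous function given by the Jacobi series; it provides the point values of \<open>v\<close>.\<close>

definition cont_rep ::
  "(nat \<Rightarrow> real) \<Rightarrow> (nat \<Rightarrow> real) \<Rightarrow> ((nat \<Rightarrow> real) \<Rightarrow> 'b::real_normed_vector) \<Rightarrow> (nat \<Rightarrow> real) \<Rightarrow> 'b" where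
  "cont_rep a b v y = (\<Sum>\<^sub>\<infinity>\<nu>\<in>F_ev. J_multi a b \<nu> y *\<^sub>R jacobi_coeff a b v \<nu>)"


section \<open>Index sets, approximation spaces, rates\<close>

text \<open>In the second case \<open>\<tau>\<close> and \<open>\<vartheta>\<close> are meaningful only for \<open>q\<^sub>2 < 2\<close>.\<close>

definition G_ev :: "real \<Rightarrow> real \<Rightarrow> real \<Rightarrow> ((nat \<Rightarrow> nat) \<Rightarrow> real) \<Rightarrow> ((nat \<Rightarrow> nat) \<Rightarrow> real) \<Rightarrow>
    real \<Rightarrow> (nat \<times> (nat \<Rightarrow> nat)) set" where
  "G_ev \<alpha> q1 q2 \<sigma>1 \<sigma>2 \<xi> =
    (let \<tau> = 2 * \<alpha> / (2 - q2);
         \<theta>' = 2 / (2 - q2) * (1 / q1 - 1 / 2);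
         \<eta> = 1 / (1 / q1 - 1 / 2)
     in if \<alpha> \<le> 1 / q2 - 1 / 2
        then {(k, \<nu>). \<nu> \<in> F_ev \<and> 2 ^ k * \<sigma>2 \<nu> powr q2 \<le> \<xi>}
        else {(k, \<nu>). \<nu> \<in> F_ev \<and> \<sigma>1 \<nu> powr q1 \<le> \<xi> * ln \<xi> powr \<eta> \<and>
                      2 powr (\<tau> * real k) * \<sigma>2 \<nu> \<le> \<xi> powr \<theta>'})"

definition approx_space :: "(nat \<Rightarrow> real) \<Rightarrow> (nat \<Rightarrow> real) \<Rightarrow> (nat \<Rightarrow> 'b::real_normed_vector set) \<Rightarrow>
    (nat \<times> (nat \<Rightarrow> nat)) set \<Rightarrow> ((nat \<Rightarrow> real) \<Rightarrow> 'b) set" where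
  "approx_space a b V G =
     {f. \<exists>c. (\<forall>(k, \<nu>)\<in>G. c k \<nu> \<in> V (2 ^ k)) \<and> f = (\<lambda>y. \<Sum>(k, \<nu>)\<in>G. J_multi a b \<nu> y *\<^sub>R c k \<nu>)}"

text \<open>
  Bounds on dimensions are stated through finite spanning sets: the library's \<^const>\<open>dim\<close> is 0
  for infinite-dimensional spaces and is not available for spaces of functions.
\<close>

definition has_dim_le :: "'b::real_vector set \<Rightarrow> nat \<Rightarrow> bool" where
  "has_dim_le S n \<longleftrightarrow> (\<exists>B. finite B \<and> card B \<le> n \<and> S \<subseteq> span B)"

definition fun_has_dim_le :: "'a set \<Rightarrow> ('a \<Rightarrow> 'b::real_vector) set \<Rightarrow> nat \<Rightarrow> bool" where
  "fun_has_dim_le D S n \<longleftrightarrow> (\<exists>B. finite B \<and> card B \<le> n \<and>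
     (\<forall>f\<in>S. \<exists>c. \<forall>y\<in>D. f y = (\<Sum>g\<in>B. c g *\<^sub>R g y)))"

definition beta_exp :: "real \<Rightarrow> real \<Rightarrow> real \<Rightarrow> real" where
  "beta_exp \<alpha> q1 q2 = (1 / q1 - 1 / 2) * (\<alpha> / (\<alpha> + (1 / q1 - 1 / q2)))"

definition kappa_exp :: "real \<Rightarrow> real \<Rightarrow> real \<Rightarrow> real" where
  "kappa_exp \<alpha> q1 q2 = (\<alpha> + 1 / 2 - 1 / q2) / (\<alpha> + 1 / q1 - 1 / q2)"

text \<open>
  For \<open>n = 1\<close> the factor \<open>log n\<close> vanishes, and a bound by 0 would claim that the quadrature
  is exact; \<open>log 2\<close> takes its place there.
\<close>

definition rate :: "real \<Rightarrow> real \<Rightarrow> real \<Rightarrow> nat \<Rightarrow> real" where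
  "rate \<alpha> q1 q2 n =
     (if \<alpha> \<le> 1 / q2 - 1 / 2 then real n powr (- \<alpha>)
      else real n powr (- beta_exp \<alpha> q1 q2) * ln (real (max n 2)) powr kappa_exp \<alpha> q1 q2)"


section \<open>Sparse-grid quadrature\<close>

definition node :: "nat \<Rightarrow> nat \<Rightarrow> real" where
  "node m k = - cos ((2 * real k + 1) * pi / (2 * (real m + 1)))"

definition lagrange :: "nat \<Rightarrow> nat \<Rightarrow> real \<Rightarrow> real" where
  "lagrange m k y = (\<Prod>j\<in>{0..m} - {k}. (y - node m j) / (node m k - node m j))"

definition interp :: "nat \<Rightarrow> (real \<Rightarrow> 'b::real_normed_vector) \<Rightarrow> real \<Rightarrow> 'b" where
  "interp m w y = (\<Sum>k=0..m. lagrange m k y *\<^sub>R w (node m k))"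

definition quad :: "real \<Rightarrow> real \<Rightarrow> nat \<Rightarrow> (real \<Rightarrow> 'b::real_normed_vector) \<Rightarrow> 'b" where
  "quad a b m w = bint (jacobi_measure a b) (interp m w)"

text \<open>Used for even \<open>m\<close> only; the case \<open>m = 0\<close> is the convention \<open>Q\<^bsub>-2\<^esub> = 0\<close>.\<close>

definition quad_diff :: "real \<Rightarrow> real \<Rightarrow> nat \<Rightarrow> (real \<Rightarrow> 'b::real_normed_vector) \<Rightarrow> 'b" where
  "quad_diff a b m w = (if m = 0 then quad a b 0 w else quad a b m w - quad a b (m - 2) w)"

text \<open>
  The tensor product over all variables.  For \<open>j\<close> outside the support of \<open>\<nu>\<close> the factor is
  \<open>Q\<^sub>0\<close>, which is the evaluation at the single node \<^term>\<open>node 0 0\<close>; the remaining finitely many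
  factors are applied one after the other, each in its own variable.
\<close>

definition quad_diff_multi ::
  "(nat \<Rightarrow> real) \<Rightarrow> (nat \<Rightarrow> real) \<Rightarrow> (nat \<Rightarrow> nat) \<Rightarrow> ((nat \<Rightarrow> real) \<Rightarrow> 'b::real_normed_vector) \<Rightarrow> 'b" where
  "quad_diff_multi a b \<nu> f =
     foldr (\<lambda>j g y. quad_diff (a j) (b j) (\<nu> j) (\<lambda>t. g (y(j := t))))
       (sorted_list_of_set (msupp \<nu>)) f (\<lambda>_. node 0 0)"

text \<open>
  The term of index 0 is \<^term>\<open>P (2 ^ 0)\<close>, the projection onto \<^term>\<open>V (2 ^ 0)\<close>, so that
  \<open>\<Sum>\<^bsub>k\<le>K\<^esub> \<delta>\<^sub>k\<close> telescopes to \<^term>\<open>P (2 ^ K)\<close>.  With the zero operator \<^term>\<open>P 0\<close> as first term the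
  sum would be \<^term>\<open>\<lambda>w. P (2 ^ K) w - P 1 w\<close>, which does not approximate the identity.
\<close>

definition delta_op :: "(nat \<Rightarrow> 'b \<Rightarrow> 'b::real_vector) \<Rightarrow> nat \<Rightarrow> 'b \<Rightarrow> 'b" where
  "delta_op P k w = (if k = 0 then P (2 ^ 0) w else P (2 ^ k) w - P (2 ^ (k - 1)) w)"

text \<open>The map \<open>emb\<close> is the inclusion of \<open>X\<^sup>2\<close> into \<open>X\<^sup>1\<close>.\<close>

definition sparse_quad :: "(nat \<Rightarrow> real) \<Rightarrow> (nat \<Rightarrow> real) \<Rightarrow> ('b::real_normed_vector \<Rightarrow> 'c::real_normed_vector) \<Rightarrow>
    (nat \<Rightarrow> 'c \<Rightarrow> 'c) \<Rightarrow> (nat \<times> (nat \<Rightarrow> nat)) set \<Rightarrow> ((nat \<Rightarrow> real) \<Rightarrow> 'b) \<Rightarrow> 'c" where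
  "sparse_quad a b emb P G f = (\<Sum>(k, \<nu>)\<in>G. delta_op P k (emb (quad_diff_multi a b \<nu> f)))"

end

theory Submission
  imports Defs "HOL-Real_Asymp.Real_Asymp"
begin

text \<open>
  Only the coefficients \<open>v\<^sub>\<nu>\<close> enter: \<open>\<integral> v = v\<^sub>0\<close>, and the quadrature operator acts on the Jacobi
  series termwise.  For even indices, \<open>\<Delta>\<^sub>s J\<^sub>\<nu>\<close> vanishes unless \<open>s \<le> \<nu>\<close>, because interpolation of
  degree \<open>m\<close> is exact on polynomials of degree \<open>m\<close>.  For the same reason \<open>\<Sum>\<^bsub>s \<le> \<nu>\<^esub> \<Delta>\<^sub>s J\<^sub>\<nu> = \<integral> J\<^sub>\<nu>\<close>,
  which is \<open>1\<close> for \<open>\<nu> = 0\<close> and \<open>0\<close> otherwise; the logarithmic Lebesgue constant of the Chebyshev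
  nodes gives \<open>\<Sum>\<^bsub>s \<le> \<nu>\<^esub> \<bar>\<Delta>\<^sub>s J\<^sub>\<nu>\<bar> \<le> p\<^sub>\<nu>\<close>.  Hence the error is at most \<open>\<Sum>\<^sub>\<nu> p\<^sub>\<nu> r\<^sub>\<nu>\<close>, where \<open>r\<^sub>\<nu>\<close> is the largest
  norm, over \<open>s \<le> \<nu>\<close>, of what the spatial differences \<open>\<delta>\<^sub>k\<close> with \<open>(k, s) \<in> G\<close> leave of \<open>v\<^sub>\<nu>\<close>.
  Monotonicity of \<open>\<sigma>\<^sub>i\<close> turns the thresholds at \<open>s\<close> into powers of \<open>\<sigma>\<^bsub>i;\<nu>\<^esub>\<close>, and Young's inequality
  reduces the sum to the two summability hypotheses.  The dimension is at most the sum of \<open>2\<^sup>k\<close> over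
  \<open>G\<close>, which the summability of \<open>\<sigma>\<^bsub>i;\<nu>\<^esub>\<^sup>-\<^sup>q\<close> (with \<open>q = q\<^sub>i\<close>) controls.
\<close>

section \<open>The Bochner integral\<close>

text \<open>Young's inequality absorbs the power \<open>1 - q / 2\<close> of a weight, and this
  shapes both regimes. For small \<alpha> the threshold on
  \<open>2 ^ k * \<sigma>2 s powr q2\<close> costs the power \<open>q2 * \<alpha>\<close> of
  \<sigma>2, which is at most \<open>1 - q2 / 2\<close>. For larger \<alpha> this is too much, so
  the threshold is tilted to \<open>2 powr (\<tau> * k) * \<sigma>2 s\<close>, with \<tau> making
  the cost exactly \<open>1 - q2 / 2\<close>. The tilt spoils the dimension count: it now sums
  \<open>\<sigma>2 powr (- 1 / \<tau>)\<close> with \<open>1 / \<tau> < q2\<close>, for which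
  summability of \<open>\<sigma>2 powr (- q2)\<close> is not enough. Cutting off large \<sigma>1
  restores control by interpolation; the discarded coefficients, measured in X1, are paid for by the
  family \<sigma>1. The logarithm in that cut is the source of \<kappa>. A second constraint is that
  X1 and X2 may be nonseparable. Integrals are therefore built from simple functions, and norms are
  measurable only up to null sets. The quadrature itself is a finite combination of point values, so
  it needs no exchange of limit and integral.\<close>

lemma strongly_measurableE:
  assumes "strongly_measurable M f"
  obtains u where "\<And>i::nat. simple_function M (u i)" "AE x in M. (\<lambda>i. u i x) \<longlonglongrightarrow> f x"
proof -
  from assms obtain u where "(\<forall>i::nat. simple_function M (u i)) \<and> (AE x in M. (\<lambda>i. u i x) \<longlonglongrightarrow> f x)"
    unfolding strongly_measurable_def by (rule exE)
  then show ?thesis by (intro that[of u]) simp_all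
qed

text \<open>\<open>f\<close> is a limit only almost everywhere, so \<open>norm (f x - s x)\<close>
  itself need not be measurable. The limsup of the simple functions
  \<open>norm (u i x - s x)\<close> is a measurable version; additivity and scaling of the
  nonnegative integral are applied to such versions and carried back.\<close>

lemma norm_diff_simple_AE_measurable:
  assumes "strongly_measurable M f" and s: "simple_function M s"
  obtains h where "h \<in> borel_measurable M" "AE x in M. ennreal (norm (f x - s x)) = h x"
proof -
  obtain u where u: "\<And>i::nat. simple_function M (u i)"
    and lim: "AE x in M. (\<lambda>i. u i x) \<longlonglongrightarrow> f x"
    by (rule strongly_measurableE[OF assms(1)]) (rule that)
  define h where "h x = limsup (\<lambda>i. ennreal (norm (u i x - s x)))" for x
  have [measurable]: "(\<lambda>x. ennreal (norm (u i x - s x))) \<in> borel_measurable M" for i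
    using simple_function_compose2[OF u s, of "\<lambda>a b. ennreal (norm (a - b))"]
    by (rule borel_measurable_simple_function)
  have "h \<in> borel_measurable M"
    unfolding h_def by measurable
  moreover have "AE x in M. ennreal (norm (f x - s x)) = h x"
    using lim
  proof eventually_elim
    case (elim x)
    have "(\<lambda>i. ennreal (norm (u i x - s x))) \<longlonglongrightarrow> ennreal (norm (f x - s x))"
      by (intro tendsto_ennrealI tendsto_intros elim)
    then show ?case
      unfolding h_def by (rule lim_imp_Limsup[OF trivial_limit_sequentially, symmetric])
  qed
  ultimately show ?thesis by (rule that)
qed

text \<open>The triangle inequality through \<open>f\<close>. This estimate is behind both the
  uniqueness of the integral and the Cauchy property of the approximating integrals.\<close>

lemma norm_simple_bochner_integral_diff_le:
  assumes f: "strongly_measurable M f"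
    and s: "Bochner_Integration.simple_bochner_integrable M s"
    and t: "Bochner_Integration.simple_bochner_integrable M t"
  shows "ennreal (norm (Bochner_Integration.simple_bochner_integral M s
      - Bochner_Integration.simple_bochner_integral M t))
    \<le> (\<integral>\<^sup>+x. ennreal (norm (f x - s x)) \<partial>M) + (\<integral>\<^sup>+x. ennreal (norm (f x - t x)) \<partial>M)"
proof -
  have "simple_function M s" "simple_function M t"
    using s t by (auto elim: simple_bochner_integrable.cases)
  obtain h where h: "h \<in> borel_measurable M" "AE x in M. ennreal (norm (f x - s x)) = h x"
    by (rule norm_diff_simple_AE_measurable[OF f \<open>simple_function M s\<close>])
  obtain k where k: "k \<in> borel_measurable M" "AE x in M. ennreal (norm (f x - t x)) = k x"
    by (rule norm_diff_simple_AE_measurable[OF f \<open>simple_function M t\<close>])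
  have "ennreal (norm (Bochner_Integration.simple_bochner_integral M s
      - Bochner_Integration.simple_bochner_integral M t))
    = norm (Bochner_Integration.simple_bochner_integral M (\<lambda>x. s x - t x))"
    using s t by (subst simple_bochner_integral_diff) auto
  also have "\<dots> \<le> Bochner_Integration.simple_bochner_integral M (\<lambda>x. norm (s x - t x))"
    using simple_bochner_integrable_compose2[of "(-)" M s t] s t
    by (auto intro!: simple_bochner_integral_norm_bound)
  also have "\<dots> = (\<integral>\<^sup>+x. ennreal (norm (s x - t x)) \<partial>M)"
    using simple_bochner_integrable_compose2[of "\<lambda>x y. norm (x - y)" M s t] s t
    by (auto intro!: simple_bochner_integral_eq_nn_integral)
  also have "\<dots> \<le> (\<integral>\<^sup>+x. h x + k x \<partial>M)"
    using h(2) k(2)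
  proof (intro nn_integral_mono_AE, eventually_elim)
    case (elim x)
    have "norm (s x - t x) \<le> norm (f x - s x) + norm (f x - t x)"
      by (metis dual_order.refl norm_diff_triangle_le norm_minus_commute)
    then have "ennreal (norm (s x - t x)) \<le> ennreal (norm (f x - s x)) + ennreal (norm (f x - t x))"
      by (simp flip: ennreal_plus)
    then show ?case using elim by simp
  qed
  also have "\<dots> = (\<integral>\<^sup>+x. h x \<partial>M) + (\<integral>\<^sup>+x. k x \<partial>M)"
    by (rule nn_integral_add) (use h k in auto)
  also have "(\<integral>\<^sup>+x. h x \<partial>M) = (\<integral>\<^sup>+x. ennreal (norm (f x - s x)) \<partial>M)"
    using h(2) by (intro nn_integral_cong_AE) auto
  also have "(\<integral>\<^sup>+x. k x \<partial>M) = (\<integral>\<^sup>+x. ennreal (norm (f x - t x)) \<partial>M)"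
    using k(2) by (intro nn_integral_cong_AE) auto
  finally show ?thesis .
qed

lemma has_bintE:
  assumes "has_bint M f x"
  obtains s where "strongly_measurable M f"
    "\<And>i::nat. Bochner_Integration.simple_bochner_integrable M (s i)"
    "(\<lambda>i. \<integral>\<^sup>+x. ennreal (norm (f x - s i x)) \<partial>M) \<longlonglongrightarrow> 0"
    "(\<lambda>i. Bochner_Integration.simple_bochner_integral M (s i)) \<longlonglongrightarrow> x"
proof -
  have f: "strongly_measurable M f"
    and "\<exists>s. (\<forall>i::nat. Bochner_Integration.simple_bochner_integrable M (s i)) \<and>
      (\<lambda>i. \<integral>\<^sup>+x. ennreal (norm (f x - s i x)) \<partial>M) \<longlonglongrightarrow> 0 \<and>
      (\<lambda>i. Bochner_Integration.simple_bochner_integral M (s i)) \<longlonglongrightarrow> x"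
    using assms unfolding has_bint_def by simp_all
  from this(2) obtain s where "(\<forall>i::nat. Bochner_Integration.simple_bochner_integrable M (s i)) \<and>
      (\<lambda>i. \<integral>\<^sup>+x. ennreal (norm (f x - s i x)) \<partial>M) \<longlonglongrightarrow> 0 \<and>
      (\<lambda>i. Bochner_Integration.simple_bochner_integral M (s i)) \<longlonglongrightarrow> x"
    by (rule exE)
  with f show ?thesis by (intro that[of s]) simp_all
qed

lemma has_bintI:
  assumes "strongly_measurable M f"
    and "\<And>i::nat. Bochner_Integration.simple_bochner_integrable M (s i)"
    and "(\<lambda>i. \<integral>\<^sup>+x. ennreal (norm (f x - s i x)) \<partial>M) \<longlonglongrightarrow> 0"
    and "(\<lambda>i. Bochner_Integration.simple_bochner_integral M (s i)) \<longlonglongrightarrow> x"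
  shows "has_bint M f x"
  unfolding has_bint_def
  by (intro conjI exI[where x=s] allI) (fact assms)+

lemma strongly_measurableI:
  assumes "\<And>i::nat. simple_function M (u i)" "AE x in M. (\<lambda>i. u i x) \<longlonglongrightarrow> f x"
  shows "strongly_measurable M f"
  unfolding strongly_measurable_def
  by (intro exI[where x=u] conjI allI) (fact assms)+

lemma has_bint_unique:
  assumes "has_bint M f x" "has_bint M f y"
  shows "x = y"
proof -
  obtain s where f: "strongly_measurable M f"
    and s: "\<And>i::nat. Bochner_Integration.simple_bochner_integrable M (s i)"
    and s0: "(\<lambda>i. \<integral>\<^sup>+x. ennreal (norm (f x - s i x)) \<partial>M) \<longlonglongrightarrow> 0"
    and sx: "(\<lambda>i. Bochner_Integration.simple_bochner_integral M (s i)) \<longlonglongrightarrow> x"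
    by (rule has_bintE[OF assms(1)]) (rule that)
  obtain t where t: "\<And>i::nat. Bochner_Integration.simple_bochner_integrable M (t i)"
    and t0: "(\<lambda>i. \<integral>\<^sup>+x. ennreal (norm (f x - t i x)) \<partial>M) \<longlonglongrightarrow> 0"
    and ty: "(\<lambda>i. Bochner_Integration.simple_bochner_integral M (t i)) \<longlonglongrightarrow> y"
    by (rule has_bintE[OF assms(2)]) (rule that)
  let ?s = "\<lambda>i. Bochner_Integration.simple_bochner_integral M (s i)"
  let ?t = "\<lambda>i. Bochner_Integration.simple_bochner_integral M (t i)"
  have "(\<lambda>i. ennreal (norm (?s i - ?t i))) \<longlonglongrightarrow> ennreal (norm (x - y))"
    by (intro tendsto_ennrealI tendsto_intros sx ty)
  moreover have "(\<lambda>i. ennreal (norm (?s i - ?t i))) \<longlonglongrightarrow> 0"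
  proof (rule tendsto_sandwich[where f="\<lambda>_. 0"])
    show "\<forall>\<^sub>F i in sequentially. ennreal (norm (?s i - ?t i))
        \<le> (\<integral>\<^sup>+x. ennreal (norm (f x - s i x)) \<partial>M) + (\<integral>\<^sup>+x. ennreal (norm (f x - t i x)) \<partial>M)"
      by (intro always_eventually allI norm_simple_bochner_integral_diff_le f s t)
    show "(\<lambda>i. (\<integral>\<^sup>+x. ennreal (norm (f x - s i x)) \<partial>M)
        + (\<integral>\<^sup>+x. ennreal (norm (f x - t i x)) \<partial>M)) \<longlonglongrightarrow> 0"
      using tendsto_add[OF s0 t0] by simp
  qed auto
  ultimately have "ennreal (norm (x - y)) = 0"
    by (rule LIMSEQ_unique)
  then show ?thesis by simp
qed

lemma bint_eqI: "has_bint M f x \<Longrightarrow> bint M f = x"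
  unfolding bint_def using has_bint_unique by blast

lemma strongly_measurable_compose:
  assumes "strongly_measurable M f" and "continuous_on UNIV L"
  shows "strongly_measurable M (\<lambda>x. L (f x))"
proof -
  obtain u where u: "\<And>i::nat. simple_function M (u i)"
    and lim: "AE x in M. (\<lambda>i. u i x) \<longlonglongrightarrow> f x"
    by (rule strongly_measurableE[OF assms(1)]) (rule that)
  have "AE x in M. (\<lambda>i. L (u i x)) \<longlonglongrightarrow> L (f x)"
    using lim by eventually_elim
      (use assms(2) in \<open>auto intro: isCont_tendsto_compose simp: continuous_on_eq_continuous_at\<close>)
  moreover have "simple_function M (\<lambda>x. L (u i x))" for i
    by (rule simple_function_compose1[OF u, of L])
  ultimately show ?thesis
    by (intro strongly_measurableI[where u="\<lambda>i x. L (u i x)"])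
qed

text \<open>A Lipschitz bound on \<open>L\<close> transports the approximating simple functions. It
  is used for multiplication of a fixed vector by a real function, which reduces interpolants to
  real integrals, and for \<open>\<phi>\<close> composed with \<open>emb\<close>.\<close>

lemma has_bint_bounded_linear:
  assumes L: "bounded_linear L" and f: "has_bint M f x"
  shows "has_bint M (\<lambda>y. L (f y)) (L x)"
proof -
  interpret L: bounded_linear L by fact
  obtain K where K: "K > 0" "\<And>x. norm (L x) \<le> norm x * K"
    using L.pos_bounded by blast
  obtain s where fm: "strongly_measurable M f"
    and s: "\<And>i::nat. Bochner_Integration.simple_bochner_integrable M (s i)"
    and s0: "(\<lambda>i. \<integral>\<^sup>+x. ennreal (norm (f x - s i x)) \<partial>M) \<longlonglongrightarrow> 0"
    and sx: "(\<lambda>i. Bochner_Integration.simple_bochner_integral M (s i)) \<longlonglongrightarrow> x"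
    by (rule has_bintE[OF f]) (rule that)
  have ssf: "simple_function M (s i)" for i
    using s[of i] by (auto elim: simple_bochner_integrable.cases)
  have le: "(\<integral>\<^sup>+x. ennreal (norm (L (f x) - L (s i x))) \<partial>M)
      \<le> ennreal K * (\<integral>\<^sup>+x. ennreal (norm (f x - s i x)) \<partial>M)" for i
  proof -
    obtain h where h: "h \<in> borel_measurable M" "AE x in M. ennreal (norm (f x - s i x)) = h x"
      by (rule norm_diff_simple_AE_measurable[OF fm ssf])
    have "(\<integral>\<^sup>+x. ennreal (norm (L (f x) - L (s i x))) \<partial>M) \<le> (\<integral>\<^sup>+x. ennreal K * h x \<partial>M)"
      using h(2)
    proof (intro nn_integral_mono_AE, eventually_elim)
      case (elim x)
      have "norm (L (f x) - L (s i x)) \<le> K * norm (f x - s i x)"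
        using K(2)[of "f x - s i x"] by (simp add: L.diff mult.commute)
      then have "ennreal (norm (L (f x) - L (s i x))) \<le> ennreal K * ennreal (norm (f x - s i x))"
        using K(1) by (simp flip: ennreal_mult)
      then show ?case using elim by simp
    qed
    also have "\<dots> = ennreal K * (\<integral>\<^sup>+x. h x \<partial>M)"
      by (rule nn_integral_cmult) (rule h)
    also have "(\<integral>\<^sup>+x. h x \<partial>M) = (\<integral>\<^sup>+x. ennreal (norm (f x - s i x)) \<partial>M)"
      using h(2) by (intro nn_integral_cong_AE) auto
    finally show ?thesis .
  qed
  have c: "(\<lambda>i. \<integral>\<^sup>+x. ennreal (norm (L (f x) - L (s i x))) \<partial>M) \<longlonglongrightarrow> 0"
  proof (rule tendsto_sandwich[where f="\<lambda>_. 0"])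
    show "\<forall>\<^sub>F i in sequentially. (\<integral>\<^sup>+x. ennreal (norm (L (f x) - L (s i x))) \<partial>M)
        \<le> ennreal K * (\<integral>\<^sup>+x. ennreal (norm (f x - s i x)) \<partial>M)"
      by (intro always_eventually allI le)
    show "(\<lambda>i. ennreal K * (\<integral>\<^sup>+x. ennreal (norm (f x - s i x)) \<partial>M)) \<longlonglongrightarrow> 0"
      using ennreal_tendsto_cmult[OF _ s0, of "ennreal K"] by simp
  qed auto
  have b: "Bochner_Integration.simple_bochner_integrable M (\<lambda>y. L (s i y))" for i
    using simple_bochner_integrable_compose2[of "\<lambda>x y. L x" M "s i" "s i"] s by (simp add: L.zero)
  have d: "(\<lambda>i. Bochner_Integration.simple_bochner_integral M (\<lambda>y. L (s i y))) \<longlonglongrightarrow> L x"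
    using L.tendsto[OF sx] s by (simp add: simple_bochner_integral_linear L.linear_axioms)
  have a: "strongly_measurable M (\<lambda>y. L (f y))"
    by (rule strongly_measurable_compose[OF fm linear_continuous_on[OF L]])
  show ?thesis
    by (rule has_bintI[where s="\<lambda>i y. L (s i y)", OF a b c d])
qed

lemma strongly_measurable_add:
  assumes "strongly_measurable M f" "strongly_measurable M g"
  shows "strongly_measurable M (\<lambda>x. f x + g x)"
proof -
  obtain u where u: "\<And>i::nat. simple_function M (u i)"
    and lu: "AE x in M. (\<lambda>i. u i x) \<longlonglongrightarrow> f x"
    by (rule strongly_measurableE[OF assms(1)]) (rule that)
  obtain w where w: "\<And>i::nat. simple_function M (w i)"
    and lw: "AE x in M. (\<lambda>i. w i x) \<longlonglongrightarrow> g x"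
    by (rule strongly_measurableE[OF assms(2)]) (rule that)
  have "AE x in M. (\<lambda>i. u i x + w i x) \<longlonglongrightarrow> f x + g x"
    using lu lw by eventually_elim (rule tendsto_add)
  moreover have "simple_function M (\<lambda>x. u i x + w i x)" for i
    by (rule simple_function_compose2[OF u w])
  ultimately show ?thesis
    by (intro strongly_measurableI[where u="\<lambda>i x. u i x + w i x"])
qed

lemma has_bint_add:
  assumes "has_bint M f x" "has_bint M g y"
  shows "has_bint M (\<lambda>z. f z + g z) (x + y)"
proof -
  obtain s where f: "strongly_measurable M f"
    and s: "\<And>i::nat. Bochner_Integration.simple_bochner_integrable M (s i)"
    and s0: "(\<lambda>i. \<integral>\<^sup>+x. ennreal (norm (f x - s i x)) \<partial>M) \<longlonglongrightarrow> 0"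
    and sx: "(\<lambda>i. Bochner_Integration.simple_bochner_integral M (s i)) \<longlonglongrightarrow> x"
    by (rule has_bintE[OF assms(1)]) (rule that)
  obtain t where g: "strongly_measurable M g"
    and t: "\<And>i::nat. Bochner_Integration.simple_bochner_integrable M (t i)"
    and t0: "(\<lambda>i. \<integral>\<^sup>+x. ennreal (norm (g x - t i x)) \<partial>M) \<longlonglongrightarrow> 0"
    and ty: "(\<lambda>i. Bochner_Integration.simple_bochner_integral M (t i)) \<longlonglongrightarrow> y"
    by (rule has_bintE[OF assms(2)]) (rule that)
  have ssf: "simple_function M (s i)" "simple_function M (t i)" for i
    using s[of i] t[of i] by (auto elim: simple_bochner_integrable.cases)
  have le: "(\<integral>\<^sup>+x. ennreal (norm ((f x + g x) - (s i x + t i x))) \<partial>M)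
      \<le> (\<integral>\<^sup>+x. ennreal (norm (f x - s i x)) \<partial>M) + (\<integral>\<^sup>+x. ennreal (norm (g x - t i x)) \<partial>M)" for i
  proof -
    obtain h where h: "h \<in> borel_measurable M" "AE x in M. ennreal (norm (f x - s i x)) = h x"
      by (rule norm_diff_simple_AE_measurable[OF f ssf(1)])
    obtain k where k: "k \<in> borel_measurable M" "AE x in M. ennreal (norm (g x - t i x)) = k x"
      by (rule norm_diff_simple_AE_measurable[OF g ssf(2)])
    have "(\<integral>\<^sup>+x. ennreal (norm ((f x + g x) - (s i x + t i x))) \<partial>M) \<le> (\<integral>\<^sup>+x. h x + k x \<partial>M)"
      using h(2) k(2)
    proof (intro nn_integral_mono_AE, eventually_elim)
      case (elim x)
      have "norm ((f x + g x) - (s i x + t i x)) \<le> norm (f x - s i x) + norm (g x - t i x)"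
        by (rule norm_diff_triangle_ineq)
      then have "ennreal (norm ((f x + g x) - (s i x + t i x)))
          \<le> ennreal (norm (f x - s i x)) + ennreal (norm (g x - t i x))"
        by (simp flip: ennreal_plus)
      then show ?case using elim by simp
    qed
    also have "\<dots> = (\<integral>\<^sup>+x. h x \<partial>M) + (\<integral>\<^sup>+x. k x \<partial>M)"
      by (rule nn_integral_add) (use h k in auto)
    also have "(\<integral>\<^sup>+x. h x \<partial>M) = (\<integral>\<^sup>+x. ennreal (norm (f x - s i x)) \<partial>M)"
      using h(2) by (intro nn_integral_cong_AE) auto
    also have "(\<integral>\<^sup>+x. k x \<partial>M) = (\<integral>\<^sup>+x. ennreal (norm (g x - t i x)) \<partial>M)"
      using k(2) by (intro nn_integral_cong_AE) auto
    finally show ?thesis .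
  qed
  have c: "(\<lambda>i. \<integral>\<^sup>+x. ennreal (norm ((f x + g x) - (s i x + t i x))) \<partial>M) \<longlonglongrightarrow> 0"
  proof (rule tendsto_sandwich[where f="\<lambda>_. 0"])
    show "\<forall>\<^sub>F i in sequentially. (\<integral>\<^sup>+x. ennreal (norm ((f x + g x) - (s i x + t i x))) \<partial>M)
        \<le> (\<integral>\<^sup>+x. ennreal (norm (f x - s i x)) \<partial>M) + (\<integral>\<^sup>+x. ennreal (norm (g x - t i x)) \<partial>M)"
      by (intro always_eventually allI le)
    show "(\<lambda>i. (\<integral>\<^sup>+x. ennreal (norm (f x - s i x)) \<partial>M)
        + (\<integral>\<^sup>+x. ennreal (norm (g x - t i x)) \<partial>M)) \<longlonglongrightarrow> 0"
      using tendsto_add[OF s0 t0] by simp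
  qed auto
  have b: "Bochner_Integration.simple_bochner_integrable M (\<lambda>z. s i z + t i z)" for i
    using simple_bochner_integrable_compose2[of "(+)" M "s i" "t i"] s t by simp
  have d: "(\<lambda>i. Bochner_Integration.simple_bochner_integral M (\<lambda>z. s i z + t i z)) \<longlonglongrightarrow> x + y"
    using tendsto_add[OF sx ty] s t by (simp add: simple_bochner_integral_add)
  have a: "strongly_measurable M (\<lambda>z. f z + g z)"
    by (rule strongly_measurable_add[OF f g])
  show ?thesis
    by (rule has_bintI[where s="\<lambda>i z. s i z + t i z", OF a b c d])
qed

text \<open>The library's real integral supplies the approximation in the mean; strong
  measurability, demanded in addition by \<open>has_bint\<close>, comes from pointwise approximation
  of a Borel function by simple ones.\<close>

lemma has_bint_integral:
  fixes f :: "'a \<Rightarrow> real"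
  assumes "integrable M f"
  shows "has_bint M f (integral\<^sup>L M f)"
proof -
  have "has_bochner_integral M f (integral\<^sup>L M f)"
    by (rule has_bochner_integral_integrable) fact
  then have "\<exists>s. (\<forall>i::nat. Bochner_Integration.simple_bochner_integrable M (s i)) \<and>
      (\<lambda>i. \<integral>\<^sup>+x. ennreal (norm (f x - s i x)) \<partial>M) \<longlonglongrightarrow> 0 \<and>
      (\<lambda>i. Bochner_Integration.simple_bochner_integral M (s i)) \<longlonglongrightarrow> integral\<^sup>L M f"
    unfolding has_bochner_integral.simps by simp
  then obtain s where s: "(\<forall>i::nat. Bochner_Integration.simple_bochner_integrable M (s i)) \<and>
      (\<lambda>i. \<integral>\<^sup>+x. ennreal (norm (f x - s i x)) \<partial>M) \<longlonglongrightarrow> 0 \<and>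
      (\<lambda>i. Bochner_Integration.simple_bochner_integral M (s i)) \<longlonglongrightarrow> integral\<^sup>L M f"
    by (rule exE)
  have "f \<in> borel_measurable M" using assms by auto
  from borel_measurable_implies_sequence_metric[OF this, of 0] obtain F where
    F: "(\<forall>i::nat. simple_function M (F i)) \<and>
      (\<forall>x\<in>space M. (\<lambda>i. F i x) \<longlonglongrightarrow> f x) \<and>
      (\<forall>i. \<forall>x\<in>space M. dist (F i x) 0 \<le> 2 * dist (f x) 0)"
    by (rule exE)
  have "strongly_measurable M f"
    by (rule strongly_measurableI[where u=F]) (use F in simp_all)
  then show ?thesis
    by (rule has_bintI[where s=s]) (use s in simp_all)
qed

lemma has_bint_sum_scaleR:
  fixes f :: "'i \<Rightarrow> 'a \<Rightarrow> real" and w :: "'i \<Rightarrow> 'b::real_normed_vector"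
  assumes "finite I" "\<And>i. i \<in> I \<Longrightarrow> integrable M (f i)"
  shows "has_bint M (\<lambda>y. \<Sum>i\<in>I. f i y *\<^sub>R w i) (\<Sum>i\<in>I. integral\<^sup>L M (f i) *\<^sub>R w i)"
  using assms
proof (induction I rule: finite_induct)
  case empty
  have "has_bint M (\<lambda>y. (0::real) *\<^sub>R (0::'b)) (integral\<^sup>L M (\<lambda>y. 0::real) *\<^sub>R 0)"
    by (intro has_bint_bounded_linear[OF bounded_linear_scaleR_left] has_bint_integral) simp
  then show ?case by simp
next
  case (insert i I)
  then show ?case
    by (simp add: has_bint_add has_bint_bounded_linear[OF bounded_linear_scaleR_left] has_bint_integral)
qed

text \<open>Strong measurability gives simple functions converging almost everywhere, but with no
  dominating function. Truncation at twice the norm of the limit provides one, so dominated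
  convergence gives convergence in the mean, and completeness a limit of the integrals. Finiteness
  of the measure turns square integrability into integrability.\<close>

lemma has_bint_in_L2:
  fixes f :: "'a \<Rightarrow> 'b::{real_normed_vector, complete_space}"
  assumes M: "finite_measure M" and f: "in_L2 M f"
  shows "\<exists>x. has_bint M f x"
proof -
  interpret finite_measure M by fact
  have fm: "strongly_measurable M f" and fin2: "(\<integral>\<^sup>+y. ennreal ((norm (f y))\<^sup>2) \<partial>M) < \<infinity>"
    using f by (auto simp: in_L2_def)
  obtain u where u: "\<And>i::nat. simple_function M (u i)"
    and lim: "AE x in M. (\<lambda>i. u i x) \<longlonglongrightarrow> f x"
    by (rule strongly_measurableE[OF fm]) (rule that)
  obtain h0 where h0: "h0 \<in> borel_measurable M" "AE x in M. ennreal (norm (f x - 0)) = h0 x"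
    by (rule norm_diff_simple_AE_measurable[OF fm simple_function_const[of M 0]])
  define g where "g x = enn2real (h0 x)" for x
  have g[measurable]: "g \<in> borel_measurable M" unfolding g_def using h0(1) by measurable
  have gf: "AE x in M. g x = norm (f x)"
    using h0(2) unfolding g_def by eventually_elim (metis diff_zero enn2real_ennreal norm_ge_zero)
  have "(\<integral>\<^sup>+x. ennreal (g x) \<partial>M) \<le> (\<integral>\<^sup>+x. ennreal 1 + ennreal ((g x)\<^sup>2) \<partial>M)"
  proof (rule nn_integral_mono)
    fix x
    have "0 \<le> g x" by (simp add: g_def)
    then have "g x \<le> 1 + (g x)\<^sup>2"
      using zero_le_power2[of "g x - 1"] by (simp add: power2_eq_square algebra_simps)
    then have "ennreal (g x) \<le> ennreal (1 + (g x)\<^sup>2)" by (rule ennreal_leI)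
    also have "\<dots> = ennreal 1 + ennreal ((g x)\<^sup>2)" by (rule ennreal_plus) auto
    finally show "ennreal (g x) \<le> ennreal 1 + ennreal ((g x)\<^sup>2)" .
  qed
  also have "\<dots> = (\<integral>\<^sup>+x. ennreal 1 \<partial>M) + (\<integral>\<^sup>+x. ennreal ((g x)\<^sup>2) \<partial>M)"
    by (rule nn_integral_add) auto
  also have "(\<integral>\<^sup>+x. ennreal ((g x)\<^sup>2) \<partial>M) = (\<integral>\<^sup>+y. ennreal ((norm (f y))\<^sup>2) \<partial>M)"
    using gf by (intro nn_integral_cong_AE) auto
  also have "(\<integral>\<^sup>+x. ennreal 1 \<partial>M) + \<dots> < \<infinity>"
    using fin2 by (auto simp: emeasure_eq_measure)
  finally have fin1: "(\<integral>\<^sup>+x. ennreal (g x) \<partial>M) < \<infinity>" .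
  \<comment> \<open>The factor 2 leaves room: where \<open>f x\<close> is nonzero,
    \<open>norm (u i x) < 2 * norm (f x)\<close> eventually and nothing is cut; where
    \<open>f x = 0\<close>, the truncated values vanish.\<close>
  define t where "t i x = (if norm (u i x) \<le> 2 * g x then u i x else 0)" for i x
  have un[measurable]: "(\<lambda>x. norm (u i x)) \<in> borel_measurable M" for i
    by (rule borel_measurable_simple_function[OF simple_function_compose1[OF u]])
  have tsf: "simple_function M (t i)" for i
    unfolding t_def by (intro simple_function_If u) auto
  have tle: "norm (t i x) \<le> 2 * g x" for i x
    by (auto simp: t_def g_def)
  have "(\<integral>\<^sup>+x. ennreal (norm (t i x)) \<partial>M) < \<infinity>" for i
  proof -
    have "(\<integral>\<^sup>+x. ennreal (norm (t i x)) \<partial>M) \<le> (\<integral>\<^sup>+x. ennreal 2 * ennreal (g x) \<partial>M)"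
    proof (rule nn_integral_mono)
      fix x
      have "ennreal (norm (t i x)) \<le> ennreal (2 * g x)" by (rule ennreal_leI[OF tle])
      also have "\<dots> = ennreal 2 * ennreal (g x)" by (rule ennreal_mult) (auto simp: g_def)
      finally show "ennreal (norm (t i x)) \<le> ennreal 2 * ennreal (g x)" .
    qed
    also have "\<dots> = ennreal 2 * (\<integral>\<^sup>+x. ennreal (g x) \<partial>M)"
      by (rule nn_integral_cmult) auto
    also have "\<dots> < \<infinity>" using fin1 by (simp add: ennreal_mult_less_top)
    finally show ?thesis .
  qed
  then have t: "Bochner_Integration.simple_bochner_integrable M (t i)" for i
    by (intro simple_bochner_integrableI_bounded tsf)
  have "\<exists>h. h \<in> borel_measurable M \<and> (AE x in M. ennreal (norm (f x - t i x)) = h x)" for i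
    by (rule norm_diff_simple_AE_measurable[OF fm tsf[of i]]) blast
  then obtain k where k: "\<And>i. k i \<in> borel_measurable M"
    "\<And>i. AE x in M. ennreal (norm (f x - t i x)) = k i x" by metis
  have kf: "AE x in M. \<forall>i. ennreal (norm (f x - t i x)) = k i x"
    using k(2) by (simp add: AE_all_countable)
  have "(\<lambda>i. \<integral>\<^sup>+x. k i x \<partial>M) \<longlonglongrightarrow> (\<integral>\<^sup>+x. 0 \<partial>M)"
  proof (rule nn_integral_dominated_convergence[where w="\<lambda>x. ennreal 3 * ennreal (g x)"])
    show "AE x in M. k i x \<le> ennreal 3 * ennreal (g x)" for i
      using kf gf
    proof eventually_elim
      case (elim x)
      have "norm (f x - t i x) \<le> 3 * g x"
        using norm_triangle_ineq4[of "f x" "t i x"] tle[of i x] elim by simp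
      then have "ennreal (norm (f x - t i x)) \<le> ennreal (3 * g x)" by (rule ennreal_leI)
      also have "\<dots> = ennreal 3 * ennreal (g x)" by (rule ennreal_mult) (auto simp: g_def)
      finally show ?case using elim(1) by simp
    qed
    show "(\<integral>\<^sup>+x. ennreal 3 * ennreal (g x) \<partial>M) < \<infinity>"
      using fin1 by (subst nn_integral_cmult) (auto simp: ennreal_mult_less_top)
    show "AE x in M. (\<lambda>i. k i x) \<longlonglongrightarrow> 0"
      using kf gf lim
    proof eventually_elim
      case (elim x)
      have "(\<lambda>i. t i x) \<longlonglongrightarrow> f x"
      proof (cases "f x = 0")
        case True
        have "(\<lambda>i. norm (t i x)) \<longlonglongrightarrow> 0"
          by (rule tendsto_sandwich[where f="\<lambda>_. 0" and h="\<lambda>_. 0"])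
             (use tle[of _ x] elim True in auto)
        then show ?thesis using True by (simp add: tendsto_norm_zero_iff)
      next
        case False
        have "(\<lambda>i. norm (u i x)) \<longlonglongrightarrow> norm (f x)" by (intro tendsto_intros elim)
        moreover have "norm (f x) < 2 * norm (f x)" using False by simp
        ultimately have "\<forall>\<^sub>F i in sequentially. norm (u i x) < 2 * norm (f x)"
          by (rule order_tendstoD)
        then have "\<forall>\<^sub>F i in sequentially. u i x = t i x"
          by eventually_elim (use elim in \<open>auto simp: t_def\<close>)
        then show ?thesis using elim(3) by (rule Lim_transform_eventually[rotated])
      qed
      then have "(\<lambda>i. ennreal (norm (f x - t i x))) \<longlonglongrightarrow> ennreal (norm (f x - f x))"
        by (intro tendsto_ennrealI tendsto_intros)
      then show ?case using elim by simp
    qed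
  qed (use k in auto)
  moreover have "(\<integral>\<^sup>+x. k i x \<partial>M) = (\<integral>\<^sup>+x. ennreal (norm (f x - t i x)) \<partial>M)" for i
    using k(2)[of i] by (intro nn_integral_cong_AE) auto
  ultimately have t0: "(\<lambda>i. \<integral>\<^sup>+x. ennreal (norm (f x - t i x)) \<partial>M) \<longlonglongrightarrow> 0" by simp
  let ?t = "\<lambda>i. Bochner_Integration.simple_bochner_integral M (t i)"
  have "Cauchy ?t"
  proof (rule CauchyI)
    fix e :: real assume "e > 0"
    then have "\<forall>\<^sub>F i in sequentially. (\<integral>\<^sup>+x. ennreal (norm (f x - t i x)) \<partial>M) < ennreal (e / 2)"
      using order_tendstoD(2)[OF t0, of "ennreal (e/2)"] by simp
    then obtain N where N: "\<And>i. i \<ge> N \<Longrightarrow> (\<integral>\<^sup>+x. ennreal (norm (f x - t i x)) \<partial>M) < ennreal (e / 2)"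
      by (auto simp: eventually_sequentially)
    have "norm (?t m - ?t n) < e" if "m \<ge> N" "n \<ge> N" for m n
    proof -
      have "ennreal (norm (?t m - ?t n)) \<le> (\<integral>\<^sup>+x. ennreal (norm (f x - t m x)) \<partial>M)
          + (\<integral>\<^sup>+x. ennreal (norm (f x - t n x)) \<partial>M)"
        by (rule norm_simple_bochner_integral_diff_le[OF fm t t])
      also have "\<dots> < ennreal (e/2) + ennreal (e/2)"
        by (intro add_strict_mono N that)
      also have "\<dots> = ennreal e" using \<open>e > 0\<close> by (simp flip: ennreal_plus)
      finally show ?thesis by (simp add: ennreal_less_iff)
    qed
    then show "\<exists>N. \<forall>m\<ge>N. \<forall>n\<ge>N. norm (?t m - ?t n) < e" by blast
  qed
  then obtain x where "?t \<longlonglongrightarrow> x"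
    using Cauchy_convergent convergent_def by blast
  then show ?thesis
    using has_bintI[OF fm t t0] by blast
qed


section \<open>Interpolation at Chebyshev nodes\<close>

text \<open>Jordan's inequality: \<open>sin\<close> is concave on the interval and the left side is
  its chord.\<close>

lemma sin_ge_linear:
  assumes "0 \<le> x" "x \<le> pi / 2"
  shows "2 * x / pi \<le> sin x"
proof -
  have "convex_on {0..pi/2} (\<lambda>x. - sin x)"
  proof (rule convex_on_realI[where f'="\<lambda>x. - cos x"])
    show "((\<lambda>x. - sin x) has_real_derivative - cos x) (at x)" for x :: real
      by (auto intro!: derivative_eq_intros)
    show "- cos x \<le> - cos y" if "x \<in> {0..pi/2}" "y \<in> {0..pi/2}" "x \<le> y" for x y :: real
      using that cos_monotone_0_pi_le[of x y] pi_gt_zero by auto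
  qed auto
  then have "- sin ((1 - 2*x/pi) *\<^sub>R 0 + (2*x/pi) *\<^sub>R (pi/2))
      \<le> (1 - 2*x/pi) * - sin 0 + (2*x/pi) * - sin (pi/2)"
    using assms by (intro convex_onD) (auto simp: field_simps)
  then show ?thesis by simp
qed

text \<open>Chebyshev polynomials of the first kind, used to exhibit a cosine sum in
  \<open>t\<close> as a polynomial in \<open>cos t\<close>.\<close>

fun cheb :: "nat \<Rightarrow> real poly" where
  "cheb 0 = 1"
| "cheb (Suc 0) = [:0, 1:]"
| "cheb (Suc (Suc n)) = [:0, 2:] * cheb (Suc n) - cheb n"

lemma poly_cheb_cos: "poly (cheb n) (cos t) = cos (real n * t)"
proof (induction n rule: cheb.induct)
  case (3 n)
  have "cos (real (Suc (Suc n)) * t) + cos (real n * t) = 2 * cos t * cos (real (Suc n) * t)"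
    using cos_times_cos[of t "real (Suc n) * t"] by (simp add: algebra_simps)
  then show ?case using 3 by (simp add: algebra_simps)
qed auto

lemma degree_cheb_le: "degree (cheb n) \<le> n"
proof (induction n rule: cheb.induct)
  case (3 n)
  have "degree ([:0, 2:] * cheb (Suc n)) \<le> Suc (Suc n)"
    using degree_mult_le[of "[:0, 2:]" "cheb (Suc n)"] 3 by simp
  then show ?case using 3 by (auto intro!: degree_diff_le)
qed auto

text \<open>The Dirichlet kernel of order \<open>n - 1\<close>, which is
  \<open>sin ((n - 1/2) * x) / sin (x / 2)\<close>. The order is one below \<open>n\<close> because
  Lagrange polynomials on \<open>n\<close> nodes have degree \<open>n - 1\<close>.\<close>

definition dirichlet :: "nat \<Rightarrow> real \<Rightarrow> real" where
  "dirichlet n x = 1 + 2 * (\<Sum>l=1..<n. cos (real l * x))"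

lemma dirichlet_0: "n \<ge> 1 \<Longrightarrow> dirichlet n 0 = 2 * real n - 1"
  by (simp add: dirichlet_def of_nat_diff)

lemma dirichlet_minus: "dirichlet n (- x) = dirichlet n x"
  by (simp add: dirichlet_def)

lemma dirichlet_abs: "dirichlet n \<bar>x\<bar> = dirichlet n x"
  by (auto simp: abs_if dirichlet_minus)

lemma dirichlet_periodic: "dirichlet n (x + 2 * pi) = dirichlet n x"
proof -
  have "cos (real l * (x + 2 * pi)) = cos (real l * x)" for l
  proof -
    have "real l * (x + 2 * pi) = real l * x + 2 * real l * pi" by (simp add: algebra_simps)
    then show ?thesis by (simp only: cos_add cos_2npi sin_2npi mult_1_right mult_zero_right diff_zero)
  qed
  then show ?thesis by (simp add: dirichlet_def)
qed

lemma abs_dirichlet_le: "n \<ge> 1 \<Longrightarrow> \<bar>dirichlet n x\<bar> \<le> 2 * real n - 1"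
proof -
  assume "n \<ge> 1"
  have "\<bar>\<Sum>l=1..<n. cos (real l * x)\<bar> \<le> (\<Sum>l=1..<n. \<bar>cos (real l * x)\<bar>)"
    by (rule sum_abs)
  also have "\<dots> \<le> (\<Sum>l=1..<n. 1)"
    by (rule sum_mono) simp
  also have "\<dots> = real n - 1" using \<open>n \<ge> 1\<close> by (simp add: of_nat_diff)
  finally show ?thesis unfolding dirichlet_def by linarith
qed

text \<open>Multiplication by \<open>sin (x / 2)\<close> makes the cosine sum telescope.\<close>

lemma dirichlet_mult_sin:
  assumes "n \<ge> 1"
  shows "dirichlet n x * sin (x / 2) = sin ((real n - 1/2) * x)"
  using assms
proof (induction n rule: dec_induct)
  case base
  then show ?case by (simp add: dirichlet_def)
next
  case (step n)
  have "2 * cos (real n * x) * sin (x / 2) = sin ((real n + 1/2) * x) - sin ((real n - 1/2) * x)"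
    using cos_times_sin[of "real n * x" "x / 2"] by (simp add: algebra_simps)
  moreover have "dirichlet (Suc n) x = dirichlet n x + 2 * cos (real n * x)"
    using step by (simp add: dirichlet_def algebra_simps)
  ultimately show ?case using step by (simp add: algebra_simps)
qed

text \<open>The closed form has a numerator of modulus at most 1, and Jordan's inequality gives
  \<open>x / pi \<le> sin (x / 2)\<close>.\<close>

lemma abs_dirichlet_le_pi_div:
  assumes "n \<ge> 1" "0 < x" "x \<le> pi"
  shows "\<bar>dirichlet n x\<bar> \<le> pi / x"
proof -
  have "x / pi \<le> sin (x / 2)" using sin_ge_linear[of "x/2"] assms by simp
  moreover have "x / pi > 0" using assms by simp
  ultimately have s: "sin (x / 2) > 0" "x / pi \<le> sin (x / 2)" by auto
  have "\<bar>dirichlet n x\<bar> * (x / pi) \<le> \<bar>dirichlet n x\<bar> * sin (x / 2)"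
    using s by (intro mult_left_mono) auto
  also have "\<dots> = \<bar>dirichlet n x * sin (x / 2)\<bar>" using s by (simp add: abs_mult)
  also have "\<dots> \<le> 1" by (simp only: dirichlet_mult_sin[OF assms(1)] abs_sin_le_one)
  finally show ?thesis using assms by (simp add: field_simps)
qed

text \<open>At \<open>x = i * pi / n\<close> the argument \<open>(n - 1/2) * x\<close> equals
  \<open>i * pi - x / 2\<close>, so numerator and denominator of the closed form agree up to
  sign.\<close>

lemma dirichlet_grid:
  assumes "n \<ge> 1" "0 < i" "i < 2 * n"
  shows "dirichlet n (real i * pi / real n) = - ((-1) ^ i)"
proof -
  let ?x = "real i * pi / real n"
  have pos: "sin (?x / 2) > 0"
    by (rule sin_gt_zero) (use assms in \<open>auto simp: field_simps\<close>)
  have "sin ((real n - 1/2) * ?x) = sin (real i * pi - ?x / 2)"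
    using assms by (intro arg_cong[where f=sin]) (simp add: field_simps)
  then have eq: "dirichlet n ?x * sin (?x / 2) = - ((-1) ^ i) * sin (?x / 2)"
    by (simp only: dirichlet_mult_sin[OF assms(1)]) (simp add: sin_diff)
  show ?thesis
    by (rule mult_right_cancel[THEN iffD1, OF _ eq]) (use pos in simp)
qed

section \<open>Chebyshev nodes and their Lagrange polynomials\<close>

definition node_angle :: "nat \<Rightarrow> nat \<Rightarrow> real" where
  "node_angle m k = pi - (2 * real k + 1) * pi / (2 * (real m + 1))"

lemma node_eq_cos: "node m k = cos (node_angle m k)"
  by (simp add: node_def node_angle_def)

lemma node_angle_bounds: "k \<le> m \<Longrightarrow> 0 \<le> node_angle m k \<and> node_angle m k \<le> pi"
  using mult_left_mono[of "2 * real k + 1" "2 * (real m + 1)" pi]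
  by (simp add: node_angle_def field_simps)

lemma inj_on_node: "inj_on (node m) {0..m}"
proof (rule inj_onI)
  fix j k assume jk: "j \<in> {0..m}" "k \<in> {0..m}" "node m j = node m k"
  then have "node_angle m j = node_angle m k"
    using node_angle_bounds[of j m] node_angle_bounds[of k m] cos_inj_pi
    by (auto simp: node_eq_cos)
  then show "j = k" by (simp add: node_angle_def field_simps)
qed

lemma node_bounds: "node m k \<in> {-1..1}"
  by (simp add: node_def)

definition lagrange_poly :: "nat \<Rightarrow> nat \<Rightarrow> real poly" where
  "lagrange_poly m k = (\<Prod>j\<in>{0..m} - {k}. smult (1 / (node m k - node m j)) [:- node m j, 1:])"

lemma poly_lagrange_poly: "poly (lagrange_poly m k) y = lagrange m k y"
  by (simp add: lagrange_poly_def lagrange_def poly_prod diff_divide_distrib)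

lemma degree_lagrange_poly: "k \<le> m \<Longrightarrow> degree (lagrange_poly m k) \<le> m"
proof -
  assume "k \<le> m"
  have "degree (lagrange_poly m k)
      \<le> (\<Sum>j\<in>{0..m} - {k}. degree (smult (1 / (node m k - node m j)) [:- node m j, 1:]))"
    unfolding lagrange_poly_def by (rule order_trans[OF degree_prod_sum_le]) (auto simp: o_def)
  also have "\<dots> \<le> (\<Sum>j\<in>{0..m} - {k}. 1)"
    by (rule sum_mono) simp
  also have "\<dots> = m" using \<open>k \<le> m\<close> by simp
  finally show ?thesis .
qed

lemma lagrange_node:
  assumes "k \<le> m" "j \<le> m"
  shows "lagrange m k (node m j) = (if j = k then 1 else 0)"
proof (cases "j = k")
  case True
  have "node m k - node m i \<noteq> 0" if "i \<in> {0..m} - {k}" for i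
    using inj_onD[OF inj_on_node, of m k i] that assms by auto
  then show ?thesis using True by (auto simp: lagrange_def intro!: prod.neutral)
next
  case False
  then show ?thesis using assms by (auto simp: lagrange_def)
qed

lemma poly_eq_on_nodes:
  assumes "degree p \<le> m" "degree q \<le> m" "\<And>j. j \<le> m \<Longrightarrow> poly p (node m j) = poly q (node m j)"
  shows "p = q"
  by (rule poly_eqI_degree[where A="node m ` {0..m}"])
     (use assms in \<open>auto simp: card_image inj_on_node\<close>)

lemma interp_poly:
  assumes "degree p \<le> m"
  shows "interp m (poly p) y = poly p y"
proof -
  define q where "q = (\<Sum>k=0..m. smult (poly p (node m k)) (lagrange_poly m k))"
  have "degree q \<le> m"
    unfolding q_def by (rule degree_sum_le) (auto intro: order_trans[OF degree_smult_le] degree_lagrange_poly)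
  moreover have "poly q (node m j) = poly p (node m j)" if "j \<le> m" for j
    using that by (simp add: q_def poly_sum poly_lagrange_poly lagrange_node if_distrib cong: if_cong)
  ultimately have "q = p" using assms by (intro poly_eq_on_nodes) auto
  moreover have "poly q y = interp m (poly p) y"
    by (simp add: q_def interp_def poly_sum poly_lagrange_poly mult.commute)
  ultimately show ?thesis by simp
qed

text \<open>The polynomial \<open>q\<close> is \<open>(1 + 2 * \<Sum> T_l(x_k) T_l) / n\<close>, the
  kernel of discrete Chebyshev orthogonality. It has degree at most \<open>m\<close>, so it suffices
  to compare values at the nodes. For \<open>j\<close> different from \<open>k\<close> the two
  Dirichlet values are opposite signs and cancel; for \<open>j = k\<close> they are
  \<open>2 * n - 1\<close> and 1.\<close>

lemma lagrange_cos:
  assumes "k \<le> m"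
  shows "lagrange m k (cos t) = (dirichlet (Suc m) (t - node_angle m k)
    + dirichlet (Suc m) (t + node_angle m k)) / (2 * real (Suc m))"
proof -
  let ?n = "Suc m"
  define q where "q = smult (1 / real ?n) (1 + smult 2
    (\<Sum>l=1..<?n. smult (cos (real l * node_angle m k)) (cheb l)))"
  have q: "poly q (cos t) = (dirichlet ?n (t - node_angle m k) + dirichlet ?n (t + node_angle m k))
      / (2 * real ?n)" for t
  proof -
    have "dirichlet ?n (t - node_angle m k) + dirichlet ?n (t + node_angle m k)
        = 2 + 2 * (\<Sum>l=1..<?n. cos (real l * (t - node_angle m k)) + cos (real l * (t + node_angle m k)))"
      by (simp add: dirichlet_def sum.distrib)
    also have "(\<Sum>l=1..<?n. cos (real l * (t - node_angle m k)) + cos (real l * (t + node_angle m k)))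
        = (\<Sum>l=1..<?n. 2 * (cos (real l * node_angle m k) * cos (real l * t)))"
      by (rule sum.cong) (simp_all add: cos_add cos_diff algebra_simps)
    finally show ?thesis
      by (simp add: q_def poly_sum poly_cheb_cos sum_distrib_left field_simps del: sum.op_ivl_Suc)
  qed
  define h where "h = pi / (2 * real ?n)"
  have pih: "pi = 2 * real ?n * h" by (simp add: h_def field_simps)
  have angle: "node_angle m i = (2 * (real m - real i) + 1) * h" for i
    by (simp add: node_angle_def h_def field_simps)
  have grid: "x * pi / real ?n = 2 * x * h" for x
    by (simp add: h_def field_simps)
  have "degree (\<Sum>l=1..<?n. smult (cos (real l * node_angle m k)) (cheb l)) \<le> m"
    by (rule degree_sum_le) (auto intro!: order_trans[OF degree_smult_le] order_trans[OF degree_cheb_le])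
  then have "degree q \<le> m"
    unfolding q_def by (intro order_trans[OF degree_smult_le] degree_add_le) auto
  moreover have "poly q (node m j) = poly (lagrange_poly m k) (node m j)" if "j \<le> m" for j
  proof -
    \<comment> \<open>Both angles are odd multiples of half a grid step, so their sum is a whole
      grid point. Reflection and the period 2 pi bring it to \<open>j + k + 1\<close> steps,
      strictly between 0 and \<open>2 * n\<close>.\<close>
    have plus: "dirichlet ?n (node_angle m j + node_angle m k) = (-1) ^ (j + k)"
    proof -
      have "node_angle m j + node_angle m k = - (real (j + k + 1) * pi / real ?n) + 2 * pi"
        unfolding grid angle by (subst pih) (simp add: algebra_simps)
      then have "dirichlet ?n (node_angle m j + node_angle m k) = dirichlet ?n (real (j + k + 1) * pi / real ?n)"
        by (simp only: dirichlet_periodic dirichlet_minus)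
      also have "\<dots> = - ((-1) ^ (j + k + 1))"
        by (rule dirichlet_grid) (use that assms in auto)
      finally show ?thesis by simp
    qed
    have qj: "poly q (node m j) = (dirichlet ?n (node_angle m j - node_angle m k)
        + dirichlet ?n (node_angle m j + node_angle m k)) / (2 * real ?n)"
      by (subst node_eq_cos) (rule q)
    show ?thesis
    proof (cases "j = k")
      case True
      then show ?thesis
        using plus dirichlet_0[of ?n]
        by (simp add: poly_lagrange_poly lagrange_node assms qj[unfolded True])
    next
      case False
      let ?i = "if j < k then k - j else j - k"
      have "\<bar>node_angle m j - node_angle m k\<bar> = real ?i * pi / real ?n"
      proof (cases "j < k")
        case True
        have "node_angle m j - node_angle m k = real ?i * pi / real ?n"
          using True unfolding grid angle by (simp add: algebra_simps of_nat_diff)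
        then show ?thesis by simp
      next
        case False
        have "node_angle m j - node_angle m k = - (real ?i * pi / real ?n)"
          using False unfolding grid angle by (simp add: algebra_simps of_nat_diff)
        then show ?thesis by simp
      qed
      then have "dirichlet ?n (node_angle m j - node_angle m k) = dirichlet ?n (real ?i * pi / real ?n)"
        by (subst dirichlet_abs[symmetric]) (simp only:)
      also have "\<dots> = - ((-1) ^ ?i)"
        by (rule dirichlet_grid) (use that assms False in auto)
      also have "\<dots> = - ((-1) ^ (j + k))"
        by (auto simp: minus_one_power_iff)
      finally show ?thesis
        using plus False
        by (simp add: poly_lagrange_poly lagrange_node assms that qj)
    qed
  qed
  ultimately have "q = lagrange_poly m k"
    using degree_lagrange_poly[OF assms] by (intro poly_eq_on_nodes) auto
  then show ?thesis using q[of t] by (simp add: poly_lagrange_poly)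
qed

section \<open>The Lebesgue constant of the Chebyshev nodes\<close>

lemma sum_int_periodic:
  fixes F :: "int \<Rightarrow> real"
  assumes "\<And>i. F (i + int N) = F i"
  shows "(\<Sum>i\<in>{a..<a + int N}. F i) = (\<Sum>i\<in>{b..<b + int N}. F i)"
proof (cases "N = 0")
  case False
  have step: "(\<Sum>i\<in>{a + 1..<a + 1 + int N}. F i) = (\<Sum>i\<in>{a..<a + int N}. F i)" for a
  proof -
    have "{a..<a + int N} = insert a {a + 1..<a + int N}"
      "{a + 1..<a + 1 + int N} = insert (a + int N) {a + 1..<a + int N}"
      using False by auto
    then show ?thesis using assms[of a] by simp
  qed
  have "(\<Sum>i\<in>{a..<a + int N}. F i) = (\<Sum>i\<in>{0..<0 + int N}. F i)" for a
  proof (induction a rule: int_induct[where k=0])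
    case (step2 i)
    then show ?case using step[of "i - 1"] by simp
  qed (simp_all add: step)
  then show ?thesis by metis
qed simp

text \<open>The points \<open>t - node_angle m k\<close> and \<open>t + node_angle m k\<close>
  together fill a full period of \<open>2 * n\<close> equispaced points. Centring the period at
  \<open>t\<close> leaves, for each \<open>j < n\<close>, two points at distance at least
  \<open>j * w\<close>, so the kernel bound \<open>n / j\<close> sums to a harmonic number.\<close>

lemma lebesgue_constant_le:
  assumes "y \<in> {-1..1}"
  shows "(\<Sum>k=0..m. \<bar>lagrange m k y\<bar>) \<le> 3 + ln (real m + 1)"
proof -
  let ?n = "Suc m"
  define t where "t = arccos y"
  have y: "y = cos t" using assms by (simp add: t_def)
  define w where "w = pi / real ?n"
  have w: "w > 0" "real ?n * w = pi" by (simp_all add: w_def)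
  define \<psi> where "\<psi> i = (real_of_int i + 1/2) * w" for i :: int
  have angle: "node_angle m k = real ?n * w - (real k + 1/2) * w" for k
  proof -
    have "(real k + 1/2) * w = (2 * real k + 1) * pi / (2 * (real m + 1))"
      by (simp add: w_def field_simps)
    then show ?thesis unfolding w(2) node_angle_def by simp
  qed
  define F where "F i = \<bar>dirichlet ?n (t - \<psi> i)\<bar>" for i
  have per: "F (i + int (2 * ?n)) = F i" for i
  proof -
    have "t - \<psi> i = (t - \<psi> (i + int (2 * ?n))) + 2 * pi"
      unfolding w(2)[symmetric] by (simp add: \<psi>_def algebra_simps)
    then show ?thesis unfolding F_def by (simp only: dirichlet_periodic)
  qed
  have "(\<Sum>k=0..m. \<bar>lagrange m k y\<bar>)
      \<le> (\<Sum>k=0..m. (F (int m - int k) + F (int k - int ?n)) / (2 * real ?n))"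
  proof (rule sum_mono)
    fix k assume k: "k \<in> {0..m}"
    have "t - node_angle m k = t - \<psi> (int m - int k)" "t + node_angle m k = t - \<psi> (int k - int ?n)"
      using k by (simp_all add: angle \<psi>_def algebra_simps)
    then have "lagrange m k y = (dirichlet ?n (t - \<psi> (int m - int k))
        + dirichlet ?n (t - \<psi> (int k - int ?n))) / (2 * real ?n)"
      using k lagrange_cos[of k m t] by (simp add: y)
    then show "\<bar>lagrange m k y\<bar> \<le> (F (int m - int k) + F (int k - int ?n)) / (2 * real ?n)"
      unfolding F_def by (simp add: abs_divide divide_right_mono)
  qed
  also have "\<dots> = ((\<Sum>k=0..m. F (int m - int k)) + (\<Sum>k=0..m. F (int k - int ?n))) / (2 * real ?n)"
    by (simp add: sum_divide_distrib sum.distrib add_divide_distrib)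
  also have "(\<Sum>k=0..m. F (int m - int k)) = (\<Sum>i\<in>{0..<int ?n}. F i)"
    by (rule sum.reindex_bij_witness[where i="\<lambda>i. nat (int m - i)" and j="\<lambda>k. int m - int k"]) auto
  also have "(\<Sum>k=0..m. F (int k - int ?n)) = (\<Sum>i\<in>{- int ?n..<0}. F i)"
    by (rule sum.reindex_bij_witness[where i="\<lambda>i. nat (i + int ?n)" and j="\<lambda>k. int k - int ?n"]) auto
  also have "(\<Sum>i\<in>{0..<int ?n}. F i) + (\<Sum>i\<in>{- int ?n..<0}. F i) = (\<Sum>i\<in>{- int ?n..<- int ?n + int (2 * ?n)}. F i)"
    by (subst sum.union_disjoint[symmetric]) (auto intro!: sum.cong)
  finally have 1: "(\<Sum>k=0..m. \<bar>lagrange m k y\<bar>)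
    \<le> (\<Sum>i\<in>{- int ?n..<- int ?n + int (2 * ?n)}. F i) / (2 * real ?n)" .
  \<comment> \<open>The last grid point not beyond \<open>t\<close>; \<open>r\<close> is its
    distance from \<open>t\<close>.\<close>
  define i0 where "i0 = \<lfloor>t / w - 1/2\<rfloor>"
  define r where "r = t - \<psi> i0"
  have r: "0 \<le> r" "r \<le> w"
  proof -
    have "real_of_int i0 + 1/2 \<le> t / w" "t / w \<le> real_of_int i0 + 1/2 + 1"
      unfolding i0_def by linarith+
    then have "(real_of_int i0 + 1/2) * w \<le> t" "t \<le> (real_of_int i0 + 1/2 + 1) * w"
      using w by (simp_all only: pos_le_divide_eq pos_divide_le_eq)
    then show "0 \<le> r" "r \<le> w"
      unfolding r_def \<psi>_def by (simp_all add: algebra_simps)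
  qed
  \<comment> \<open>The nearest point on either side can be arbitrarily close to \<open>t\<close>,
    so only the trivial kernel bound is available for \<open>j = 0\<close>.\<close>
  define B where "B j = (if j = 0 then 2 * real ?n - 1 else real ?n / real j)" for j :: nat
  have bound: "\<bar>dirichlet ?n x\<bar> \<le> B j" if "real j * w \<le> \<bar>x\<bar>" "\<bar>x\<bar> \<le> pi" for x j
  proof (cases "j = 0")
    case True
    then show ?thesis using abs_dirichlet_le[of ?n x] by (simp add: B_def)
  next
    case False
    have pos: "0 < real j * w" using False w by simp
    have "\<bar>dirichlet ?n x\<bar> = \<bar>dirichlet ?n \<bar>x\<bar>\<bar>" by (simp add: dirichlet_abs)
    also have "\<dots> \<le> pi / \<bar>x\<bar>" using pos that by (intro abs_dirichlet_le_pi_div) auto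
    also have "pi / \<bar>x\<bar> \<le> pi / (real j * w)"
    proof -
      have "0 < \<bar>x\<bar>" using pos that(1) by (rule less_le_trans)
      then show ?thesis
        using pos that(1) by (intro divide_left_mono) (simp_all only: mult_pos_pos pi_ge_zero)
    qed
    also have "\<dots> = B j" using False by (simp add: B_def w_def)
    finally show ?thesis .
  qed
  have jb: "(real j + 1) * w \<le> pi" if "j < ?n" for j
    unfolding w(2)[symmetric] using that w by (intro mult_right_mono) auto
  \<comment> \<open>The window is shifted so that \<open>n\<close> points lie at or before
    \<open>i0\<close> and \<open>n\<close> after it; \<open>j\<close> counts outwards on each
    side.\<close>
  have "(\<Sum>i\<in>{- int ?n..<- int ?n + int (2 * ?n)}. F i)
      = (\<Sum>i\<in>{i0 - int m..<(i0 - int m) + int (2 * ?n)}. F i)"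
    using per by (rule sum_int_periodic)
  also have "{i0 - int m..<(i0 - int m) + int (2 * ?n)} = {i0 - int m..i0} \<union> {i0 + 1..i0 + int ?n}"
    by auto
  also have "(\<Sum>i\<in>\<dots>. F i) = (\<Sum>i\<in>{i0 - int m..i0}. F i) + (\<Sum>i\<in>{i0 + 1..i0 + int ?n}. F i)"
    by (rule sum.union_disjoint) auto
  also have "(\<Sum>i\<in>{i0 - int m..i0}. F i) = (\<Sum>j<?n. F (i0 - int j))"
    by (rule sum.reindex_bij_witness[where j="\<lambda>i. nat (i0 - i)" and i="\<lambda>k. i0 - int k"]) auto
  also have "(\<Sum>i\<in>{i0 + 1..i0 + int ?n}. F i) = (\<Sum>j<?n. F (i0 + 1 + int j))"
    by (rule sum.reindex_bij_witness[where j="\<lambda>i. nat (i - i0 - 1)" and i="\<lambda>k. i0 + 1 + int k"]) auto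
  also have "(\<Sum>j<?n. F (i0 - int j)) \<le> (\<Sum>j<?n. B j)"
  proof (rule sum_mono)
    fix j assume j: "j \<in> {..<?n}"
    have x: "t - \<psi> (i0 - int j) = r + real j * w"
      by (simp add: r_def \<psi>_def algebra_simps)
    show "F (i0 - int j) \<le> B j"
    proof -
      have nn: "0 \<le> r + real j * w" using r w by simp
      have "r + real j * w \<le> pi" using jb[of j] j r by (simp add: algebra_simps)
      moreover have "real j * w \<le> r + real j * w" using r by simp
      ultimately show ?thesis
        unfolding F_def x by (intro bound) (simp_all only: abs_of_nonneg[OF nn])
    qed
  qed
  also have "(\<Sum>j<?n. F (i0 + 1 + int j)) \<le> (\<Sum>j<?n. B j)"
  proof (rule sum_mono)
    fix j assume j: "j \<in> {..<?n}"
    have x: "t - \<psi> (i0 + 1 + int j) = - ((real j + 1) * w - r)"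
      by (simp add: r_def \<psi>_def algebra_simps)
    have a: "real j * w \<le> (real j + 1) * w - r"
      using r by (simp add: algebra_simps)
    have nn: "0 \<le> (real j + 1) * w - r"
      by (rule order_trans[OF _ a]) (use w in simp)
    have "(real j + 1) * w - r \<le> pi" using jb[of j] j r by simp
    then show "F (i0 + 1 + int j) \<le> B j"
      unfolding F_def x by (intro bound) (simp_all only: abs_minus_cancel abs_of_nonneg[OF nn] a)
  qed
  finally have 2: "(\<Sum>i\<in>{- int ?n..<- int ?n + int (2 * ?n)}. F i) \<le> 2 * (\<Sum>j<?n. B j)" by simp
  have "(\<Sum>j<?n. B j) = B 0 + (\<Sum>j=1..m. B j)"
    by (simp add: sum.lessThan_Suc_shift sum.atLeast1_atMost_eq del: sum.lessThan_Suc)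
  also have "(\<Sum>j=1..m. B j) = real ?n * harm m"
    by (simp add: harm_def sum_distrib_left B_def divide_inverse)
  also have "harm m \<le> (harm ?n :: real)"
    by (simp add: harm_Suc)
  also have "harm ?n \<le> 1 + ln (real ?n)"
    using euler_mascheroni_sequence_decreasing[of 1 ?n] by (simp add: harm_expand)
  finally have "(\<Sum>j<?n. B j) \<le> 2 * real ?n - 1 + real ?n * (1 + ln (real ?n))"
    by (simp add: B_def)
  \<comment> \<open>The constant 3 collects \<open>2 * n - 1\<close> from the nearest point and the
    1 in \<open>n * (1 + ln n)\<close>.\<close>
  then have 3: "(\<Sum>j<?n. B j) \<le> real ?n * (3 + ln (real ?n))"
    by (simp add: algebra_simps)
  have "(\<Sum>k=0..m. \<bar>lagrange m k y\<bar>) \<le> 2 * (real ?n * (3 + ln (real ?n))) / (2 * real ?n)"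
    using 2 3 by (intro order_trans[OF 1] divide_right_mono) auto
  also have "\<dots> = 3 + ln (real ?n)"
    by (simp del: of_nat_Suc)
  finally show ?thesis by (simp add: add.commute)
qed


section \<open>Jacobi measures\<close>

lemma measurable_jacobi_weight[measurable]: "jacobi_weight a b \<in> borel_measurable borel"
  unfolding jacobi_weight_def by measurable

lemma jacobi_weight_nonneg: "0 \<le> jacobi_weight a b y"
  by (simp add: jacobi_weight_def)

text \<open>The substitution y = 1 - 2 t turns the weight into a Beta integrand.\<close>

lemma jacobi_weight_integral:
  assumes "a > -1" "b > -1"
  shows "set_integrable lborel {-1..1} (jacobi_weight a b)"
    and "(LINT y:{-1..1}|lborel. jacobi_weight a b y) = 2 powr (a + b + 1) * Beta (a + 1) (b + 1)"
proof -
  let ?g = "\<lambda>y. indicator {-1..1} y *\<^sub>R jacobi_weight a b y"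
  let ?h = "\<lambda>t. indicator {0..1} t *\<^sub>R (t powr (a + 1 - 1) * (1 - t) powr (b + 1 - 1))"
  have eq: "?g (1 + (-2) * t) = 2 powr (a + b) * ?h t" for t :: real
  proof (cases "t \<in> {0..1}")
    case True
    then have "(2 * t) powr a = 2 powr a * t powr a" "(2 * (1 - t)) powr b = 2 powr b * (1 - t) powr b"
      by (simp_all only: powr_mult)
    moreover have "1 - (1 + (-2) * t) = 2 * t" "1 + (1 + (-2) * t) = 2 * (1 - t)" by simp_all
    ultimately show ?thesis
      using True unfolding jacobi_weight_def by (simp only:) (simp add: powr_add)
  qed (auto simp: indicator_def)
  have "set_integrable lborel {0..1} (\<lambda>t. t powr (a + 1 - 1) * (1 - t) powr (b + 1 - 1))"
    using assms by (intro integrable_Beta) auto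
  then have h: "integrable lborel ?h" "integral\<^sup>L lborel ?h = Beta (a + 1) (b + 1)"
    using set_borel_integral_eq_integral[of "{0..1}" "\<lambda>t. t powr (a + 1 - 1) * (1 - t) powr (b + 1 - 1)"]
      integral_unique[OF has_integral_Beta_real[of "a + 1" "b + 1"]] assms
    by (auto simp: set_integrable_def set_lebesgue_integral_def)
  have "integrable lborel (\<lambda>t. ?g (1 + (-2) * t))"
    unfolding eq using h(1) by (rule integrable_mult_right)
  then show "set_integrable lborel {-1..1} (jacobi_weight a b)"
    unfolding set_integrable_def by (subst (asm) lborel_integrable_real_affine_iff) auto
  have "integral\<^sup>L lborel ?g = \<bar>-2\<bar> *\<^sub>R integral\<^sup>L lborel (\<lambda>t. ?g (1 + (-2) * t))"
    by (rule lborel_integral_real_affine) simp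
  also have "\<dots> = 2 * (2 powr (a + b) * Beta (a + 1) (b + 1))"
    unfolding eq integral_mult_right_zero h(2) by simp
  finally show "(LINT y:{-1..1}|lborel. jacobi_weight a b y) = 2 powr (a + b + 1) * Beta (a + 1) (b + 1)"
    by (simp add: set_lebesgue_integral_def powr_add)
qed

lemma jacobi_mass_pos:
  assumes "a > -1" "b > -1"
  shows "(LINT y:{-1..1}|lborel. jacobi_weight a b y) > 0"
  using assms by (auto simp: jacobi_weight_integral Beta_def intro!: mult_pos_pos divide_pos_pos Gamma_real_pos)

lemma space_jacobi_measure: "space (jacobi_measure a b) = {-1..1}"
  by (simp add: jacobi_measure_def)

lemma measurable_jacobi_measure:
  "f \<in> borel_measurable borel \<Longrightarrow> f \<in> borel_measurable (jacobi_measure a b)"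
  by (simp add: jacobi_measure_def measurable_restrict_space1)

lemma prob_space_jacobi_measure:
  assumes "a > -1" "b > -1"
  shows "prob_space (jacobi_measure a b)"
proof
  let ?Z = "LINT y:{-1..1}|lborel. jacobi_weight a b y"
  let ?R = "restrict_space lborel {-1..1::real}"
  have Z: "?Z > 0" by (rule jacobi_mass_pos[OF assms])
  have i: "integrable ?R (\<lambda>y. jacobi_weight a b y / ?Z)"
    using jacobi_weight_integral(1)[OF assms]
    by (intro integrable_divide) (simp add: integrable_restrict_space set_integrable_def)
  have "emeasure (jacobi_measure a b) (space (jacobi_measure a b))
      = (\<integral>\<^sup>+y. ennreal (jacobi_weight a b y / ?Z) * indicator {-1..1} y \<partial>?R)"
    unfolding space_jacobi_measure unfolding jacobi_measure_def
    by (rule emeasure_density) (auto simp: sets_restrict_space measurable_restrict_space1)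
  also have "\<dots> = (\<integral>\<^sup>+y. ennreal (jacobi_weight a b y / ?Z) \<partial>?R)"
    by (rule nn_integral_cong) simp
  also have "\<dots> = ennreal (LINT y|?R. jacobi_weight a b y / ?Z)"
    by (rule nn_integral_eq_integral[OF i]) (use Z jacobi_weight_nonneg in simp)
  also have "(LINT y|?R. jacobi_weight a b y / ?Z) = 1"
    using Z by (simp add: integral_restrict_space set_lebesgue_integral_def)
  finally show "emeasure (jacobi_measure a b) (space (jacobi_measure a b)) = 1" by simp
qed

lemma integrable_jacobi_measure:
  fixes f :: "real \<Rightarrow> real"
  assumes "a > -1" "b > -1" "continuous_on UNIV f"
  shows "integrable (jacobi_measure a b) f"
proof -
  interpret prob_space "jacobi_measure a b" by (rule prob_space_jacobi_measure[OF assms(1,2)])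
  have "compact (f ` {-1..1})"
    using assms(3) by (intro compact_continuous_image) (auto intro: continuous_on_subset)
  then obtain B where "\<And>y. y \<in> {-1..1} \<Longrightarrow> norm (f y) \<le> B"
    using compact_imp_bounded bounded_iff by (metis image_eqI)
  then have "AE y in jacobi_measure a b. norm (f y) \<le> B"
    by (intro AE_I2) (simp add: space_jacobi_measure)
  moreover have "f \<in> borel_measurable (jacobi_measure a b)"
    by (intro measurable_jacobi_measure borel_measurable_continuous_onI assms)
  ultimately show ?thesis by (rule integrable_const_bound)
qed

lemma integral_jacobi_measure:
  fixes f :: "real \<Rightarrow> real"
  assumes "a > -1" "b > -1" and f[measurable]: "f \<in> borel_measurable borel"
  shows "(LINT y|jacobi_measure a b. f y)
    = (LINT y:{-1..1}|lborel. jacobi_weight a b y * f y) / (LINT y:{-1..1}|lborel. jacobi_weight a b y)"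
proof -
  let ?Z = "LINT y:{-1..1}|lborel. jacobi_weight a b y"
  let ?R = "restrict_space lborel {-1..1::real}"
  have Z: "?Z > 0" by (rule jacobi_mass_pos[OF assms(1,2)])
  have "(LINT y|jacobi_measure a b. f y) = (LINT y|?R. (jacobi_weight a b y / ?Z) *\<^sub>R f y)"
    unfolding jacobi_measure_def using Z
    by (intro integral_density) (auto intro!: measurable_restrict_space1 AE_I2 simp: jacobi_weight_nonneg)
  also have "\<dots> = (LINT y:{-1..1}|lborel. (jacobi_weight a b y * f y) / ?Z)"
    by (simp add: integral_restrict_space set_lebesgue_integral_def)
  also have "\<dots> = (LINT y:{-1..1}|lborel. jacobi_weight a b y * f y) / ?Z"
    by (rule set_integral_divide_zero)
  finally show ?thesis .
qed

section \<open>Orthogonality of the Jacobi polynomials to constants\<close>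

lemma jacobi_weight_mult_powers:
  assumes "y \<in> {-1..1}" "s \<le> k"
  shows "jacobi_weight a b y * (((y - 1) / 2) ^ s * ((y + 1) / 2) ^ (k - s))
    = (-1) ^ s / 2 ^ k * jacobi_weight (a + real s) (b + real (k - s)) y"
proof -
  \<comment> \<open>The end points are covered by the convention that \<open>0 powr c\<close> is 0
    for every \<open>c\<close>, also when \<open>n = 0\<close> or \<open>c\<close> is
    negative.\<close>
  have p: "x powr c * x ^ n = x powr (c + real n)" if "x \<ge> 0" for x c :: real and n
    using that by (cases "x = 0"; cases n) (simp_all add: powr_add powr_realpow)
  have "((y - 1) / 2) ^ s = (-1) ^ s * (1 - y) ^ s / 2 ^ s"
    by (simp add: power_divide flip: power_mult_distrib)
  moreover have "((y + 1) / 2) ^ (k - s) = (1 + y) ^ (k - s) / 2 ^ (k - s)"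
    by (simp add: power_divide add.commute)
  moreover have "(2::real) ^ k = 2 ^ s * 2 ^ (k - s)" using assms(2) by (simp flip: power_add)
  ultimately show ?thesis
    using p[of "1 - y" a s] p[of "1 + y" b "k - s"] assms(1)
    by (simp add: jacobi_weight_def field_simps)
qed

text \<open>The powers of 1 - y and 1 + y in each term only shift the exponents of the weight, so
  each term integrates to a Beta value. Its Gamma factors cancel against those of the generalised
  binomials, and what remains is a multiple of the alternating sum of
  \<open>k choose s\<close>.\<close>

lemma integral_jacobi_P:
  assumes "a > -1" "b > -1" "k > 0"
  shows "(LINT y|jacobi_measure a b. jacobi_P a b k y) = 0"
proof -
  define c where "c s = ((real k + a) gchoose (k - s)) * ((real k + b) gchoose s) * ((-1) ^ s / 2 ^ k)" for s
  have ab: "a + real s > -1" "b + real (k - s) > -1" for s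
    using assms by auto
  \<comment> \<open>\<open>p\<close> and \<open>q\<close> stand for the Gamma values that cancel,
    \<open>R\<close> for the denominator of the Beta value and \<open>f\<close> for
    \<open>fact k\<close>.\<close>
  have alg: "A / (F * p) * (B / (F' * q)) * (e / t) * (u * (p * q / R))
      = (u / t * A * B / R / f) * (e * (f / (F' * F)))"
    if "p \<noteq> 0" "q \<noteq> 0" "f \<noteq> 0" for A B F F' p q e t u R f :: real
    using that by (simp add: mult_ac)
  have int: "integrable lborel (\<lambda>y. indicator {-1..1} y
      * (c s * jacobi_weight (a + real s) (b + real (k - s)) y))" for s
    using integrable_mult_right[OF jacobi_weight_integral(1)[OF ab, of s s, unfolded set_integrable_def], of "c s"]
    by (simp add: mult.left_commute del: of_nat_diff)
  have "(LINT y:{-1..1}|lborel. jacobi_weight a b y * jacobi_P a b k y)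
      = (LINT y:{-1..1}|lborel. (\<Sum>s\<le>k. c s * jacobi_weight (a + real s) (b + real (k - s)) y))"
  proof (rule set_lebesgue_integral_cong)
    show "\<forall>y. y \<in> {-1..1} \<longrightarrow> jacobi_weight a b y * jacobi_P a b k y
        = (\<Sum>s\<le>k. c s * jacobi_weight (a + real s) (b + real (k - s)) y)"
    proof (intro allI impI)
      fix y :: real assume y: "y \<in> {-1..1}"
      show "jacobi_weight a b y * jacobi_P a b k y
        = (\<Sum>s\<le>k. c s * jacobi_weight (a + real s) (b + real (k - s)) y)"
        unfolding jacobi_P_def sum_distrib_left
      proof (rule sum.cong)
        fix s assume "s \<in> {..k}"
        then show "jacobi_weight a b y * ((real k + a gchoose (k - s)) * (real k + b gchoose s)
            * ((y - 1) / 2) ^ s * ((y + 1) / 2) ^ (k - s))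
          = c s * jacobi_weight (a + real s) (b + real (k - s)) y"
          using arg_cong[OF jacobi_weight_mult_powers[OF y, of s k a b],
            of "\<lambda>x. ((real k + a) gchoose (k - s)) * ((real k + b) gchoose s) * x"]
          by (simp add: c_def mult_ac del: of_nat_diff)
      qed simp
    qed
  qed simp
  also have "\<dots> = (\<Sum>s\<le>k. LINT y:{-1..1}|lborel. c s * jacobi_weight (a + real s) (b + real (k - s)) y)"
    unfolding set_lebesgue_integral_def real_scaleR_def sum_distrib_left
    by (rule Bochner_Integration.integral_sum) (rule int)
  also have "\<dots> = (\<Sum>s\<le>k. c s * (2 powr (a + b + real k + 1)
      * Beta (a + real s + 1) (b + real (k - s) + 1)))"
  proof (rule sum.cong)
    fix s assume "s \<in> {..k}"
    then have e: "a + real s + (b + real (k - s)) + 1 = a + b + real k + 1" by (simp add: of_nat_diff)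
    then show "(LINT y:{-1..1}|lborel. c s * jacobi_weight (a + real s) (b + real (k - s)) y)
        = c s * (2 powr (a + b + real k + 1) * Beta (a + real s + 1) (b + real (k - s) + 1))"
      using jacobi_weight_integral(2)[OF ab, of s s, unfolded e] by (simp del: of_nat_diff)
  qed simp
  also have "\<dots> = (\<Sum>s\<le>k. (2 powr (a + b + real k + 1) / 2 ^ k * Gamma (real k + a + 1)
      * Gamma (real k + b + 1) / Gamma (a + b + real k + 2) / fact k) * ((-1) ^ s * real (k choose s)))"
  proof (rule sum.cong)
    fix s assume s: "s \<in> {..k}"
    have pos: "Gamma (a + real s + 1) > 0" "Gamma (b + real (k - s) + 1) > 0"
      using assms by (auto intro!: Gamma_real_pos)
    have "real k + a + 1 \<notin> \<int>\<^sub>\<le>\<^sub>0" "real k + b + 1 \<notin> \<int>\<^sub>\<le>\<^sub>0"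
      using assms by (auto elim!: nonpos_Ints_cases)
    then have g: "(real k + a) gchoose (k - s) = Gamma (real k + a + 1) / (fact (k - s) * Gamma (a + real s + 1))"
      "(real k + b) gchoose s = Gamma (real k + b + 1) / (fact s * Gamma (b + real (k - s) + 1))"
      using s by (simp_all add: gbinomial_Gamma of_nat_diff algebra_simps)
    have ch: "real (k choose s) = fact k / (fact s * fact (k - s))"
      using s by (simp add: binomial_fact)
    have be: "Beta (a + real s + 1) (b + real (k - s) + 1)
        = Gamma (a + real s + 1) * Gamma (b + real (k - s) + 1) / Gamma (a + b + real k + 2)"
    proof -
      have "a + real s + 1 + (b + real (k - s) + 1) = a + b + real k + 2"
        using s by (simp add: of_nat_diff)
      then show ?thesis by (simp only: Beta_def)
    qed
    show "c s * (2 powr (a + b + real k + 1) * Beta (a + real s + 1) (b + real (k - s) + 1))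
      = (2 powr (a + b + real k + 1) / 2 ^ k * Gamma (real k + a + 1)
      * Gamma (real k + b + 1) / Gamma (a + b + real k + 2) / fact k) * ((-1) ^ s * real (k choose s))"
      unfolding c_def g ch be by (rule alg) (use pos in simp_all)
  qed simp
  also have "\<dots> = 0"
    unfolding sum_distrib_left[symmetric] using choose_alternating_sum[of k, where 'a=real] assms by simp
  finally have "(LINT y:{-1..1}|lborel. jacobi_weight a b y * jacobi_P a b k y) = 0" .
  moreover have "jacobi_P a b k \<in> borel_measurable borel"
    unfolding jacobi_P_def by measurable
  ultimately show ?thesis by (simp add: integral_jacobi_measure assms)
qed

lemma integral_jacobi_J:
  assumes "a > -1" "b > -1" "k > 0"
  shows "(LINT y|jacobi_measure a b. jacobi_J a b k y) = 0"
  unfolding jacobi_J_def using integral_jacobi_P[OF assms] by simp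

lemma jacobi_J_0:
  assumes "a > -1" "b > -1"
  shows "jacobi_J a b 0 y = 1"
proof -
  interpret prob_space "jacobi_measure a b" by (rule prob_space_jacobi_measure[OF assms])
  show ?thesis by (simp add: jacobi_J_def jacobi_P_def prob_space)
qed

lemma jacobi_J_poly:
  obtains p where "degree p \<le> k" "jacobi_J a b k = poly p"
proof
  define q where "q = (\<Sum>s\<le>k. smult (((real k + a) gchoose (k - s)) * ((real k + b) gchoose s))
      ([:- 1/2, 1/2:] ^ s * [:1/2, 1/2:] ^ (k - s)))"
  let ?c = "inverse (sqrt (LINT t|jacobi_measure a b. (jacobi_P a b k t)\<^sup>2))"
  have "degree ([:- 1/2, 1/2:] ^ s * [:1/2, 1/2:] ^ (k - s) :: real poly) \<le> k" if "s \<le> k" for s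
    using that by (auto simp: degree_mult_eq degree_power_eq)
  then have "degree q \<le> k"
    unfolding q_def by (intro degree_sum_le) (auto intro!: order_trans[OF degree_smult_le])
  then show "degree (smult ?c q) \<le> k"
    by (rule order_trans[OF degree_smult_le])
  show "jacobi_J a b k = poly (smult ?c q)"
  proof
    fix y :: real
    have "poly [:- 1/2, 1/2:] y = (y - 1) / 2" "poly [:1/2, 1/2:] y = (y + 1) / 2"
      by (simp_all add: field_simps)
    then have "poly q y = jacobi_P a b k y"
      unfolding q_def jacobi_P_def poly_sum poly_smult poly_mult poly_power
      by (simp only: mult.assoc)
    then show "jacobi_J a b k y = poly (smult ?c q) y"
      by (simp add: jacobi_J_def divide_inverse mult.commute)
  qed
qed


section \<open>Univariate quadrature differences\<close>

definition quad_weight :: "real \<Rightarrow> real \<Rightarrow> nat \<Rightarrow> nat \<Rightarrow> real" where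
  "quad_weight a b m k = (LINT y|jacobi_measure a b. lagrange m k y)"

lemma integrable_lagrange:
  assumes "a > -1" "b > -1"
  shows "integrable (jacobi_measure a b) (lagrange m k)"
proof -
  have "lagrange m k = poly (lagrange_poly m k)"
    by (simp add: fun_eq_iff poly_lagrange_poly)
  then show ?thesis
    using integrable_jacobi_measure[OF assms, of "poly (lagrange_poly m k)"]
    by (simp add: continuous_on_poly)
qed

text \<open>The interpolant is a finite sum of real polynomials times values of \<open>w\<close>, so
  the Bochner integral reduces to real weights. Linearity of the quadrature and its compatibility
  with infinite sums are read off this formula.\<close>

lemma quad_eq_sum:
  assumes "a > -1" "b > -1"
  shows "quad a b m w = (\<Sum>k=0..m. quad_weight a b m k *\<^sub>R w (node m k))"
proof -
  have "has_bint (jacobi_measure a b) (\<lambda>y. \<Sum>k=0..m. lagrange m k y *\<^sub>R w (node m k))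
      (\<Sum>k=0..m. quad_weight a b m k *\<^sub>R w (node m k))"
    unfolding quad_weight_def
    by (rule has_bint_sum_scaleR) (auto intro: integrable_lagrange assms)
  then show ?thesis
    unfolding quad_def interp_def by (rule bint_eqI)
qed

text \<open>Each weight is the integral of a Lagrange polynomial against a probability measure, so
  the Lebesgue constant bounds the norm of the quadrature.\<close>

lemma sum_abs_quad_weight_le:
  assumes "a > -1" "b > -1"
  shows "(\<Sum>k=0..m. \<bar>quad_weight a b m k\<bar>) \<le> 3 + ln (real m + 1)"
proof -
  interpret prob_space "jacobi_measure a b" by (rule prob_space_jacobi_measure[OF assms])
  have "(\<Sum>k=0..m. \<bar>quad_weight a b m k\<bar>) \<le> (\<Sum>k=0..m. LINT y|jacobi_measure a b. \<bar>lagrange m k y\<bar>)"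
    unfolding quad_weight_def by (intro sum_mono integral_abs_bound)
  also have "\<dots> = (LINT y|jacobi_measure a b. (\<Sum>k=0..m. \<bar>lagrange m k y\<bar>))"
    by (rule Bochner_Integration.integral_sum[symmetric])
       (intro integrable_abs integrable_lagrange assms)
  also have "\<dots> \<le> (LINT y|jacobi_measure a b. 3 + ln (real m + 1))"
  proof (rule integral_mono)
    show "integrable (jacobi_measure a b) (\<lambda>y. \<Sum>k=0..m. \<bar>lagrange m k y\<bar>)"
      by (intro Bochner_Integration.integrable_sum integrable_abs integrable_lagrange assms)
  qed (auto simp: space_jacobi_measure intro!: lebesgue_constant_le)
  also have "\<dots> = 3 + ln (real m + 1)" by (simp add: prob_space)
  finally show ?thesis .
qed

lemma abs_quad_le:
  fixes w :: "real \<Rightarrow> real"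
  assumes "a > -1" "b > -1" "\<And>y. y \<in> {-1..1} \<Longrightarrow> \<bar>w y\<bar> \<le> S"
  shows "\<bar>quad a b m w\<bar> \<le> (3 + ln (real m + 1)) * S"
proof -
  have S: "S \<ge> 0" using assms(3)[of 0] by simp
  have "\<bar>quad a b m w\<bar> \<le> (\<Sum>k=0..m. \<bar>quad_weight a b m k * w (node m k)\<bar>)"
    unfolding quad_eq_sum[OF assms(1,2)] real_scaleR_def by (rule sum_abs)
  also have "\<dots> \<le> (\<Sum>k=0..m. \<bar>quad_weight a b m k\<bar> * S)"
    unfolding abs_mult by (intro sum_mono mult_left_mono assms(3) node_bounds) simp
  also have "\<dots> = (\<Sum>k=0..m. \<bar>quad_weight a b m k\<bar>) * S"
    by (simp add: sum_distrib_right)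
  also have "\<dots> \<le> (3 + ln (real m + 1)) * S"
    by (intro mult_right_mono sum_abs_quad_weight_le assms(1,2) S)
  finally show ?thesis .
qed

lemma quad_poly:
  assumes "a > -1" "b > -1" "degree p \<le> m"
  shows "quad a b m (poly p) = (LINT y|jacobi_measure a b. poly p y)"
proof -
  have "interp m (poly p) = poly p"
    by (simp add: fun_eq_iff interp_poly assms(3))
  moreover have "has_bint (jacobi_measure a b) (poly p) (LINT y|jacobi_measure a b. poly p y)"
    by (intro has_bint_integral integrable_jacobi_measure assms continuous_on_poly continuous_on_id)
  ultimately show ?thesis
    unfolding quad_def by (simp add: bint_eqI)
qed

lemma quad_jacobi_J:
  assumes "a > -1" "b > -1" "k \<le> m"
  shows "quad a b m (jacobi_J a b k) = (if k = 0 then 1 else 0)"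
proof -
  obtain p where p: "degree p \<le> k" "jacobi_J a b k = poly p" by (rule jacobi_J_poly)
  interpret prob_space "jacobi_measure a b" by (rule prob_space_jacobi_measure[OF assms(1,2)])
  have "quad a b m (jacobi_J a b k) = (LINT y|jacobi_measure a b. jacobi_J a b k y)"
    using p assms quad_poly[of a b p m] by simp
  then show ?thesis
    using integral_jacobi_J[OF assms(1,2), of k] jacobi_J_0[OF assms(1,2)] by (auto simp: prob_space)
qed

text \<open>Parity turns \<open>k < m\<close> into \<open>k \<le> m - 2\<close>, so both quadratures
  in the difference are exact.\<close>

lemma quad_diff_jacobi_J_eq_0:
  assumes "a > -1" "b > -1" "even m" "even k" "k < m"
  shows "quad_diff a b m (jacobi_J a b k) = 0"
proof -
  have "k \<le> m - 2" "m \<noteq> 0" using assms(3-5) by (auto elim!: evenE)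
  then show ?thesis using assms by (simp add: quad_diff_def quad_jacobi_J)
qed

lemma sum_even_le:
  fixes g :: "nat \<Rightarrow> 'a::comm_monoid_add"
  shows "(\<Sum>m | even m \<and> m \<le> 2 * l. g m) = (\<Sum>i\<le>l. g (2 * i))"
  by (rule sum.reindex_bij_witness[where i="\<lambda>i. 2 * i" and j="\<lambda>m. m div 2"]) auto

lemma sum_quad_diff:
  "(\<Sum>i\<le>l. quad_diff a b (2 * i) w) = quad a b (2 * l) w"
  by (induction l) (auto simp: quad_diff_def)

lemma sum_quad_diff_jacobi_J:
  assumes "a > -1" "b > -1" "even k"
  shows "(\<Sum>m | even m \<and> m \<le> k. quad_diff a b m (jacobi_J a b k)) = (if k = 0 then 1 else 0)"
proof -
  obtain l where k: "k = 2 * l" using assms(3) by (elim evenE)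
  show ?thesis
    unfolding k sum_even_le sum_quad_diff using assms by (simp add: quad_jacobi_J)
qed

text \<open>Brings the Lebesgue bound for degrees up to \<open>k - 2\<close> into the logarithmic
  form in which the constant \<open>C\<^sub>\<epsilon>\<close> is specified. By
  \<open>exp 3 \<le> 27\<close> it follows from
  \<open>27 * (k - 1) \<le> (2 * k + 3)\<^sup>2\<close>, a quadratic with negative
  discriminant.\<close>

lemma log_bound_le:
  assumes "k \<ge> 2"
  shows "3 + ln (real k - 1) \<le> 2 * ln (2 * real k + 3)"
proof -
  have "exp 3 \<le> (27::real)"
  proof -
    have "exp 3 = (exp 1 :: real) ^ 3" by (simp flip: exp_of_nat_mult)
    also have "\<dots> \<le> 3 ^ 3" by (intro power_mono exp_le) simp
    finally show ?thesis by simp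
  qed
  then have "exp 3 * (real k - 1) \<le> 27 * (real k - 1)"
    using assms by (intro mult_right_mono) auto
  also have "\<dots> \<le> (2 * real k + 3)\<^sup>2"
    using zero_le_power2[of "8 * real k - 15"] by (simp add: power2_eq_square algebra_simps)
  finally have "ln (exp 3 * (real k - 1)) \<le> ln ((2 * real k + 3)\<^sup>2)"
    using assms by (subst ln_le_cancel_iff) auto
  then show ?thesis using assms by (simp add: ln_mult ln_realpow)
qed

text \<open>Each value \<open>A i\<close> enters at most twice, and the last one, of degree
  \<open>k\<close>, vanishes by exactness and orthogonality. The remaining \<open>k / 2\<close>
  values have degree at most \<open>k - 2\<close> and are bounded by the Lebesgue constant times
  \<open>S\<close>.\<close>

lemma sum_abs_quad_diff_jacobi_J_le:
  assumes "a > -1" "b > -1" "even k" "k > 0"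
    and S: "\<And>y. y \<in> {-1..1} \<Longrightarrow> \<bar>jacobi_J a b k y\<bar> \<le> S"
  shows "(\<Sum>m | even m \<and> m \<le> k. \<bar>quad_diff a b m (jacobi_J a b k)\<bar>)
    \<le> real k * (2 * S * ln (2 * real k + 3))"
proof -
  obtain l where k: "k = 2 * l" using assms(3) by (elim evenE)
  with assms(4) have l: "l > 0" by simp
  define A where "A i = \<bar>quad a b (2 * i) (jacobi_J a b k)\<bar>" for i
  have Al: "A l = 0"
    using quad_jacobi_J[of a b k "2 * l"] assms k by (simp add: A_def)
  have "(\<Sum>i\<le>n. \<bar>quad_diff a b (2 * i) (jacobi_J a b k)\<bar>) \<le> A n + 2 * (\<Sum>i<n. A i)" for n
  proof (induction n)
    case 0
    then show ?case by (simp add: quad_diff_def A_def)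
  next
    case (Suc n)
    have "\<bar>quad_diff a b (2 * Suc n) (jacobi_J a b k)\<bar> \<le> A (Suc n) + A n"
      by (simp add: quad_diff_def A_def abs_triangle_ineq4)
    then show ?case using Suc by simp
  qed
  from this[of l] have "(\<Sum>m | even m \<and> m \<le> k. \<bar>quad_diff a b m (jacobi_J a b k)\<bar>) \<le> 2 * (\<Sum>i<l. A i)"
    by (simp add: k sum_even_le Al)
  also have "(\<Sum>i<l. A i) \<le> (\<Sum>i<l. 2 * ln (2 * real k + 3) * S)"
  proof (rule sum_mono)
    fix i assume i: "i \<in> {..<l}"
    have S0: "S \<ge> 0" using S[of 0] by simp
    have "A i \<le> (3 + ln (real (2 * i) + 1)) * S"
      unfolding A_def by (rule abs_quad_le) (use assms in auto)
    also have "\<dots> \<le> (3 + ln (real k - 1)) * S"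
      using i S0 by (intro mult_right_mono add_left_mono) (auto simp: k)
    also have "\<dots> \<le> 2 * ln (2 * real k + 3) * S"
      using log_bound_le[of k] S0 l k by (intro mult_right_mono) auto
    finally show "A i \<le> 2 * ln (2 * real k + 3) * S" .
  qed
  finally show ?thesis by (simp add: k algebra_simps)
qed

text \<open>Origin of the weight parameters: the sum over the levels costs a factor
  \<open>k\<close>, and one additional power of \<open>1 + (C + 1) * k\<close> absorbs it. Hence the
  exponent \<open>\<theta>0 + 1 + e\<close> and the slope \<open>C + 1\<close>.\<close>

lemma weight_power_bound:
  fixes C lam0 \<theta>0 e :: real
  assumes "k > 0" "C > 0" "\<theta>0 \<ge> 0" "e > 0"
    and "2 * (1 + lam0 * real k) powr \<theta>0 * ln (2 * real k + 3) \<le> (C * real k + 1) powr (\<theta>0 + e)"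
  shows "real k * (2 * (1 + lam0 * real k) powr \<theta>0 * ln (2 * real k + 3))
    \<le> (1 + (C + 1) * real k) powr (\<theta>0 + 1 + e)"
proof -
  have "real k * (2 * (1 + lam0 * real k) powr \<theta>0 * ln (2 * real k + 3))
      \<le> real k * (C * real k + 1) powr (\<theta>0 + e)"
    using assms by (intro mult_left_mono) auto
  also have "\<dots> \<le> (1 + (C + 1) * real k) * (1 + (C + 1) * real k) powr (\<theta>0 + e)"
    using assms by (intro mult_mono powr_mono2) (auto simp: algebra_simps)
  also have "\<dots> = (1 + (C + 1) * real k) powr (1 + (\<theta>0 + e))"
    using assms by (subst powr_add) (auto simp: add_pos_pos)
  finally show ?thesis by (simp add: algebra_simps)
qed


section \<open>Tensorized quadrature differences\<close>

(* The library's version is restricted to the class banach. *)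
lemma norm_summable_on_complete:
  fixes f :: "'i \<Rightarrow> 'b::{real_normed_vector, complete_space}"
  assumes "(\<lambda>x. norm (f x)) summable_on A"
  shows "f summable_on A"
proof -
  let ?n = "\<lambda>x. norm (f x)"
  obtain L where L: "(?n has_sum L) A" using assms by (auto simp: summable_on_def)
  have "cauchy_filter (filtermap (sum f) (finite_subsets_at_top A))"
    unfolding cauchy_filter_metric_filtermap
  proof (intro allI impI)
    fix e :: real assume "e > 0"
    then obtain X where X: "finite X" "X \<subseteq> A" "dist (sum ?n X) L \<le> e / 3"
      using has_sum_finite_approximation[OF L, of "e / 3"] by auto
    have near: "dist (sum f F) (sum f X) \<le> e / 3" if "finite F" "X \<subseteq> F" "F \<subseteq> A" for F
    proof -
      have "dist (sum f F) (sum f X) = norm (sum f (F - X))"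
        using that by (simp add: dist_norm sum_diff)
      also have "\<dots> \<le> sum ?n (F - X)" by (rule norm_sum)
      also have "\<dots> = sum ?n F - sum ?n X" using that by (simp add: sum_diff)
      also have "sum ?n F \<le> L" using that by (intro finite_sum_le_has_sum[OF L]) auto
      also have "L - sum ?n X \<le> e / 3" using X(3) unfolding dist_real_def by linarith
      finally show ?thesis by simp
    qed
    show "\<exists>P. eventually P (finite_subsets_at_top A) \<and>
        (\<forall>F F'. P F \<and> P F' \<longrightarrow> dist (sum f F) (sum f F') < e)"
    proof (intro exI conjI allI impI)
      show "\<forall>\<^sub>F F in finite_subsets_at_top A. finite F \<and> X \<subseteq> F \<and> F \<subseteq> A"
        using X by (auto simp: eventually_finite_subsets_at_top)
      show "dist (sum f F) (sum f F') < e"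
        if "(finite F \<and> X \<subseteq> F \<and> F \<subseteq> A) \<and> (finite F' \<and> X \<subseteq> F' \<and> F' \<subseteq> A)" for F F'
        using that near[of F] near[of F'] dist_triangle2[of "sum f F" "sum f F'" "sum f X"] \<open>e > 0\<close>
        by linarith
    qed
  qed
  then have "convergent_filter (filtermap (sum f) (finite_subsets_at_top A))"
    by (rule cauchy_filter_convergent)
  then show ?thesis
    by (auto simp: convergent_filter_iff summable_on_def has_sum_def filterlim_def)
qed

lemma has_sum_finite_sum:
  fixes f :: "'k \<Rightarrow> 'i \<Rightarrow> 'b::topological_comm_monoid_add"
  assumes "finite K" "\<And>k. k \<in> K \<Longrightarrow> (f k has_sum F k) A"
  shows "((\<lambda>x. \<Sum>k\<in>K. f k x) has_sum (\<Sum>k\<in>K. F k)) A"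
  using assms by (induction K rule: finite_induct) (auto intro: has_sum_add)

lemma quad_diff_scaleR:
  assumes "a > -1" "b > -1"
  shows "quad_diff a b m (\<lambda>t. g t *\<^sub>R x) = quad_diff a b m g *\<^sub>R x"
  by (simp add: quad_diff_def quad_eq_sum assms scaleR_sum_left scaleR_left_diff_distrib)

text \<open>Quadrature is a finite combination of values at nodes in [-1,1], so pointwise
  convergence passes through it.\<close>

lemma quad_diff_has_sum:
  fixes f :: "'i \<Rightarrow> real \<Rightarrow> 'b::real_normed_vector"
  assumes "a > -1" "b > -1" "\<And>t. t \<in> {-1..1} \<Longrightarrow> ((\<lambda>\<nu>. f \<nu> t) has_sum F t) A"
  shows "((\<lambda>\<nu>. quad_diff a b m (f \<nu>)) has_sum quad_diff a b m F) A"
proof -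
  have q: "((\<lambda>\<nu>. quad a b n (f \<nu>)) has_sum quad a b n F) A" for n
    unfolding quad_eq_sum[OF assms(1,2)]
    by (intro has_sum_finite_sum has_sum_scaleR assms(3) node_bounds) simp
  have "((\<lambda>\<nu>. quad a b m (f \<nu>) + - quad a b (m - 2) (f \<nu>)) has_sum
      (quad a b m F + - quad a b (m - 2) F)) A"
    by (intro has_sum_add has_sum_uminus[THEN iffD2] q) (simp add: q)
  then show ?thesis using q[of 0] by (cases "m = 0") (simp_all add: quad_diff_def)
qed

text \<open>The scalar obtained by applying the s-th tensor difference to the \<nu>-th polynomial.
  Off both supports the factor would be \<open>Q_0\<close> applied to the constant 1, which is 1; on
  the support of \<nu> alone it is evaluation at the single node 0.\<close>

definition tensor_coeff ::
  "(nat \<Rightarrow> real) \<Rightarrow> (nat \<Rightarrow> real) \<Rightarrow> (nat \<Rightarrow> nat) \<Rightarrow> (nat \<Rightarrow> nat) \<Rightarrow> real" where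
  "tensor_coeff a b s \<nu> =
     (\<Prod>j\<in>msupp s \<union> msupp \<nu>. quad_diff (a j) (b j) (s j) (jacobi_J (a j) (b j) (\<nu> j)))"

lemma F_ev_finite: "\<nu> \<in> F_ev \<Longrightarrow> finite (msupp \<nu>)"
  by (simp add: F_ev_def)

lemma F_ev_even: "\<nu> \<in> F_ev \<Longrightarrow> even (\<nu> j)"
  by (simp add: F_ev_def)

lemma zero_in_F_ev: "(\<lambda>_. 0) \<in> F_ev"
  by (simp add: F_ev_def msupp_def)

text \<open>Two univariate bounds with one common weight: the sup norm bound gives absolute
  convergence of the series at every point, the bound on summed differences gives stability of the
  quadrature. Products run over supports only, hence \<open>k > 0\<close>.\<close>

locale jacobi_quadrature =
  fixes a b :: "nat \<Rightarrow> real" and \<theta> lam :: real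
  assumes a: "\<And>j. a j > -1" and b: "\<And>j. b j > -1"
    and theta: "\<theta> \<ge> 0" and lam: "lam \<ge> 0"
    and jacobi_bound: "\<And>j k y. k > 0 \<Longrightarrow> y \<in> {-1..1} \<Longrightarrow>
      \<bar>jacobi_J (a j) (b j) k y\<bar> \<le> (1 + lam * real k) powr \<theta>"
    and quad_bound: "\<And>j k. even k \<Longrightarrow> k > 0 \<Longrightarrow>
      (\<Sum>m | even m \<and> m \<le> k. \<bar>quad_diff (a j) (b j) m (jacobi_J (a j) (b j) k)\<bar>)
        \<le> (1 + lam * real k) powr \<theta>"
begin

lemma p_weight_ge_1: "p_weight \<theta> lam \<nu> \<ge> 1"
  unfolding p_weight_def using theta lam by (intro prod_ge_1 ge_one_powr_ge_zero) auto

lemma abs_J_multi_le: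
  assumes "\<And>j. y j \<in> {-1..1}"
  shows "\<bar>J_multi a b \<nu> y\<bar> \<le> p_weight \<theta> lam \<nu>"
  unfolding J_multi_def p_weight_def abs_prod
  by (intro prod_mono conjI jacobi_bound assms) (auto simp: msupp_def)

text \<open>Applying the factors one after the other turns, for each \<open>\<nu>\<close>, the values of the
  univariate polynomials into their quadrature differences.\<close>

lemma foldr_quad_diff_has_sum:
  fixes f :: "(nat \<Rightarrow> real) \<Rightarrow> 'b::real_normed_vector"
  assumes "distinct js" "\<And>y. (\<And>j. y j \<in> {-1..1}) \<Longrightarrow>
      ((\<lambda>\<nu>. J_multi a b \<nu> y *\<^sub>R c \<nu>) has_sum f y) F_ev" "\<And>j. y j \<in> {-1..1}"
  shows "((\<lambda>\<nu>. ((\<Prod>j\<in>msupp \<nu> - set js. jacobi_J (a j) (b j) (\<nu> j) (y j)) *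
        (\<Prod>j\<in>set js. quad_diff (a j) (b j) (s j) (jacobi_J (a j) (b j) (\<nu> j)))) *\<^sub>R c \<nu>)
      has_sum foldr (\<lambda>j g y. quad_diff (a j) (b j) (s j) (\<lambda>t. g (y(j := t)))) js f y) F_ev"
  using assms(1,3)
proof (induction js arbitrary: y)
  case Nil
  then show ?case using assms(2)[of y] by (simp add: J_multi_def)
next
  case (Cons j js)
  let ?D = "\<lambda>i \<nu>. quad_diff (a i) (b i) (s i) (jacobi_J (a i) (b i) (\<nu> i))"
  let ?f = "foldr (\<lambda>j g y. quad_diff (a j) (b j) (s j) (\<lambda>t. g (y(j := t)))) js f"
  have "((\<lambda>\<nu>. quad_diff (a j) (b j) (s j) (\<lambda>t.
      ((\<Prod>i\<in>msupp \<nu> - set js. jacobi_J (a i) (b i) (\<nu> i) ((y(j := t)) i)) *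
        (\<Prod>i\<in>set js. ?D i \<nu>)) *\<^sub>R c \<nu>))
    has_sum quad_diff (a j) (b j) (s j) (\<lambda>t. ?f (y(j := t)))) F_ev"
    by (rule quad_diff_has_sum[OF a b], rule Cons.IH) (use Cons.prems in auto)
  moreover have "quad_diff (a j) (b j) (s j) (\<lambda>t.
      ((\<Prod>i\<in>msupp \<nu> - set js. jacobi_J (a i) (b i) (\<nu> i) ((y(j := t)) i)) *
        (\<Prod>i\<in>set js. ?D i \<nu>)) *\<^sub>R c \<nu>)
    = ((\<Prod>i\<in>msupp \<nu> - set (j # js). jacobi_J (a i) (b i) (\<nu> i) (y i)) *
        (\<Prod>i\<in>set (j # js). ?D i \<nu>)) *\<^sub>R c \<nu>" if "\<nu> \<in> F_ev" for \<nu>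
  proof -
    let ?R = "\<Prod>i\<in>msupp \<nu> - set (j # js). jacobi_J (a i) (b i) (\<nu> i) (y i)"
    have split: "(\<Prod>i\<in>msupp \<nu> - set js. jacobi_J (a i) (b i) (\<nu> i) ((y(j := t)) i))
        = jacobi_J (a j) (b j) (\<nu> j) t * ?R" for t
    proof (cases "j \<in> msupp \<nu>")
      case True
      then have eq: "msupp \<nu> - set js = insert j (msupp \<nu> - set (j # js))"
        using Cons.prems(1) by auto
      have "(\<Prod>i\<in>msupp \<nu> - set js. jacobi_J (a i) (b i) (\<nu> i) ((y(j := t)) i))
          = jacobi_J (a j) (b j) (\<nu> j) t
            * (\<Prod>i\<in>msupp \<nu> - set (j # js). jacobi_J (a i) (b i) (\<nu> i) ((y(j := t)) i))"
        by (subst eq, subst prod.insert) (use F_ev_finite[OF that] in auto)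
      also have "(\<Prod>i\<in>msupp \<nu> - set (j # js). jacobi_J (a i) (b i) (\<nu> i) ((y(j := t)) i)) = ?R"
        by (rule prod.cong) auto
      finally show ?thesis .
    next
      case False
      then have "(\<Prod>i\<in>msupp \<nu> - set js. jacobi_J (a i) (b i) (\<nu> i) ((y(j := t)) i)) = ?R"
        by (intro prod.cong) auto
      moreover have "\<nu> j = 0" using False by (simp add: msupp_def)
      ultimately show ?thesis by (simp add: jacobi_J_0 a b)
    qed
    have "quad_diff (a j) (b j) (s j) (\<lambda>t.
      ((\<Prod>i\<in>msupp \<nu> - set js. jacobi_J (a i) (b i) (\<nu> i) ((y(j := t)) i)) *
        (\<Prod>i\<in>set js. ?D i \<nu>)) *\<^sub>R c \<nu>)
      = quad_diff (a j) (b j) (s j) (\<lambda>t. jacobi_J (a j) (b j) (\<nu> j) t *\<^sub>R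
        ((?R * (\<Prod>i\<in>set js. ?D i \<nu>)) *\<^sub>R c \<nu>))"
      unfolding split by (simp add: mult.assoc)
    also have "\<dots> = ?D j \<nu> *\<^sub>R ((?R * (\<Prod>i\<in>set js. ?D i \<nu>)) *\<^sub>R c \<nu>)"
      by (rule quad_diff_scaleR[OF a b])
    also have "\<dots> = (?R * (\<Prod>i\<in>set (j # js). ?D i \<nu>)) *\<^sub>R c \<nu>"
      using Cons.prems(1) by (simp add: mult_ac)
    finally show ?thesis .
  qed
  ultimately show ?case
    unfolding foldr.simps o_def by (simp only: cong: has_sum_cong)
qed

lemma quad_diff_0: "quad_diff (a j) (b j) 0 w = w (node 0 0)"
proof -
  interpret prob_space "jacobi_measure (a j) (b j)" by (rule prob_space_jacobi_measure[OF a b])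
  have "quad_weight (a j) (b j) 0 0 = 1"
    by (simp add: quad_weight_def lagrange_def prob_space)
  then show ?thesis by (simp add: quad_diff_def quad_eq_sum a b)
qed

lemma quad_diff_multi_has_sum:
  fixes f :: "(nat \<Rightarrow> real) \<Rightarrow> 'b::real_normed_vector"
  assumes "s \<in> F_ev" "\<And>y. (\<And>j. y j \<in> {-1..1}) \<Longrightarrow>
      ((\<lambda>\<nu>. J_multi a b \<nu> y *\<^sub>R c \<nu>) has_sum f y) F_ev"
  shows "((\<lambda>\<nu>. tensor_coeff a b s \<nu> *\<^sub>R c \<nu>) has_sum quad_diff_multi a b s f) F_ev"
proof -
  let ?js = "sorted_list_of_set (msupp s)"
  have js: "distinct ?js" "set ?js = msupp s" using F_ev_finite[OF assms(1)] by auto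
  have "((\<Prod>j\<in>msupp \<nu> - msupp s. jacobi_J (a j) (b j) (\<nu> j) (node 0 0)) *
        (\<Prod>j\<in>msupp s. quad_diff (a j) (b j) (s j) (jacobi_J (a j) (b j) (\<nu> j))))
      = tensor_coeff a b s \<nu>" if "\<nu> \<in> F_ev" for \<nu>
  proof -
    have "msupp s \<union> msupp \<nu> = (msupp \<nu> - msupp s) \<union> msupp s" by auto
    then have "tensor_coeff a b s \<nu> =
        (\<Prod>j\<in>msupp \<nu> - msupp s. quad_diff (a j) (b j) (s j) (jacobi_J (a j) (b j) (\<nu> j))) *
        (\<Prod>j\<in>msupp s. quad_diff (a j) (b j) (s j) (jacobi_J (a j) (b j) (\<nu> j)))"
      unfolding tensor_coeff_def using F_ev_finite[OF that] F_ev_finite[OF assms(1)]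
      by (simp only:) (rule prod.union_disjoint, auto)
    also have "(\<Prod>j\<in>msupp \<nu> - msupp s. quad_diff (a j) (b j) (s j) (jacobi_J (a j) (b j) (\<nu> j)))
        = (\<Prod>j\<in>msupp \<nu> - msupp s. jacobi_J (a j) (b j) (\<nu> j) (node 0 0))"
      by (rule prod.cong) (auto simp: msupp_def quad_diff_0)
    finally show ?thesis by simp
  qed
  then show ?thesis
    using foldr_quad_diff_has_sum[OF js(1) assms(2), of "\<lambda>_. node 0 0" s]
    unfolding quad_diff_multi_def js(2) using node_bounds[of 0 0]
    by (simp cong: has_sum_cong)
qed

lemma tensor_coeff_eq_0:
  assumes "s \<in> F_ev" "\<nu> \<in> F_ev" "\<not> s \<le> \<nu>"
  shows "tensor_coeff a b s \<nu> = 0"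
proof -
  obtain j where j: "\<nu> j < s j" using assms(3) by (auto simp: le_fun_def not_le)
  then have "j \<in> msupp s \<union> msupp \<nu>" by (auto simp: msupp_def)
  moreover have "quad_diff (a j) (b j) (s j) (jacobi_J (a j) (b j) (\<nu> j)) = 0"
    by (rule quad_diff_jacobi_J_eq_0[OF a b F_ev_even[OF assms(1)] F_ev_even[OF assms(2)] j])
  ultimately show ?thesis
    unfolding tensor_coeff_def using assms by (intro prod_zero) (auto simp: F_ev_finite)
qed

text \<open>\<open>s \<le> \<nu>\<close> forces \<open>s\<close> to vanish off the support of \<nu>,
  so the indices below \<nu> form a finite box. Restriction to the support and extension by zero are
  inverse to each other, and on the box the distributive law applies.\<close>

lemma sum_prod_F_ev:
  fixes g :: "nat \<Rightarrow> nat \<Rightarrow> real"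
  assumes "\<nu> \<in> F_ev"
  shows "(\<Sum>s | s \<in> F_ev \<and> s \<le> \<nu>. \<Prod>j\<in>msupp \<nu>. g j (s j))
    = (\<Prod>j\<in>msupp \<nu>. \<Sum>m | even m \<and> m \<le> \<nu> j. g j m)"
    and "finite {s. s \<in> F_ev \<and> s \<le> \<nu>}"
proof -
  let ?S = "{s. s \<in> F_ev \<and> s \<le> \<nu>}"
  let ?P = "PiE (msupp \<nu>) (\<lambda>j. {m. even m \<and> m \<le> \<nu> j})"
  let ?i = "\<lambda>g j. if j \<in> msupp \<nu> then g j else 0"
  have fin: "finite (msupp \<nu>)" by (rule F_ev_finite[OF assms])
  have zero: "s j = 0" if "s \<le> \<nu>" "j \<notin> msupp \<nu>" for s j
    using le_funD[OF that(1), of j] that(2) by (simp add: msupp_def)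
  have 1: "?i (restrict s (msupp \<nu>)) = s" if "s \<in> ?S" for s
    using that zero by (auto simp: fun_eq_iff)
  have 2: "restrict s (msupp \<nu>) \<in> ?P" if "s \<in> ?S" for s
    using that by (auto simp: F_ev_even le_fun_def)
  have 3: "?i h \<in> ?S" if "h \<in> ?P" for h
  proof -
    have "msupp (?i h) \<subseteq> msupp \<nu>" by (auto simp: msupp_def)
    then have "finite (msupp (?i h))" using fin by (rule finite_subset)
    moreover have "even (?i h j) \<and> ?i h j \<le> \<nu> j" for j using that by (auto simp: PiE_iff)
    ultimately show ?thesis by (auto simp: F_ev_def le_fun_def)
  qed
  have 4: "restrict (?i h) (msupp \<nu>) = h" if "h \<in> ?P" for h
    using that by (auto simp: fun_eq_iff PiE_iff extensional_def)
  have "(\<Prod>j\<in>msupp \<nu>. \<Sum>m | even m \<and> m \<le> \<nu> j. g j m) = (\<Sum>h\<in>?P. \<Prod>j\<in>msupp \<nu>. g j (h j))"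
    by (rule prod_sum_PiE) (auto simp: fin)
  also have "\<dots> = (\<Sum>s\<in>?S. \<Prod>j\<in>msupp \<nu>. g j (s j))"
    by (rule sum.reindex_bij_witness[where i="\<lambda>s. restrict s (msupp \<nu>)" and j="?i"])
       (use 1 2 3 4 in \<open>auto simp del: mem_Collect_eq\<close>)
  finally show "(\<Sum>s | s \<in> F_ev \<and> s \<le> \<nu>. \<Prod>j\<in>msupp \<nu>. g j (s j))
    = (\<Prod>j\<in>msupp \<nu>. \<Sum>m | even m \<and> m \<le> \<nu> j. g j m)" by simp
  have "?S \<subseteq> ?i ` ?P"
  proof
    fix s assume s: "s \<in> ?S"
    have "?i (restrict s (msupp \<nu>)) \<in> ?i ` ?P" by (rule imageI[OF 2[OF s]])
    then show "s \<in> ?i ` ?P" by (simp only: 1[OF s])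
  qed
  moreover have "finite ?P" by (intro finite_PiE fin) auto
  ultimately show "finite ?S" by (meson finite_imageI finite_subset)
qed

lemma tensor_coeff_le:
  assumes "s \<le> \<nu>"
  shows "tensor_coeff a b s \<nu>
    = (\<Prod>j\<in>msupp \<nu>. quad_diff (a j) (b j) (s j) (jacobi_J (a j) (b j) (\<nu> j)))"
proof -
  have "msupp s \<subseteq> msupp \<nu>"
  proof
    fix j assume "j \<in> msupp s"
    then show "j \<in> msupp \<nu>" using le_funD[OF assms, of j] by (simp add: msupp_def)
  qed
  then show ?thesis by (simp add: tensor_coeff_def Un_absorb1)
qed

lemma sum_tensor_coeff:
  assumes "\<nu> \<in> F_ev"
  shows "(\<Sum>s | s \<in> F_ev \<and> s \<le> \<nu>. tensor_coeff a b s \<nu>) = (if \<nu> = (\<lambda>_. 0) then 1 else 0)"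
proof -
  have "(\<Sum>s | s \<in> F_ev \<and> s \<le> \<nu>. tensor_coeff a b s \<nu>)
      = (\<Sum>s | s \<in> F_ev \<and> s \<le> \<nu>. \<Prod>j\<in>msupp \<nu>. quad_diff (a j) (b j) (s j) (jacobi_J (a j) (b j) (\<nu> j)))"
    by (rule sum.cong) (auto simp: tensor_coeff_le)
  also have "\<dots> = (\<Prod>j\<in>msupp \<nu>. \<Sum>m | even m \<and> m \<le> \<nu> j. quad_diff (a j) (b j) m (jacobi_J (a j) (b j) (\<nu> j)))"
    by (rule sum_prod_F_ev(1)[OF assms])
  also have "\<dots> = (\<Prod>j\<in>msupp \<nu>. 0)"
    by (rule prod.cong) (auto simp: sum_quad_diff_jacobi_J a b F_ev_even assms msupp_def)
  also have "\<dots> = (if \<nu> = (\<lambda>_. 0) then 1 else 0)"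
    using F_ev_finite[OF assms] by (auto simp: msupp_def)
  finally show ?thesis .
qed

lemma sum_abs_tensor_coeff_le:
  assumes "\<nu> \<in> F_ev"
  shows "(\<Sum>s | s \<in> F_ev \<and> s \<le> \<nu>. \<bar>tensor_coeff a b s \<nu>\<bar>) \<le> p_weight \<theta> lam \<nu>"
proof -
  have "(\<Sum>s | s \<in> F_ev \<and> s \<le> \<nu>. \<bar>tensor_coeff a b s \<nu>\<bar>)
      = (\<Sum>s | s \<in> F_ev \<and> s \<le> \<nu>. \<Prod>j\<in>msupp \<nu>. \<bar>quad_diff (a j) (b j) (s j) (jacobi_J (a j) (b j) (\<nu> j))\<bar>)"
    by (rule sum.cong) (auto simp: tensor_coeff_le abs_prod)
  also have "\<dots> = (\<Prod>j\<in>msupp \<nu>. \<Sum>m | even m \<and> m \<le> \<nu> j. \<bar>quad_diff (a j) (b j) m (jacobi_J (a j) (b j) (\<nu> j))\<bar>)"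
    by (rule sum_prod_F_ev(1)[OF assms])
  also have "\<dots> \<le> p_weight \<theta> lam \<nu>"
    unfolding p_weight_def
    by (intro prod_mono conjI quad_bound sum_nonneg F_ev_even[OF assms]) (auto simp: msupp_def)
  finally show ?thesis .
qed

end


section \<open>Error and dimension bounds\<close>

definition residual :: "('b \<Rightarrow> 'c) \<Rightarrow> (nat \<Rightarrow> 'c \<Rightarrow> 'c) \<Rightarrow> (nat \<times> (nat \<Rightarrow> nat)) set \<Rightarrow>
    (nat \<Rightarrow> nat) \<Rightarrow> 'b \<Rightarrow> 'c::real_vector" where
  "residual emb P G s w = emb w - (\<Sum>k | (k, s) \<in> G. delta_op P k (emb w))"

context jacobi_quadrature
begin

lemma cont_rep_has_sum:
  fixes v :: "(nat \<Rightarrow> real) \<Rightarrow> 'b::{real_normed_vector, complete_space}"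
  assumes "(\<lambda>\<nu>. p_weight \<theta> lam \<nu> * norm (jacobi_coeff a b v \<nu>)) summable_on F_ev"
    and "\<And>j. y j \<in> {-1..1}"
  shows "((\<lambda>\<nu>. J_multi a b \<nu> y *\<^sub>R jacobi_coeff a b v \<nu>) has_sum cont_rep a b v y) F_ev"
proof -
  have "(\<lambda>\<nu>. norm (J_multi a b \<nu> y *\<^sub>R jacobi_coeff a b v \<nu>)) summable_on F_ev"
    by (rule summable_on_comparison_test[OF assms(1)])
       (auto intro!: mult_right_mono abs_J_multi_le assms(2))
  then show ?thesis
    unfolding cont_rep_def by (rule has_sum_infsum[OF norm_summable_on_complete])
qed

text \<open>The residual identity
  \<open>emb v\<^sub>0 - Q\<^sub>G v = \<Sum>\<^sub>\<nu> \<Sum>\<^bsub>s \<le> \<nu>\<^esub> d(s, \<nu>) (emb v\<^sub>\<nu> - \<Sum>\<^sub>k \<delta>\<^sub>k (emb v\<^sub>\<nu>))\<close> holds because the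
  coefficients \<open>d(s, \<nu>)\<close> sum to \<open>1\<close> for \<open>\<nu> = 0\<close> and to \<open>0\<close> otherwise.\<close>

lemma sparse_quad_error_le:
  fixes v :: "(nat \<Rightarrow> real) \<Rightarrow> 'b::{real_normed_vector, complete_space}"
    and emb :: "'b \<Rightarrow> 'c::real_normed_vector"
  assumes emb: "bounded_linear emb" and P: "\<And>m. linear (P m)"
    and P_bound: "\<And>m w. norm (P m (emb w)) \<le> C1 * norm (emb w)"
    and G: "finite G" "\<And>k s. (k, s) \<in> G \<Longrightarrow> s \<in> F_ev"
    and summ: "(\<lambda>\<nu>. p_weight \<theta> lam \<nu> * norm (jacobi_coeff a b v \<nu>)) summable_on F_ev"
    and bound: "\<And>\<nu> s. \<nu> \<in> F_ev \<Longrightarrow> s \<in> F_ev \<Longrightarrow> s \<le> \<nu> \<Longrightarrow>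
      p_weight \<theta> lam \<nu> * norm (residual emb P G s (jacobi_coeff a b v \<nu>)) \<le> g \<nu>"
    and g: "(g has_sum T) F_ev"
  shows "norm (emb (jacobi_coeff a b v (\<lambda>_. 0)) - sparse_quad a b emb P G (cont_rep a b v)) \<le> T"
proof -
  let ?c = "jacobi_coeff a b v" and ?f = "cont_rep a b v"
  let ?d = "\<lambda>s \<nu>. tensor_coeff a b s \<nu>"
  let ?K = "\<lambda>s. {k. (k, s) \<in> G}"
  let ?S = "snd ` G"
  let ?D = "\<lambda>\<nu>. {s. s \<in> F_ev \<and> s \<le> \<nu>}"
  define L where "L s w = (\<Sum>k\<in>?K s. delta_op P k (emb w))" for s w
  have finK: "finite (?K s)" for s
    by (rule finite_subset[of _ "fst ` G"]) (use G(1) in force)+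
  have blP: "bounded_linear (\<lambda>w. P m (emb w))" for m
  proof (rule bounded_linear_intro[where K="C1 * onorm emb"])
    interpret emb: bounded_linear emb by (rule emb)
    interpret P: linear "P m" by (rule P)
    show "P m (emb (x + y)) = P m (emb x) + P m (emb y)" for x y by (simp add: emb.add P.add)
    show "P m (emb (r *\<^sub>R x)) = r *\<^sub>R P m (emb x)" for r x by (simp add: emb.scaleR P.scaleR)
    show "norm (P m (emb x)) \<le> norm x * (C1 * onorm emb)" for x
    proof (cases "norm (emb x) = 0")
      case True
      then have "emb x = emb 0" by (simp add: emb.zero)
      then have "P m (emb x) = 0" by (simp add: emb.zero P.zero)
      \<comment> \<open>\<open>P_bound\<close> forces the sign of \<open>C1\<close> as soon as
        \<open>emb\<close> is not identically zero; otherwise the operator norm of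
        \<open>emb\<close> vanishes.\<close>
      moreover have "C1 \<ge> 0 \<or> (\<forall>x. emb x = 0)"
      proof (rule ccontr)
        assume "\<not> (C1 \<ge> 0 \<or> (\<forall>x. emb x = 0))"
        then obtain z where "C1 < 0" "emb z \<noteq> 0" by auto
        then have "C1 * norm (emb z) < 0" by (simp add: mult_neg_pos)
        then show False using P_bound[of m z] norm_ge_zero[of "P m (emb z)"] by linarith
      qed
      then have "0 \<le> C1 * onorm emb"
      proof
        assume "\<forall>x. emb x = 0"
        then have "emb = (\<lambda>_. 0)" by auto
        then show ?thesis by (simp add: onorm_zero)
      qed (simp add: onorm_pos_le emb)
      ultimately show ?thesis by simp
    next
      case False
      then have "0 < norm (emb x)" by simp
      moreover have "0 \<le> C1 * norm (emb x)" by (rule order_trans[OF norm_ge_zero P_bound])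
      ultimately have "0 \<le> C1" by (simp add: zero_le_mult_iff)
      have "norm (P m (emb x)) \<le> C1 * norm (emb x)" by (rule P_bound)
      also have "\<dots> \<le> C1 * (onorm emb * norm x)"
        by (rule mult_left_mono[OF onorm[OF emb] \<open>0 \<le> C1\<close>])
      finally show ?thesis by (simp add: mult_ac)
    qed
  qed
  have bl\<delta>: "bounded_linear (\<lambda>w. delta_op P k (emb w))" for k
    unfolding delta_op_def by (cases "k = 0") (simp_all add: blP[of 1, simplified] blP bounded_linear_sub)
  have blL: "bounded_linear (L s)" for s
    unfolding L_def by (intro bounded_linear_sum bl\<delta>)
  have J: "((\<lambda>\<nu>. J_multi a b \<nu> y *\<^sub>R ?c \<nu>) has_sum ?f y) F_ev" if "\<And>j. y j \<in> {-1..1}" for y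
    by (rule cont_rep_has_sum[OF summ that])
  have SF: "s \<in> F_ev" if "s \<in> ?S" for s using that G(2) by auto
  have hs: "((\<lambda>\<nu>. L s (?d s \<nu> *\<^sub>R ?c \<nu>)) has_sum L s (quad_diff_multi a b s ?f)) F_ev" if "s \<in> ?S" for s
    by (rule has_sum_bounded_linear[OF blL quad_diff_multi_has_sum[OF SF[OF that] J]])
  have sq_eq: "sparse_quad a b emb P G ?f = (\<Sum>s\<in>?S. L s (quad_diff_multi a b s ?f))"
  proof -
    have "(\<Sum>s\<in>?S. L s (quad_diff_multi a b s ?f))
        = (\<Sum>(s, k)\<in>Sigma ?S ?K. delta_op P k (emb (quad_diff_multi a b s ?f)))"
      unfolding L_def by (rule sum.Sigma) (use G(1) finK in auto)
    also have "\<dots> = sparse_quad a b emb P G ?f"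
      unfolding sparse_quad_def
      by (rule sum.reindex_bij_witness[where i=prod.swap and j=prod.swap]) force+
    finally show ?thesis by simp
  qed
  have sq: "((\<lambda>\<nu>. \<Sum>s\<in>?S. L s (?d s \<nu> *\<^sub>R ?c \<nu>)) has_sum sparse_quad a b emb P G ?f) F_ev"
    unfolding sq_eq by (rule has_sum_finite_sum[OF finite_imageI[OF G(1)] hs])
  have c0: "((\<lambda>\<nu>. if \<nu> = (\<lambda>_. 0) then emb (?c \<nu>) else 0) has_sum emb (?c (\<lambda>_. 0))) F_ev"
    by (rule has_sum_cong_neutral[THEN iffD1, OF _ _ _ has_sum_finiteI[of "{\<lambda>_. 0}" "emb (?c (\<lambda>_. 0))" "\<lambda>\<nu>. emb (?c \<nu>)"]])
       (use zero_in_F_ev in auto)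
  have "((\<lambda>\<nu>. (if \<nu> = (\<lambda>_. 0) then emb (?c \<nu>) else 0) + - (\<Sum>s\<in>?S. L s (?d s \<nu> *\<^sub>R ?c \<nu>)))
      has_sum (emb (?c (\<lambda>_. 0)) + - sparse_quad a b emb P G ?f)) F_ev"
    by (intro has_sum_add c0) (use sq in \<open>simp add: has_sum_uminus\<close>)
  then have diff: "((\<lambda>\<nu>. (if \<nu> = (\<lambda>_. 0) then emb (?c \<nu>) else 0) - (\<Sum>s\<in>?S. L s (?d s \<nu> *\<^sub>R ?c \<nu>)))
      has_sum (emb (?c (\<lambda>_. 0)) - sparse_quad a b emb P G ?f)) F_ev"
    by simp
  have "norm ((if \<nu> = (\<lambda>_. 0) then emb (?c \<nu>) else 0) - (\<Sum>s\<in>?S. L s (?d s \<nu> *\<^sub>R ?c \<nu>))) \<le> g \<nu>"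
    if \<nu>: "\<nu> \<in> F_ev" for \<nu>
  proof -
    have finD: "finite (?D \<nu>)" by (rule sum_prod_F_ev(2)[OF \<nu>])
    have "(\<Sum>s\<in>?S. L s (?d s \<nu> *\<^sub>R ?c \<nu>)) = (\<Sum>s\<in>?S. ?d s \<nu> *\<^sub>R L s (?c \<nu>))"
      by (simp add: linear_cmul[OF bounded_linear.linear[OF blL]])
    also have "\<dots> = (\<Sum>s\<in>?S \<inter> ?D \<nu>. ?d s \<nu> *\<^sub>R L s (?c \<nu>))"
      by (rule sum.mono_neutral_right) (use G(1) SF tensor_coeff_eq_0 \<nu> in auto)
    \<comment> \<open>An \<open>s\<close> that does not occur in \<open>G\<close> has an empty
      slice, so \<open>L s = 0\<close> there. The sum must run over all \<open>s \<le> \<nu>\<close>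
      before the identity for the sum of the coefficients can be inserted.\<close>
    also have "\<dots> = (\<Sum>s\<in>?D \<nu>. ?d s \<nu> *\<^sub>R L s (?c \<nu>))"
    proof (rule sum.mono_neutral_left)
      show "\<forall>s\<in>?D \<nu> - ?S \<inter> ?D \<nu>. ?d s \<nu> *\<^sub>R L s (?c \<nu>) = 0"
      proof
        fix s assume "s \<in> ?D \<nu> - ?S \<inter> ?D \<nu>"
        then have "?K s = {}" by force
        then show "?d s \<nu> *\<^sub>R L s (?c \<nu>) = 0" unfolding L_def by simp
      qed
    qed (use finD in auto)
    finally have 1: "(\<Sum>s\<in>?S. L s (?d s \<nu> *\<^sub>R ?c \<nu>)) = (\<Sum>s\<in>?D \<nu>. ?d s \<nu> *\<^sub>R L s (?c \<nu>))" .
    have "(if \<nu> = (\<lambda>_. 0) then emb (?c \<nu>) else 0) = (\<Sum>s\<in>?D \<nu>. ?d s \<nu>) *\<^sub>R emb (?c \<nu>)"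
      by (simp add: sum_tensor_coeff[OF \<nu>])
    then have eq: "(if \<nu> = (\<lambda>_. 0) then emb (?c \<nu>) else 0) - (\<Sum>s\<in>?S. L s (?d s \<nu> *\<^sub>R ?c \<nu>))
        = (\<Sum>s\<in>?D \<nu>. ?d s \<nu> *\<^sub>R residual emb P G s (?c \<nu>))"
      unfolding 1 by (simp add: scaleR_sum_left residual_def L_def scaleR_right_diff_distrib sum_subtractf)
    have "norm (\<Sum>s\<in>?D \<nu>. ?d s \<nu> *\<^sub>R residual emb P G s (?c \<nu>))
      \<le> (\<Sum>s\<in>?D \<nu>. \<bar>?d s \<nu>\<bar> * (g \<nu> / p_weight \<theta> lam \<nu>))"
    proof (rule sum_norm_le)
      fix s assume s: "s \<in> ?D \<nu>"
      have "norm (residual emb P G s (?c \<nu>)) \<le> g \<nu> / p_weight \<theta> lam \<nu>"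
        using bound[OF \<nu>, of s] s p_weight_ge_1[of \<nu>] by (simp add: field_simps)
      then show "norm (?d s \<nu> *\<^sub>R residual emb P G s (?c \<nu>)) \<le> \<bar>?d s \<nu>\<bar> * (g \<nu> / p_weight \<theta> lam \<nu>)"
        by (simp only: norm_scaleR mult_left_mono abs_ge_zero)
    qed
    also have "\<dots> = (\<Sum>s\<in>?D \<nu>. \<bar>?d s \<nu>\<bar>) * (g \<nu> / p_weight \<theta> lam \<nu>)"
      by (rule sum_distrib_right[symmetric])
    also have "\<dots> \<le> p_weight \<theta> lam \<nu> * (g \<nu> / p_weight \<theta> lam \<nu>)"
    proof (rule mult_right_mono[OF sum_abs_tensor_coeff_le[OF \<nu>]])
      \<comment> \<open>The instance \<open>s = \<nu>\<close> of the bound shows that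
        \<open>g \<nu>\<close> is nonnegative.\<close>
      have "0 \<le> p_weight \<theta> lam \<nu> * norm (residual emb P G \<nu> (?c \<nu>))"
        using p_weight_ge_1[of \<nu>] by (intro mult_nonneg_nonneg) auto
      also have "\<dots> \<le> g \<nu>" by (rule bound[OF \<nu> \<nu>]) simp
      finally show "0 \<le> g \<nu> / p_weight \<theta> lam \<nu>" using p_weight_ge_1[of \<nu>] by simp
    qed
    also have "\<dots> = g \<nu>" using p_weight_ge_1[of \<nu>] by simp
    finally show ?thesis unfolding eq .
  qed
  with diff g show ?thesis by (rule norm_infsum_le)
qed

end

section \<open>Dyadic slices of the index set\<close>

lemma sum_delta_op: "(\<Sum>k\<le>K. delta_op P k w) = P (2 ^ K) w"
  by (induction K) (auto simp: delta_op_def)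

text \<open>\<open>K\<close> is the floor of \<open>l\<close>, where
  \<open>2 powr l = (Y / X) powr (1 / \<gamma>)\<close>. The upper bound on \<open>2 ^ K\<close>
  serves the dimension count; the lower one, with its factor 2 from rounding, serves the spatial
  error.\<close>

lemma dyadic_slice:
  fixes X Y \<gamma> :: real
  assumes "\<gamma> > 0" "0 < X" "X \<le> Y"
  obtains K :: nat where "{k::nat. 2 powr (\<gamma> * real k) * X \<le> Y} = {..K}"
    "2 ^ K \<le> (Y / X) powr (1 / \<gamma>)" "(Y / X) powr (1 / \<gamma>) \<le> 2 * 2 ^ K"
proof -
  define l where "l = log 2 (Y / X) / \<gamma>"
  define K where "K = nat \<lfloor>l\<rfloor>"
  have Y: "Y > 0" "Y / X \<ge> 1" using assms by auto
  have l0: "l \<ge> 0" using Y assms by (simp add: l_def)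
  have l: "(Y / X) powr (1 / \<gamma>) = 2 powr l"
  proof -
    have "2 powr l = (2 powr log 2 (Y / X)) powr (1 / \<gamma>)"
      unfolding l_def by (subst powr_powr) simp
    then show ?thesis using Y by simp
  qed
  have K: "real K \<le> l" "l \<le> real K + 1" using l0 unfolding K_def by linarith+
  show ?thesis
  proof
    have "2 powr (\<gamma> * real k) * X \<le> Y \<longleftrightarrow> k \<le> K" for k :: nat
    proof -
      have "2 powr (\<gamma> * real k) * X \<le> Y \<longleftrightarrow> 2 powr (\<gamma> * real k) \<le> Y / X"
        using assms(2) by (simp add: field_simps)
      also have "\<dots> \<longleftrightarrow> \<gamma> * real k \<le> log 2 (Y / X)"
        using Y by (subst le_log_iff) auto
      also have "\<dots> \<longleftrightarrow> real k \<le> l"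
        using assms(1) by (simp add: l_def field_simps)
      also have "\<dots> \<longleftrightarrow> k \<le> K"
        using l0 unfolding K_def by linarith
      finally show ?thesis .
    qed
    then show "{k::nat. 2 powr (\<gamma> * real k) * X \<le> Y} = {..K}" by auto
    have "2 ^ K = 2 powr real K" by (simp add: powr_realpow)
    then show "2 ^ K \<le> (Y / X) powr (1 / \<gamma>)" using K by (simp add: l)
    have "2 * 2 ^ K = 2 powr (real K + 1)" by (simp add: powr_realpow powr_add)
    then show "(Y / X) powr (1 / \<gamma>) \<le> 2 * 2 ^ K" using K by (simp add: l)
  qed
qed

lemma dyadic_slice_empty:
  fixes X Y \<gamma> :: real
  assumes "\<gamma> > 0" "0 < X" "Y < X"
  shows "{k::nat. 2 powr (\<gamma> * real k) * X \<le> Y} = {}"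
proof -
  have "Y < 2 powr (\<gamma> * real k) * X" for k :: nat
  proof -
    have "1 \<le> 2 powr (\<gamma> * real k)" using assms(1) by (intro ge_one_powr_ge_zero) auto
    then have "1 * X \<le> 2 powr (\<gamma> * real k) * X" using assms(2) by (intro mult_right_mono) auto
    then show ?thesis using assms(3) by simp
  qed
  then show ?thesis by (auto simp: not_le)
qed

text \<open>One formula covers two cases. If the slice is empty, nothing is subtracted, but
  \<open>X > Y\<close> makes the power of \<open>X / Y\<close> at least 1. Otherwise the differences
  telescope to \<open>P (2 ^ K)\<close>, and \<open>(2 ^ K) powr (- \<alpha>)\<close> is at most
  \<open>(X / Y) powr (\<alpha> / \<gamma>)\<close> times the rounding factor
  \<open>2 powr \<alpha>\<close>.\<close>

lemma residual_bound:
  fixes emb :: "'b::real_normed_vector \<Rightarrow> 'c::real_normed_vector"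
  assumes slice: "{k. (k, s) \<in> G} = {k. 2 powr (\<gamma> * real k) * X \<le> Y}"
    and pos: "\<gamma> > 0" "0 < X" "0 < Y" "\<alpha> > 0" "C0 > 0" "C2 > 0"
    and emb: "norm (emb w) \<le> C0 * norm w"
    and approx: "\<And>m. m \<ge> 1 \<Longrightarrow> norm (emb w - P m (emb w)) \<le> C2 * real m powr (- \<alpha>) * norm w"
  shows "norm (residual emb P G s w) \<le> (C0 + C2 * 2 powr \<alpha>) * ((X / Y) powr (\<alpha> / \<gamma>) * norm w)"
proof (cases "X \<le> Y")
  case False
  then have "residual emb P G s w = emb w"
    using dyadic_slice_empty[of \<gamma> X Y] pos by (simp add: residual_def slice)
  then have "norm (residual emb P G s w) \<le> C0 * norm w" using emb by simp
  also have "\<dots> \<le> C0 * ((X / Y) powr (\<alpha> / \<gamma>) * norm w)"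
  proof -
    have "1 \<le> (X / Y) powr (\<alpha> / \<gamma>)" using False pos by (intro ge_one_powr_ge_zero) auto
    then have "1 * norm w \<le> (X / Y) powr (\<alpha> / \<gamma>) * norm w" by (intro mult_right_mono) auto
    then show ?thesis using pos by simp
  qed
  also have "\<dots> \<le> (C0 + C2 * 2 powr \<alpha>) * ((X / Y) powr (\<alpha> / \<gamma>) * norm w)"
    using pos by (intro mult_right_mono) auto
  finally show ?thesis .
next
  case True
  then obtain K where K: "{k::nat. 2 powr (\<gamma> * real k) * X \<le> Y} = {..K}"
    "(Y / X) powr (1 / \<gamma>) \<le> 2 * 2 ^ K"
    using dyadic_slice[OF pos(1,2)] by metis
  have "residual emb P G s w = emb w - P (2 ^ K) (emb w)"
    by (simp add: residual_def slice K(1) sum_delta_op)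
  then have "norm (residual emb P G s w) \<le> C2 * real (2 ^ K) powr (- \<alpha>) * norm w"
    using approx[of "2 ^ K"] by simp
  also have "real (2 ^ K) powr (- \<alpha>) \<le> 2 powr \<alpha> * (X / Y) powr (\<alpha> / \<gamma>)"
  proof -
    have "real (2 ^ K) powr (- \<alpha>) = 2 powr \<alpha> * (2 * 2 ^ K) powr (- \<alpha>)"
      by (simp add: powr_mult powr_minus)
    also have "(2 * 2 ^ K) powr (- \<alpha>) \<le> ((Y / X) powr (1 / \<gamma>)) powr (- \<alpha>)"
      using K(2) pos by (intro powr_mono2') auto
    also have "((Y / X) powr (1 / \<gamma>)) powr (- \<alpha>) = (X / Y) powr (\<alpha> / \<gamma>)"
      using pos by (simp add: powr_powr powr_minus powr_divide)
    finally show ?thesis by simp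
  qed
  finally have "norm (residual emb P G s w) \<le> C2 * (2 powr \<alpha> * (X / Y) powr (\<alpha> / \<gamma>)) * norm w"
    using pos by (simp add: mult_left_mono mult_right_mono)
  also have "\<dots> = (C2 * 2 powr \<alpha>) * ((X / Y) powr (\<alpha> / \<gamma>) * norm w)" by simp
  also have "\<dots> \<le> (C0 + C2 * 2 powr \<alpha>) * ((X / Y) powr (\<alpha> / \<gamma>) * norm w)"
    using pos by (intro mult_right_mono) auto
  finally show ?thesis .
qed

text \<open>A geometric sum is at most twice its last term, and an empty slice contributes
  0.\<close>

lemma sum_dyadic_slice_le:
  fixes X Y \<gamma> :: real
  assumes "\<gamma> > 0" "0 < X" "0 < Y"
  shows "finite {k::nat. 2 powr (\<gamma> * real k) * X \<le> Y}"
    and "(\<Sum>k | 2 powr (\<gamma> * real k) * X \<le> Y. 2 ^ k) \<le> 2 * (Y / X) powr (1 / \<gamma>)"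
proof -
  have "finite {k::nat. 2 powr (\<gamma> * real k) * X \<le> Y} \<and>
    (\<Sum>k | 2 powr (\<gamma> * real k) * X \<le> Y. 2 ^ k) \<le> 2 * (Y / X) powr (1 / \<gamma>)"
  proof (cases "X \<le> Y")
    case True
    then obtain K where K: "{k::nat. 2 powr (\<gamma> * real k) * X \<le> Y} = {..K}"
      "2 ^ K \<le> (Y / X) powr (1 / \<gamma>)"
      using dyadic_slice[OF assms(1,2)] by metis
    have "(\<Sum>k\<le>K. 2 ^ k) \<le> (2 * 2 ^ K :: real)" by (induction K) auto
    then show ?thesis unfolding K(1) using K(2) by auto
  qed (use dyadic_slice_empty[OF assms(1,2)] in simp)
  then show "finite {k::nat. 2 powr (\<gamma> * real k) * X \<le> Y}"
    and "(\<Sum>k | 2 powr (\<gamma> * real k) * X \<le> Y. 2 ^ k) \<le> 2 * (Y / X) powr (1 / \<gamma>)" by auto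
qed

text \<open>Serves both index sets: \<gamma> = 1 with \<open>X = \<sigma>2 powr q2\<close> in one
  regime, \<gamma> = \<tau> with \<open>X = \<sigma>2\<close> and \<open>A\<close> cut down by
  \<sigma>1 in the other. Only indices with \<open>X s \<le> Y\<close> have a nonempty slice, so
  \<open>G\<close> is a finite disjoint union of finite slices.\<close>

lemma dyadic_index_set:
  fixes X :: "'i \<Rightarrow> real" and Y \<gamma> B :: real
  assumes G: "\<And>k s. (k, s) \<in> G \<longleftrightarrow> s \<in> A \<and> 2 powr (\<gamma> * real k) * X s \<le> Y"
    and pos: "\<gamma> > 0" "0 < Y" "\<And>s. s \<in> A \<Longrightarrow> 0 < X s"
    and fin: "finite {s\<in>A. X s \<le> Y}"
    and bound: "(\<Sum>s | s \<in> A \<and> X s \<le> Y. (Y / X s) powr (1 / \<gamma>)) \<le> B"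
  shows "finite G" and "real (\<Sum>(k, s)\<in>G. 2 ^ k) \<le> 2 * B"
proof -
  let ?S = "{s\<in>A. X s \<le> Y}" and ?K = "\<lambda>s. {k::nat. 2 powr (\<gamma> * real k) * X s \<le> Y}"
  have GS: "G = prod.swap ` Sigma ?S ?K"
  proof -
    have "X s \<le> Y" if "(k, s) \<in> G" for k s
      using that dyadic_slice_empty[of \<gamma> "X s" Y] pos G by (metis (mono_tags, lifting) empty_iff mem_Collect_eq not_le)
    then show ?thesis using G by force
  qed
  have finK: "finite (?K s)" if "s \<in> ?S" for s
    using that pos by (intro sum_dyadic_slice_le(1)) auto
  show "finite G" unfolding GS using fin finK by (intro finite_imageI finite_SigmaI) auto
  have "real (\<Sum>(k, s)\<in>G. 2 ^ k) = (\<Sum>(s, k)\<in>Sigma ?S ?K. 2 ^ k)"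
    unfolding GS by (subst sum.reindex) (auto simp: case_prod_beta o_def)
  also have "\<dots> = (\<Sum>s\<in>?S. \<Sum>k\<in>?K s. 2 ^ k)"
    by (rule sum.Sigma[symmetric]) (use fin finK in auto)
  also have "\<dots> \<le> (\<Sum>s\<in>?S. 2 * (Y / X s) powr (1 / \<gamma>))"
    by (intro sum_mono sum_dyadic_slice_le(2)) (use pos in auto)
  also have "\<dots> \<le> 2 * B" using bound by (simp flip: sum_distrib_left)
  finally show "real (\<Sum>(k, s)\<in>G. 2 ^ k) \<le> 2 * B" .
qed

text \<open>Each pair \<open>(k, \<nu>)\<close> adds at most \<open>2 ^ k\<close> spanning
  functions, namely the \<nu>-th polynomial times the members of a spanning set of
  \<open>V (2 ^ k)\<close>.\<close>

lemma approx_space_dim_le: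
  fixes V :: "nat \<Rightarrow> 'b::real_normed_vector set"
  assumes V: "\<And>m. has_dim_le (V m) m" and "finite G" "(\<Sum>(k, s)\<in>G. 2 ^ k) \<le> n"
  shows "fun_has_dim_le D (approx_space a b V G) n"
proof -
  have "\<exists>B. finite B \<and> card B \<le> (\<Sum>(k, s)\<in>G. 2 ^ k) \<and>
      (\<forall>f\<in>approx_space a b V G. \<exists>c. \<forall>y\<in>D. f y = (\<Sum>g\<in>B. c g *\<^sub>R g y))"
    using assms(2)
  proof (induction G rule: finite_induct)
    case empty
    then show ?case by (intro exI[of _ "{}"]) (auto simp: approx_space_def)
  next
    case (insert x G)
    obtain k \<nu> where x: "x = (k, \<nu>)" by (cases x)
    from insert.IH obtain B where B: "finite B" "card B \<le> (\<Sum>(k, s)\<in>G. 2 ^ k)"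
      "\<And>f. f \<in> approx_space a b V G \<Longrightarrow> \<exists>c. \<forall>y\<in>D. f y = (\<Sum>g\<in>B. c g *\<^sub>R g y)" by blast
    from V[of "2 ^ k"] obtain W where W: "finite W" "card W \<le> 2 ^ k" "V (2 ^ k) \<subseteq> span W"
      by (auto simp: has_dim_le_def)
    define E where "E w y = J_multi a b \<nu> y *\<^sub>R w" for w :: 'b and y
    let ?B = "B \<union> E ` W"
    have "card ?B \<le> card B + card (E ` W)" by (rule card_Un_le)
    also have "\<dots> \<le> (\<Sum>(k, s)\<in>G. 2 ^ k) + 2 ^ k"
      using B(2) card_image_le[OF W(1), of E] W(2) by linarith
    also have "\<dots> = (\<Sum>(k, s)\<in>insert x G. 2 ^ k)"
      using insert.hyps by (simp add: x)
    finally have card: "card ?B \<le> (\<Sum>(k, s)\<in>insert x G. 2 ^ k)" .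
    have "\<exists>c. \<forall>y\<in>D. f y = (\<Sum>g\<in>?B. c g *\<^sub>R g y)" if f: "f \<in> approx_space a b V (insert x G)" for f
    proof -
      from f have "\<exists>c. (\<forall>(k, \<nu>)\<in>insert x G. c k \<nu> \<in> V (2 ^ k)) \<and>
          f = (\<lambda>y. \<Sum>(k, \<nu>)\<in>insert x G. J_multi a b \<nu> y *\<^sub>R c k \<nu>)"
        unfolding approx_space_def by (rule CollectD)
      then obtain c where "(\<forall>(k, \<nu>)\<in>insert x G. c k \<nu> \<in> V (2 ^ k)) \<and>
          f = (\<lambda>y. \<Sum>(k, \<nu>)\<in>insert x G. J_multi a b \<nu> y *\<^sub>R c k \<nu>)"
        by (rule exE)
      then have c: "\<And>k \<nu>. (k, \<nu>) \<in> insert x G \<Longrightarrow> c k \<nu> \<in> V (2 ^ k)"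
        "f = (\<lambda>y. \<Sum>(k, \<nu>)\<in>insert x G. J_multi a b \<nu> y *\<^sub>R c k \<nu>)"
        by (auto simp only:)
      define f1 where "f1 = (\<lambda>y. \<Sum>(k, \<nu>)\<in>G. J_multi a b \<nu> y *\<^sub>R c k \<nu>)"
      have "f1 \<in> approx_space a b V G"
        unfolding approx_space_def f1_def
        by (rule CollectI, rule exI[of _ c]) (use c(1) in auto)
      then obtain c1 where c1: "\<And>y. y \<in> D \<Longrightarrow> f1 y = (\<Sum>g\<in>B. c1 g *\<^sub>R g y)"
        using B(3) by blast
      have "c k \<nu> \<in> span W" using c(1)[of k \<nu>] W(3) x by auto
      then obtain u where u: "c k \<nu> = (\<Sum>w\<in>W. u w *\<^sub>R w)"
        using span_finite[OF W(1)] by auto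
      \<comment> \<open>Different \<open>w\<close> may give the same function, and it may already
        lie in \<open>B\<close>; the coefficients are therefore collected over the fibres of
        \<open>E\<close> and added to those of \<open>f1\<close>.\<close>
      define c2 where "c2 g = (\<Sum>w | w \<in> W \<and> E w = g. u w)" for g
      have "f y = (\<Sum>g\<in>?B. ((if g \<in> B then c1 g else 0) + c2 g) *\<^sub>R g y)" if y: "y \<in> D" for y
      proof -
        have "f y = f1 y + J_multi a b \<nu> y *\<^sub>R c k \<nu>"
          using insert.hyps by (simp add: c(2) f1_def x add.commute)
        also have "J_multi a b \<nu> y *\<^sub>R c k \<nu> = (\<Sum>w\<in>W. u w *\<^sub>R E w y)"
          by (simp add: u E_def scaleR_sum_right mult.commute)
        also have "\<dots> = (\<Sum>g\<in>E ` W. \<Sum>w | w \<in> W \<and> E w = g. u w *\<^sub>R E w y)"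
          by (rule sum.image_gen[OF W(1)])
        also have "\<dots> = (\<Sum>g\<in>E ` W. c2 g *\<^sub>R g y)"
          unfolding c2_def scaleR_sum_left by (intro sum.cong) auto
        also have "\<dots> = (\<Sum>g\<in>?B. c2 g *\<^sub>R g y)"
        proof (rule sum.mono_neutral_left)
          show "\<forall>g\<in>?B - E ` W. c2 g *\<^sub>R g y = 0"
          proof
            fix g assume "g \<in> ?B - E ` W"
            then have e: "{w. w \<in> W \<and> E w = g} = {}" by auto
            show "c2 g *\<^sub>R g y = 0" unfolding c2_def e by simp
          qed
        qed (use B(1) W(1) in auto)
        also have "f1 y = (\<Sum>g\<in>?B. (if g \<in> B then c1 g else 0) *\<^sub>R g y)"
          unfolding c1[OF y] using B(1) W(1) by (intro sum.mono_neutral_cong_left) auto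
        finally show ?thesis by (simp add: sum.distrib scaleR_add_left)
      qed
      then show ?thesis
        by (intro exI[of _ "\<lambda>g. (if g \<in> B then c1 g else 0) + c2 g"] ballI)
    qed
    then show ?case
      using card B(1) W(1) by (intro exI[of _ ?B] conjI ballI) auto
  qed
  then show ?thesis
    unfolding fun_has_dim_le_def using assms(3) by (meson order_trans)
qed


section \<open>Convergence rates\<close>

lemma finite_superlevel_set:
  fixes f :: "'i \<Rightarrow> real"
  assumes "f summable_on A" "\<And>x. x \<in> A \<Longrightarrow> 0 \<le> f x" "e > 0"
  shows "finite {x \<in> A. e \<le> f x}"
proof (rule ccontr)
  assume "infinite {x \<in> A. e \<le> f x}"
  obtain n :: nat where n: "infsum f A / e < real n" using reals_Archimedean2 by blast
  obtain B where B: "finite B" "card B = n" "B \<subseteq> {x \<in> A. e \<le> f x}"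
    using infinite_arbitrarily_large[OF \<open>infinite {x \<in> A. e \<le> f x}\<close>] by blast
  have "real n * e = (\<Sum>x\<in>B. e)" using B by simp
  also have "\<dots> \<le> sum f B" using B by (intro sum_mono) auto
  also have "\<dots> \<le> infsum f A" using B assms by (intro finite_sum_le_infsum) auto
  finally show False using n assms(3) by (simp add: field_simps)
qed

text \<open>Split at \<open>x = 1 / L\<close>. In the dimension count \<open>x\<close> is
  \<open>\<sigma>2 s powr (- q2)\<close>, and the constant term is compensated by the cut in
  \<sigma>1.\<close>

lemma powr_le_split:
  fixes x L \<rho> :: real
  assumes "0 < x" "0 < L" "0 \<le> \<rho>" "\<rho> \<le> 1"
  shows "x powr \<rho> \<le> L powr (1 - \<rho>) * x + L powr (- \<rho>)"
proof (cases "x \<le> 1 / L")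
  case True
  then have "x powr \<rho> \<le> (1 / L) powr \<rho>" using assms by (intro powr_mono2) auto
  also have "\<dots> = L powr (- \<rho>)" using assms by (simp add: powr_divide powr_minus_divide)
  finally show ?thesis using assms by (simp add: add_increasing)
next
  case False
  then have "1 / x \<le> L" using assms by (simp add: field_simps)
  then have "(1 / x) powr (1 - \<rho>) \<le> L powr (1 - \<rho>)" using assms by (intro powr_mono2) auto
  then have "(1 / x) powr (1 - \<rho>) * x \<le> L powr (1 - \<rho>) * x" using assms by (intro mult_right_mono) auto
  moreover have "(1 / x) powr (1 - \<rho>) * x = x powr \<rho>"
    using assms by (simp add: powr_divide powr_diff)
  ultimately show ?thesis using assms by (simp add: add_increasing2)
qed

text \<open>With the exponent \<open>1 - q / 2\<close>, Young's inequality for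
  \<open>p * s powr (- q / 2)\<close> and \<open>s * x\<close> produces exactly the terms of the two
  summability hypotheses.\<close>

lemma weighted_young:
  fixes p s x q :: real
  assumes "0 < s"
  shows "p * (s powr (1 - q / 2) * x) \<le> (p\<^sup>2 * s powr (- q) + (s * x)\<^sup>2) / 2"
proof -
  have "p * (s powr (1 - q / 2) * x) = (p * s powr (- (q / 2))) * (s * x)"
    using powr_add[of s "- (q / 2)" 1] assms by simp
  also have "\<dots> \<le> ((p * s powr (- (q / 2)))\<^sup>2 + (s * x)\<^sup>2) / 2"
    using sum_squares_bound[of "p * s powr (- (q / 2))" "s * x"] by simp
  also have "(p * s powr (- (q / 2)))\<^sup>2 = p\<^sup>2 * s powr (- q)"
    by (simp add: power_mult_distrib power2_eq_square flip: powr_add)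
  finally show ?thesis .
qed

text \<open>The dimension bound is inverted by
  \<open>\<xi> powr E = n / (B * ln n powr \<omega>)\<close>. Writing \<open>ln n\<close> in place
  of \<open>ln \<xi>\<close> keeps the choice explicit and is safe because \<open>E \<ge> 1\<close>
  gives \<open>\<xi> \<le> n\<close>. The finitely many small \<open>n\<close> are served by
  \<open>\<xi>0\<close>.\<close>

lemma threshold_rate:
  fixes D err :: "real \<Rightarrow> real" and h E \<omega> B T E0 \<xi>0 :: real
  assumes pos: "h > 0" "E \<ge> 1" "\<omega> \<ge> 0" "B \<ge> 1" "T \<ge> 0"
    and D: "\<And>\<xi>. \<xi> \<ge> 2 \<Longrightarrow> D \<xi> \<le> B * (\<xi> powr E * ln \<xi> powr \<omega>)"
    and err: "\<And>\<xi>. \<xi> \<ge> 2 \<Longrightarrow> err \<xi> \<le> T * \<xi> powr (- h)"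
    and start: "\<xi>0 > 1" "D \<xi>0 \<le> 0" "err \<xi>0 \<le> E0" "E0 \<ge> 0"
  shows "\<exists>C>0. \<forall>n\<ge>1. \<exists>\<xi>>1. D \<xi> \<le> real n \<and>
    err \<xi> \<le> C * (real n powr (- (h / E)) * ln (real (max n 2)) powr (\<omega> * h / E))"
proof -
  define \<beta> where "\<beta> = h / E"
  define \<kappa> where "\<kappa> = \<omega> * h / E"
  have bk: "\<beta> > 0" "\<kappa> \<ge> 0" using pos by (auto simp: \<beta>_def \<kappa>_def)
  have "B > 0" using pos by simp
  then have "filterlim (\<lambda>n::nat. real n / (B * ln (real n) powr \<omega>)) at_top sequentially"
    by real_asymp
  then have "\<forall>\<^sub>F n::nat in sequentially. 2 powr E \<le> real n / (B * ln (real n) powr \<omega>)"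
    by (simp add: filterlim_at_top)
  then obtain n0 where n0: "\<And>n. n \<ge> n0 \<Longrightarrow> 2 powr E \<le> real n / (B * ln (real n) powr \<omega>)"
    by (auto simp: eventually_sequentially)
  \<comment> \<open>\<open>n \<ge> 3\<close> ensures \<open>ln n \<ge> 1\<close>, and
    \<open>n \<ge> n0\<close> ensures that the chosen \<xi> is at least 2.\<close>
  define N where "N = max n0 3"
  \<comment> \<open>The first summand serves \<open>n \<ge> N\<close>, the second the smaller
    \<open>n\<close>, where the rate is bounded below; the 1 makes \<open>C\<close>
    positive.\<close>
  define C where "C = T * B powr \<beta> + E0 * (real N powr \<beta> / ln 2 powr \<kappa>) + 1"
  have N: "real N \<ge> 3" by (simp add: N_def)
  have ln2: "ln (2::real) > 0" by simp
  have C: "C > 0" "T * B powr \<beta> \<le> C" "E0 * (real N powr \<beta> / ln 2 powr \<kappa>) \<le> C"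
    using pos start ln2 unfolding C_def by (auto intro!: add_nonneg_pos add_nonneg_nonneg)
  have "\<exists>\<xi>>1. D \<xi> \<le> real n \<and> err \<xi> \<le> C * (real n powr (- \<beta>) * ln (real (max n 2)) powr \<kappa>)"
    if n: "n \<ge> 1" for n :: nat
  proof (cases "n \<ge> N")
    case False
    have "1 \<le> (real N powr \<beta> / ln 2 powr \<kappa>) * (real n powr (- \<beta>) * ln (real (max n 2)) powr \<kappa>)"
    proof -
      have "1 \<le> real N powr \<beta> * real n powr (- \<beta>)"
      proof -
        have "real n powr \<beta> \<le> real N powr \<beta>" using False bk by (intro powr_mono2) auto
        then show ?thesis using n by (simp add: powr_minus field_simps)
      qed
      moreover have "1 \<le> ln (real (max n 2)) powr \<kappa> / ln 2 powr \<kappa>"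
        using bk ln2 by (simp add: powr_mono2)
      ultimately have "1 * 1 \<le> (real N powr \<beta> * real n powr (- \<beta>)) * (ln (real (max n 2)) powr \<kappa> / ln 2 powr \<kappa>)"
        by (intro mult_mono) auto
      then show ?thesis by simp
    qed
    then have "E0 * 1 \<le> E0 * ((real N powr \<beta> / ln 2 powr \<kappa>) * (real n powr (- \<beta>) * ln (real (max n 2)) powr \<kappa>))"
      using start(4) by (rule mult_left_mono)
    also have "\<dots> \<le> C * (real n powr (- \<beta>) * ln (real (max n 2)) powr \<kappa>)"
      unfolding mult.assoc[symmetric, of E0] by (rule mult_right_mono[OF C(3)]) simp
    finally have "err \<xi>0 \<le> C * (real n powr (- \<beta>) * ln (real (max n 2)) powr \<kappa>)" using start by simp
    then show ?thesis using start by (intro exI[of _ \<xi>0]) auto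
  next
    case True
    then have n3: "real n \<ge> 3" and nn0: "n \<ge> n0" by (auto simp: N_def)
    have ln1: "ln (real n) \<ge> 1"
      using exp_le n3 by (subst ln_ge_iff) auto
    define z where "z = real n / (B * ln (real n) powr \<omega>)"
    define \<xi> where "\<xi> = z powr (1 / E)"
    have lnw: "ln (real n) powr \<omega> \<ge> 1" using ln1 pos by (intro ge_one_powr_ge_zero) auto
    have z: "2 powr E \<le> z" using n0[OF nn0] by (simp add: z_def)
    have z0: "z > 0" using z by (rule less_le_trans[rotated]) simp
    have "1 * 1 \<le> B * ln (real n) powr \<omega>" using lnw pos by (intro mult_mono) auto
    then have zn: "z \<le> real n" using n3 unfolding z_def by (simp add: divide_le_eq mult_le_cancel_left1)
    have "2 = (2 powr E) powr (1 / E)" using pos by (simp add: powr_powr)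
    also have "\<dots> \<le> \<xi>" unfolding \<xi>_def using z pos by (intro powr_mono2) auto
    finally have \<xi>2: "\<xi> \<ge> 2" .
    have \<xi>E: "\<xi> powr E = z" using pos z0 by (simp add: \<xi>_def powr_powr)
    have "\<xi> \<le> real n"
    proof -
      have "\<xi> powr 1 \<le> \<xi> powr E" using \<xi>2 pos by (intro powr_mono) auto
      then show ?thesis using \<xi>E zn \<xi>2 by simp
    qed
    then have "ln \<xi> powr \<omega> \<le> ln (real n) powr \<omega>" using \<xi>2 pos by (intro powr_mono2) auto
    then have "D \<xi> \<le> B * (z * ln (real n) powr \<omega>)"
      using D[OF \<xi>2] \<xi>E pos z0 by (intro order_trans[OF D[OF \<xi>2]] mult_left_mono) auto
    also have "\<dots> = real n" using pos lnw ln1 by (simp add: z_def)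
    finally have "D \<xi> \<le> real n" .
    moreover have "err \<xi> \<le> C * (real n powr (- \<beta>) * ln (real (max n 2)) powr \<kappa>)"
    proof -
      have "\<xi> powr (- h) = z powr (- \<beta>)" by (simp add: \<xi>_def powr_powr \<beta>_def)
      also have "\<dots> = B powr \<beta> * (real n powr (- \<beta>) * (ln (real n) powr \<omega>) powr \<beta>)"
        using pos n3 lnw by (simp add: z_def powr_divide powr_mult powr_minus field_simps)
      also have "(ln (real n) powr \<omega>) powr \<beta> = ln (real n) powr \<kappa>"
        by (simp add: powr_powr \<beta>_def \<kappa>_def)
      finally have "err \<xi> \<le> T * (B powr \<beta> * (real n powr (- \<beta>) * ln (real n) powr \<kappa>))"
        using err[OF \<xi>2] by simp
      also have "\<dots> = (T * B powr \<beta>) * (real n powr (- \<beta>) * ln (real n) powr \<kappa>)" by simp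
      also have "\<dots> \<le> C * (real n powr (- \<beta>) * ln (real n) powr \<kappa>)"
        by (rule mult_right_mono[OF C(2)]) simp
      finally show ?thesis using n3 by (simp add: max_def)
    qed
    ultimately show ?thesis using \<xi>2 by (intro exI[of _ \<xi>]) auto
  qed
  then show ?thesis using C(1) unfolding \<beta>_def \<kappa>_def by blast
qed

text \<open>The condition on \<open>C\<close> fits the quadrature bound. The bound on the sup norm
  is smaller by the factor \<open>2 * k * ln (2 * k + 3)\<close>, which is at least 1, so the same
  weight dominates it.\<close>

lemma jacobi_quadratureI:
  fixes a b :: "nat \<Rightarrow> real" and lam0 \<theta>0 e C :: real
  assumes "\<And>j. a j > -1" "\<And>j. b j > -1" and pos: "\<theta>0 \<ge> 0" "e > 0" "C > 0"
    and J: "\<And>j k y. y \<in> {-1..1} \<Longrightarrow> \<bar>jacobi_J (a j) (b j) k y\<bar> \<le> (1 + lam0 * real k) powr \<theta>0"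
    and C: "\<And>k::nat. k \<ge> 1 \<Longrightarrow>
      2 * (1 + lam0 * real k) powr \<theta>0 * ln (2 * real k + 3) \<le> (C * real k + 1) powr (\<theta>0 + e)"
  shows "jacobi_quadrature a b (\<theta>0 + 1 + e) (C + 1)"
proof
  have bound: "real k * (2 * (1 + lam0 * real k) powr \<theta>0 * ln (2 * real k + 3))
      \<le> (1 + (C + 1) * real k) powr (\<theta>0 + 1 + e)" if "k > 0" for k :: nat
    using that pos by (intro weight_power_bound C) auto
  show "\<bar>jacobi_J (a j) (b j) k y\<bar> \<le> (1 + (C + 1) * real k) powr (\<theta>0 + 1 + e)"
    if "k > 0" "y \<in> {-1..1}" for j k y
  proof -
    have "1 \<le> ln (2 * real k + 3)"
      using exp_le that(1) by (subst ln_ge_iff) auto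
    then have "1 * (1 + lam0 * real k) powr \<theta>0 \<le> (real k * (2 * ln (2 * real k + 3))) * (1 + lam0 * real k) powr \<theta>0"
      using that(1) by (intro mult_right_mono) (auto intro!: mult_ge1_I)
    then have "(1 + lam0 * real k) powr \<theta>0 \<le> real k * (2 * (1 + lam0 * real k) powr \<theta>0 * ln (2 * real k + 3))"
      by (simp add: mult_ac)
    then show ?thesis using J[OF that(2)] bound[OF that(1)] by (meson order_trans)
  qed
  show "(\<Sum>m | even m \<and> m \<le> k. \<bar>quad_diff (a j) (b j) m (jacobi_J (a j) (b j) k)\<bar>)
      \<le> (1 + (C + 1) * real k) powr (\<theta>0 + 1 + e)" if "even k" "k > 0" for j k
    by (rule order_trans[OF sum_abs_quad_diff_jacobi_J_le[OF assms(1,2) that J] bound[OF that(2)]])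
qed (use assms in auto)


section \<open>The setting of the theorem and its summable families\<close>

locale sparse_quadrature = jacobi_quadrature a b \<theta> lam for a b \<theta> lam +
  fixes emb :: "'b::{real_normed_vector, complete_space} \<Rightarrow> 'c::real_normed_vector"
    and v :: "(nat \<Rightarrow> real) \<Rightarrow> 'b" and V :: "nat \<Rightarrow> 'c set" and P :: "nat \<Rightarrow> 'c \<Rightarrow> 'c"
    and \<alpha> C0 C1 C2 q1 q2 :: real and \<sigma>1 \<sigma>2 :: "(nat \<Rightarrow> nat) \<Rightarrow> real"
  assumes linear_emb: "linear emb" and C0: "C0 > 0" and emb_bound: "\<And>w. norm (emb w) \<le> C0 * norm w"
    and V: "\<And>m. has_dim_le (V m) m" and P: "\<And>m. linear (P m)"
    and \<alpha>: "\<alpha> > 0" and C2: "C2 > 0"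
    and P_bound: "\<And>m w. norm (P m (emb w)) \<le> C1 * norm (emb w)"
    and P_approx: "\<And>m w. m \<ge> 1 \<Longrightarrow> norm (emb w - P m (emb w)) \<le> C2 * real m powr (- \<alpha>) * norm w"
    and q: "0 < q1" "q1 \<le> q2" "q1 < 2" "q2 < 2"
    and \<sigma>1: "\<And>\<nu>. \<nu> \<in> F_ev \<Longrightarrow> \<sigma>1 \<nu> > 1" and \<sigma>2: "\<And>\<nu>. \<nu> \<in> F_ev \<Longrightarrow> \<sigma>2 \<nu> > 1"
    and mono1: "\<And>s \<nu>. s \<in> F_ev \<Longrightarrow> \<nu> \<in> F_ev \<Longrightarrow> s \<le> \<nu> \<Longrightarrow> \<sigma>1 s \<le> \<sigma>1 \<nu>"
    and mono2: "\<And>s \<nu>. s \<in> F_ev \<Longrightarrow> \<nu> \<in> F_ev \<Longrightarrow> s \<le> \<nu> \<Longrightarrow> \<sigma>2 s \<le> \<sigma>2 \<nu>"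
    and coeff1: "(\<lambda>\<nu>. (\<sigma>1 \<nu> * norm (emb (jacobi_coeff a b v \<nu>)))\<^sup>2) summable_on F_ev"
    and coeff2: "(\<lambda>\<nu>. (\<sigma>2 \<nu> * norm (jacobi_coeff a b v \<nu>))\<^sup>2) summable_on F_ev"
    and weight1: "(\<lambda>\<nu>. (p_weight \<theta> lam \<nu> powr (2 / q1) / \<sigma>1 \<nu>) powr q1) summable_on F_ev"
    and weight2: "(\<lambda>\<nu>. (p_weight \<theta> lam \<nu> powr (2 / q2) / \<sigma>2 \<nu>) powr q2) summable_on F_ev"
begin

abbreviation c where "c \<equiv> jacobi_coeff a b v"
abbreviation p where "p \<equiv> p_weight \<theta> lam"

text \<open>On \<open>F_ev\<close>, \<open>W1\<close> and \<open>W2\<close> are the summands of the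
  weight hypotheses with the power \<open>q1\<close> or \<open>q2\<close> multiplied out;
  \<open>S1\<close> and \<open>S2\<close> are those of the coefficient hypotheses. They are the two
  terms of \<open>weighted_young\<close>.\<close>

definition W1 where "W1 \<nu> = (p \<nu>)\<^sup>2 * \<sigma>1 \<nu> powr (- q1)"
definition W2 where "W2 \<nu> = (p \<nu>)\<^sup>2 * \<sigma>2 \<nu> powr (- q2)"
definition S1 where "S1 \<nu> = (\<sigma>1 \<nu> * norm (emb (c \<nu>)))\<^sup>2"
definition S2 where "S2 \<nu> = (\<sigma>2 \<nu> * norm (c \<nu>))\<^sup>2"
definition N1 where "N1 = infsum W1 F_ev"
definition N2 where "N2 = infsum W2 F_ev"
definition C3 where "C3 = C0 + C2 * 2 powr \<alpha>"
definition T1 where "T1 = infsum (\<lambda>\<nu>. (W1 \<nu> + S1 \<nu>) / 2) F_ev"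
definition T2 where "T2 = infsum (\<lambda>\<nu>. C3 * ((W2 \<nu> + S2 \<nu>) / 2)) F_ev"
definition err where "err \<xi> = norm (emb (c (\<lambda>_. 0))
  - sparse_quad a b emb P (G_ev \<alpha> q1 q2 \<sigma>1 \<sigma>2 \<xi>) (cont_rep a b v))"
definition dims where "dims \<xi> = real (\<Sum>(k, s)\<in>G_ev \<alpha> q1 q2 \<sigma>1 \<sigma>2 \<xi>. 2 ^ k)"

lemma bounded_linear_emb: "bounded_linear emb"
proof -
  interpret linear emb by (rule linear_emb)
  show ?thesis
    by (rule bounded_linear_intro[where K=C0]) (use add scale emb_bound in \<open>auto simp: mult.commute\<close>)
qed

lemma p_ge_1: "p \<nu> \<ge> 1"
  by (rule p_weight_ge_1)

lemma W_summable: "W1 summable_on F_ev" "W2 summable_on F_ev"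
proof -
  have eq: "(p \<nu> powr (2 / q) / s) powr q = (p \<nu>)\<^sup>2 * s powr (- q)" if "q > 0" "s > 1" for q s \<nu>
    using that p_ge_1[of \<nu>]
    by (simp add: powr_divide powr_powr powr_minus_divide)
  show "W1 summable_on F_ev"
    using weight1 by (rule summable_on_cong[THEN iffD1, rotated]) (use eq q \<sigma>1 in \<open>auto simp: W1_def\<close>)
  show "W2 summable_on F_ev"
    using weight2 by (rule summable_on_cong[THEN iffD1, rotated]) (use eq q \<sigma>2 in \<open>auto simp: W2_def\<close>)
qed

lemma S_summable: "S1 summable_on F_ev" "S2 summable_on F_ev"
  using coeff1 coeff2 by (auto simp: S1_def[abs_def] S2_def[abs_def])

lemma W_nonneg: "0 \<le> W1 \<nu>" "0 \<le> W2 \<nu>"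
  by (auto simp: W1_def W2_def)

lemma W_ge: "\<sigma>1 \<nu> powr (- q1) \<le> W1 \<nu>" "\<sigma>2 \<nu> powr (- q2) \<le> W2 \<nu>"
proof -
  have "1 \<le> (p \<nu>)\<^sup>2" using p_ge_1[of \<nu>] by simp
  then have "1 * x powr y \<le> (p \<nu>)\<^sup>2 * x powr y" for x y :: real by (rule mult_right_mono) simp
  then show "\<sigma>1 \<nu> powr (- q1) \<le> W1 \<nu>" "\<sigma>2 \<nu> powr (- q2) \<le> W2 \<nu>" by (auto simp: W1_def W2_def)
qed

lemma N_nonneg: "0 \<le> N1" "0 \<le> N2"
  by (auto simp: N1_def N2_def intro: infsum_nonneg W_nonneg)

lemma C3_pos: "C3 > 0"
  unfolding C3_def using C0 C2 by (simp add: add_pos_nonneg)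

lemma T1_has_sum: "((\<lambda>\<nu>. (W1 \<nu> + S1 \<nu>) / 2) has_sum T1) F_ev"
proof -
  have "(\<lambda>\<nu>. (1/2) * (W1 \<nu> + S1 \<nu>)) summable_on F_ev"
    by (intro summable_on_cmult_right summable_on_add W_summable S_summable)
  then show ?thesis unfolding T1_def by (intro has_sum_infsum) simp
qed

lemma T2_has_sum: "((\<lambda>\<nu>. C3 * ((W2 \<nu> + S2 \<nu>) / 2)) has_sum T2) F_ev"
proof -
  have "(\<lambda>\<nu>. C3 * ((1/2) * (W2 \<nu> + S2 \<nu>))) summable_on F_ev"
    by (intro summable_on_cmult_right summable_on_add W_summable S_summable)
  then show ?thesis unfolding T2_def by (intro has_sum_infsum) simp
qed

lemma T_nonneg: "0 \<le> T1" "0 \<le> T2"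
  using C3_pos W_nonneg
  by (auto simp: T1_def T2_def S1_def S2_def intro!: infsum_nonneg mult_nonneg_nonneg divide_nonneg_nonneg add_nonneg_nonneg)

text \<open>By \<open>\<sigma>2 \<nu> > 1\<close> and \<open>q2 < 2\<close>, inserting the factor
  \<open>\<sigma>2 \<nu> powr (1 - q2 / 2)\<close> only enlarges the term, and Young's inequality
  applies. This makes the Jacobi series converge at every point.\<close>

lemma coeff_summable: "(\<lambda>\<nu>. p \<nu> * norm (c \<nu>)) summable_on F_ev"
proof (rule summable_on_comparison_test)
  show "(\<lambda>\<nu>. (1/2) * (W2 \<nu> + S2 \<nu>)) summable_on F_ev"
    by (intro summable_on_cmult_right summable_on_add W_summable S_summable)
  fix \<nu> assume \<nu>: "\<nu> \<in> F_ev"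
  show "0 \<le> p \<nu> * norm (c \<nu>)" using p_ge_1[of \<nu>] by simp
  have "1 \<le> \<sigma>2 \<nu> powr (1 - q2 / 2)" using \<sigma>2[OF \<nu>] q by (intro ge_one_powr_ge_zero) auto
  then have "1 * norm (c \<nu>) \<le> \<sigma>2 \<nu> powr (1 - q2 / 2) * norm (c \<nu>)" by (rule mult_right_mono) simp
  then have "p \<nu> * norm (c \<nu>) \<le> p \<nu> * (\<sigma>2 \<nu> powr (1 - q2 / 2) * norm (c \<nu>))"
    using p_ge_1[of \<nu>] by simp
  also have "\<dots> \<le> (W2 \<nu> + S2 \<nu>) / 2"
    unfolding W2_def S2_def by (rule weighted_young) (use \<sigma>2[OF \<nu>] in simp)
  finally show "p \<nu> * norm (c \<nu>) \<le> (1/2) * (W2 \<nu> + S2 \<nu>)" by simp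
qed

text \<open>On the sublevel set the summable family \<open>W2\<close> stays above a fixed positive
  number; \<open>max Y 1\<close> keeps the base of the power positive.\<close>

lemma finite_sublevel: "finite {s \<in> F_ev. \<sigma>2 s \<le> Y}"
proof -
  have "{s \<in> F_ev. \<sigma>2 s \<le> Y} \<subseteq> {s \<in> F_ev. (max Y 1) powr (- q2) \<le> W2 s}"
  proof safe
    fix s assume s: "s \<in> F_ev" "\<sigma>2 s \<le> Y"
    have "(max Y 1) powr (- q2) \<le> \<sigma>2 s powr (- q2)"
      using s \<sigma>2[OF s(1)] q by (intro powr_mono2') auto
    then show "(max Y 1) powr (- q2) \<le> W2 s" using W_ge(2)[of s] by simp
  qed
  moreover have "finite {s \<in> F_ev. (max Y 1) powr (- q2) \<le> W2 s}"
    by (rule finite_superlevel_set[OF W_summable(2)]) (auto simp: W_nonneg)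
  ultimately show ?thesis by (rule finite_subset)
qed

lemma err_le:
  assumes "finite (G_ev \<alpha> q1 q2 \<sigma>1 \<sigma>2 \<xi>)"
    and "\<And>\<nu> s. \<nu> \<in> F_ev \<Longrightarrow> s \<in> F_ev \<Longrightarrow> s \<le> \<nu> \<Longrightarrow>
      p \<nu> * norm (residual emb P (G_ev \<alpha> q1 q2 \<sigma>1 \<sigma>2 \<xi>) s (c \<nu>)) \<le> g \<nu>"
    and "(g has_sum T) F_ev"
  shows "err \<xi> \<le> T"
  unfolding err_def
  by (rule sparse_quad_error_le[OF bounded_linear_emb P P_bound assms(1) _ coeff_summable assms(2,3)])
     (auto simp: G_ev_def Let_def split: if_splits)

lemma err_empty: "G_ev \<alpha> q1 q2 \<sigma>1 \<sigma>2 \<xi> = {} \<Longrightarrow> err \<xi> = norm (emb (c (\<lambda>_. 0)))"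
  by (simp add: err_def sparse_quad_def)

lemma dims_empty: "G_ev \<alpha> q1 q2 \<sigma>1 \<sigma>2 \<xi> = {} \<Longrightarrow> dims \<xi> = 0"
  by (simp add: dims_def)

lemma zero_le_index: "(\<lambda>_. 0) \<le> (\<nu> :: nat \<Rightarrow> nat)"
  by (simp add: le_fun_def)

lemma le_two_power_mult: "x \<le> 2 ^ k * x" if "x \<ge> 0" for x :: real
proof -
  have "1 * x \<le> 2 ^ k * x" using that by (intro mult_right_mono) auto
  then show ?thesis by simp
qed

subsection \<open>The case \<open>\<alpha> \<le> 1 / q2 - 1 / 2\<close>\<close>

context
  assumes small: "\<alpha> \<le> 1 / q2 - 1 / 2"
begin

lemma G_small: "(k, s) \<in> G_ev \<alpha> q1 q2 \<sigma>1 \<sigma>2 \<xi> \<longleftrightarrow> s \<in> F_ev \<and> 2 powr (1 * real k) * \<sigma>2 s powr q2 \<le> \<xi>"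
  using small by (simp add: G_ev_def powr_realpow)

text \<open>By monotonicity the zero index has the smallest value of \<sigma>2, and it exceeds 1, so
  a \<xi> just above 1 admits nothing. It serves the small \<open>n\<close>, for which the general
  dimension estimate leaves no admissible threshold.\<close>

lemma G_small_empty: "\<exists>\<xi>>1. G_ev \<alpha> q1 q2 \<sigma>1 \<sigma>2 \<xi> = {}"
proof -
  let ?x = "\<sigma>2 (\<lambda>_. 0) powr q2"
  define \<xi> where "\<xi> = (1 + ?x) / 2"
  have x: "?x > 1" using \<sigma>2[OF zero_in_F_ev] q by (simp add: gr_one_powr)
  then have \<xi>: "\<xi> > 1" "\<xi> < ?x" by (auto simp: \<xi>_def)
  have "(k, s) \<notin> G_ev \<alpha> q1 q2 \<sigma>1 \<sigma>2 \<xi>" for k s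
  proof
    assume "(k, s) \<in> G_ev \<alpha> q1 q2 \<sigma>1 \<sigma>2 \<xi>"
    then have s: "s \<in> F_ev" "2 ^ k * \<sigma>2 s powr q2 \<le> \<xi>" by (simp_all add: G_small powr_realpow)
    have "?x \<le> \<sigma>2 s powr q2"
      using \<sigma>2[OF zero_in_F_ev] q mono2[OF zero_in_F_ev s(1) zero_le_index] by (intro powr_mono2) auto
    also have "\<dots> \<le> 2 ^ k * \<sigma>2 s powr q2" by (rule le_two_power_mult) simp
    finally show False using s(2) \<xi> by simp
  qed
  then show ?thesis using \<xi>(1) by auto
qed

text \<open>With \<gamma> = 1 the slice at \<open>s\<close> costs at most
  \<open>2 * \<xi> * \<sigma>2 s powr (- q2)\<close>, which the summable \<open>W2\<close> dominates
  up to the factor \<open>2 * \<xi>\<close>.\<close>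

lemma G_small_dims:
  assumes "\<xi> > 1"
  shows "finite (G_ev \<alpha> q1 q2 \<sigma>1 \<sigma>2 \<xi>)" and "dims \<xi> \<le> 2 * (\<xi> * N2)"
proof -
  have "{s \<in> F_ev. \<sigma>2 s powr q2 \<le> \<xi>} \<subseteq> {s \<in> F_ev. \<sigma>2 s \<le> \<xi> powr (1 / q2)}"
  proof safe
    fix s assume s: "s \<in> F_ev" "\<sigma>2 s powr q2 \<le> \<xi>"
    then have "(\<sigma>2 s powr q2) powr (1 / q2) \<le> \<xi> powr (1 / q2)"
      using q by (intro powr_mono2) auto
    then show "\<sigma>2 s \<le> \<xi> powr (1 / q2)" using \<sigma>2[OF s(1)] q by (simp add: powr_powr)
  qed
  then have fin: "finite {s \<in> F_ev. \<sigma>2 s powr q2 \<le> \<xi>}"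
    by (rule finite_subset[OF _ finite_sublevel])
  have "(\<Sum>s | s \<in> F_ev \<and> \<sigma>2 s powr q2 \<le> \<xi>. (\<xi> / \<sigma>2 s powr q2) powr (1 / 1))
      \<le> (\<Sum>s | s \<in> F_ev \<and> \<sigma>2 s powr q2 \<le> \<xi>. \<xi> * W2 s)"
  proof (rule sum_mono)
    fix s assume "s \<in> {s. s \<in> F_ev \<and> \<sigma>2 s powr q2 \<le> \<xi>}"
    have "(\<xi> / \<sigma>2 s powr q2) powr (1 / 1) = \<xi> * \<sigma>2 s powr (- q2)"
      using assms by (simp add: powr_minus divide_inverse)
    also have "\<dots> \<le> \<xi> * W2 s" using W_ge(2)[of s] assms by simp
    finally show "(\<xi> / \<sigma>2 s powr q2) powr (1 / 1) \<le> \<xi> * W2 s" .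
  qed
  also have "\<dots> = \<xi> * (\<Sum>s | s \<in> F_ev \<and> \<sigma>2 s powr q2 \<le> \<xi>. W2 s)"
    by (simp add: sum_distrib_left)
  also have "\<dots> \<le> \<xi> * N2"
    unfolding N2_def using assms fin W_nonneg
    by (intro mult_left_mono finite_sum_le_infsum W_summable) auto
  finally have le: "(\<Sum>s | s \<in> F_ev \<and> \<sigma>2 s powr q2 \<le> \<xi>. (\<xi> / \<sigma>2 s powr q2) powr (1 / 1)) \<le> \<xi> * N2" .
  have pos: "0 < \<sigma>2 s powr q2" if "s \<in> F_ev" for s using \<sigma>2[OF that] by simp
  show "finite (G_ev \<alpha> q1 q2 \<sigma>1 \<sigma>2 \<xi>)"
    by (rule dyadic_index_set(1)[OF G_small _ _ pos fin le]) (use assms in auto)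
  show "dims \<xi> \<le> 2 * (\<xi> * N2)"
    unfolding dims_def by (rule dyadic_index_set(2)[OF G_small _ _ pos fin le]) (use assms in auto)
qed

text \<open>The spatial error contributes the power \<open>q2 * \<alpha>\<close> of \<sigma>2, and
  the case hypothesis says exactly that this exponent is at most \<open>1 - q2 / 2\<close>.\<close>

lemma G_small_err:
  assumes "\<xi> > 1"
  shows "err \<xi> \<le> \<xi> powr (- \<alpha>) * T2"
proof (rule err_le[OF G_small_dims(1)[OF assms]])
  show "((\<lambda>\<nu>. \<xi> powr (- \<alpha>) * (C3 * ((W2 \<nu> + S2 \<nu>) / 2))) has_sum \<xi> powr (- \<alpha>) * T2) F_ev"
    by (rule has_sum_cmult_right[OF T2_has_sum])
  fix \<nu> s assume \<nu>: "\<nu> \<in> F_ev" and s: "s \<in> F_ev" "s \<le> \<nu>"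
  have pos: "\<sigma>2 s > 1" "\<sigma>2 \<nu> > 1" "\<sigma>2 s \<le> \<sigma>2 \<nu>" using \<sigma>2 mono2 \<nu> s by auto
  have "norm (residual emb P (G_ev \<alpha> q1 q2 \<sigma>1 \<sigma>2 \<xi>) s (c \<nu>))
      \<le> C3 * ((\<sigma>2 s powr q2 / \<xi>) powr (\<alpha> / 1) * norm (c \<nu>))"
    unfolding C3_def
    by (rule residual_bound[where emb=emb and P=P and w="c \<nu>"])
       (use G_small s pos assms \<alpha> C0 C2 emb_bound P_approx in auto)
  also have "(\<sigma>2 s powr q2 / \<xi>) powr (\<alpha> / 1) = \<xi> powr (- \<alpha>) * \<sigma>2 s powr (q2 * \<alpha>)"
    using assms pos by (simp add: powr_divide powr_powr powr_minus field_simps)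
  also have "\<sigma>2 s powr (q2 * \<alpha>) \<le> \<sigma>2 \<nu> powr (q2 * \<alpha>)"
    using pos q \<alpha> by (intro powr_mono2) auto
  also have "\<sigma>2 \<nu> powr (q2 * \<alpha>) \<le> \<sigma>2 \<nu> powr (1 - q2 / 2)"
  proof -
    have "q2 * \<alpha> \<le> q2 * (1 / q2 - 1 / 2)" using small q by (intro mult_left_mono) auto
    also have "\<dots> = 1 - q2 / 2" using q by (simp add: right_diff_distrib)
    finally show ?thesis using pos by (intro powr_mono) auto
  qed
  finally have "norm (residual emb P (G_ev \<alpha> q1 q2 \<sigma>1 \<sigma>2 \<xi>) s (c \<nu>))
      \<le> C3 * ((\<xi> powr (- \<alpha>) * \<sigma>2 \<nu> powr (1 - q2 / 2)) * norm (c \<nu>))"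
    using C3_pos by (simp add: mult_left_mono mult_right_mono)
  then have "p \<nu> * norm (residual emb P (G_ev \<alpha> q1 q2 \<sigma>1 \<sigma>2 \<xi>) s (c \<nu>))
      \<le> p \<nu> * (C3 * ((\<xi> powr (- \<alpha>) * \<sigma>2 \<nu> powr (1 - q2 / 2)) * norm (c \<nu>)))"
    using p_ge_1[of \<nu>] by (intro mult_left_mono) auto
  also have "\<dots> = \<xi> powr (- \<alpha>) * (C3 * (p \<nu> * (\<sigma>2 \<nu> powr (1 - q2 / 2) * norm (c \<nu>))))"
    by (simp add: mult_ac)
  also have "\<dots> \<le> \<xi> powr (- \<alpha>) * (C3 * ((W2 \<nu> + S2 \<nu>) / 2))"
    unfolding W2_def S2_def using pos C3_pos by (intro mult_left_mono weighted_young) auto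
  finally show "p \<nu> * norm (residual emb P (G_ev \<alpha> q1 q2 \<sigma>1 \<sigma>2 \<xi>) s (c \<nu>))
      \<le> \<xi> powr (- \<alpha>) * (C3 * ((W2 \<nu> + S2 \<nu>) / 2))" .
qed

text \<open>The dimension grows at most linearly in \<xi>, which allows
  \<open>\<xi> = n / B\<close>. For \<open>n \<le> B\<close> the index set is empty, the error is
  the norm of the whole integral, and the term \<open>E0 * B powr \<alpha>\<close> in
  \<open>C\<close> pays for it.\<close>

lemma rate_small:
  "\<exists>C>0. \<forall>n\<ge>1. \<exists>\<xi>>1. finite (G_ev \<alpha> q1 q2 \<sigma>1 \<sigma>2 \<xi>) \<and> dims \<xi> \<le> real n \<and> err \<xi> \<le> C * rate \<alpha> q1 q2 n"
proof -
  obtain \<xi>0 where \<xi>0: "\<xi>0 > 1" "G_ev \<alpha> q1 q2 \<sigma>1 \<sigma>2 \<xi>0 = {}" using G_small_empty by blast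
  define E0 where "E0 = norm (emb (c (\<lambda>_. 0)))"
  define B where "B = 2 * N2 + 1"
  define C where "C = T2 * B powr \<alpha> + E0 * B powr \<alpha> + 1"
  have B: "B \<ge> 1" "2 * N2 \<le> B" using N_nonneg by (auto simp: B_def)
  have C: "C > 0" "T2 * B powr \<alpha> \<le> C" "E0 * B powr \<alpha> \<le> C"
    using T_nonneg by (auto simp: C_def E0_def intro!: add_nonneg_pos add_nonneg_nonneg)
  have "\<exists>\<xi>>1. finite (G_ev \<alpha> q1 q2 \<sigma>1 \<sigma>2 \<xi>) \<and> dims \<xi> \<le> real n \<and> err \<xi> \<le> C * rate \<alpha> q1 q2 n"
    if n: "n \<ge> 1" for n :: nat
  proof (cases "real n / B > 1")
    case True
    let ?\<xi> = "real n / B"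
    have "dims ?\<xi> \<le> ?\<xi> * (2 * N2)" using G_small_dims(2)[OF True] by (simp add: mult_ac)
    also have "\<dots> \<le> ?\<xi> * B" using True B by (intro mult_left_mono) auto
    also have "\<dots> = real n" using B by simp
    finally have 1: "dims ?\<xi> \<le> real n" .
    have "err ?\<xi> \<le> ?\<xi> powr (- \<alpha>) * T2" by (rule G_small_err[OF True])
    also have "\<dots> = (T2 * B powr \<alpha>) * real n powr (- \<alpha>)"
      using B n by (simp add: powr_divide powr_minus field_simps)
    also have "\<dots> \<le> C * real n powr (- \<alpha>)" by (rule mult_right_mono[OF C(2)]) simp
    finally have "err ?\<xi> \<le> C * rate \<alpha> q1 q2 n" using small by (simp add: rate_def)
    then show ?thesis using 1 True G_small_dims(1)[OF True] by blast
  next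
    case False
    then have "real n \<le> B" using B by (simp add: field_simps)
    then have "real n powr \<alpha> \<le> B powr \<alpha>" using \<alpha> by (intro powr_mono2) auto
    then have "1 \<le> B powr \<alpha> * real n powr (- \<alpha>)" using n by (simp add: powr_minus field_simps)
    then have "E0 * 1 \<le> E0 * (B powr \<alpha> * real n powr (- \<alpha>))"
      by (rule mult_left_mono) (simp add: E0_def)
    also have "\<dots> \<le> C * real n powr (- \<alpha>)"
      unfolding mult.assoc[symmetric] by (rule mult_right_mono[OF C(3)]) simp
    finally have "err \<xi>0 \<le> C * rate \<alpha> q1 q2 n"
      using small err_empty[OF \<xi>0(2)] by (simp add: rate_def E0_def)
    then show ?thesis using \<xi>0 dims_empty[OF \<xi>0(2)] by (intro exI[of _ \<xi>0]) auto
  qed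
  then show ?thesis using C(1) by blast
qed

end

subsection \<open>The case \<open>\<alpha> > 1 / q2 - 1 / 2\<close>\<close>

definition \<tau> where "\<tau> = 2 * \<alpha> / (2 - q2)"
definition h where "h = 1 / q1 - 1 / 2"
text \<open>The exponent of \<xi> in the second threshold, called \<open>\<theta>'\<close> in
  \<open>G_ev\<close>; the \<eta> there is \<open>1 / h\<close>.\<close>

definition \<zeta> where "\<zeta> = 2 / (2 - q2) * h"
definition L where "L \<xi> = \<xi> * ln \<xi> powr (1 / h)"
text \<open>An interpolation exponent: a slice costs \<open>\<sigma>2 s powr (- 1 / \<tau>)\<close>,
  which is the \<rho>-th power of the summable \<open>\<sigma>2 s powr (- q2)\<close>.\<close>

definition \<rho> where "\<rho> = (1 / q2 - 1 / 2) / \<alpha>"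

context
  assumes large: "\<not> \<alpha> \<le> 1 / q2 - 1 / 2"
begin

text \<open>The identities show how the parameters fit together:
  \<open>\<alpha> / \<tau> = 1 - q2 / 2\<close> puts the spatial error within reach of Young's
  inequality, while \<open>\<zeta> * (1 - q2 / 2) = h\<close> and \<open>q1 * h = 1 - q1 / 2\<close>
  bring spatial error and cut-off error both down to \<open>\<xi> powr (- h)\<close>. The bound
  \<open>\<rho> < 1\<close> is the case hypothesis.\<close>

lemma exponents:
  "\<tau> > 0" "h > 0" "\<zeta> > 0" "0 \<le> \<rho>" "\<rho> < 1"
  "\<alpha> / \<tau> = 1 - q2 / 2" "\<zeta> * (1 - q2 / 2) = h" "q2 * \<rho> = 1 / \<tau>" "\<zeta> * (1 / \<tau>) = h / \<alpha>"
  "q1 * h = 1 - q1 / 2"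
  using q \<alpha> large
  by (auto simp: \<tau>_def h_def \<zeta>_def \<rho>_def field_simps)

lemma G_large: "(k, s) \<in> G_ev \<alpha> q1 q2 \<sigma>1 \<sigma>2 \<xi> \<longleftrightarrow>
    s \<in> {s \<in> F_ev. \<sigma>1 s powr q1 \<le> L \<xi>} \<and> 2 powr (\<tau> * real k) * \<sigma>2 s \<le> \<xi> powr \<zeta>"
  using large by (simp add: G_ev_def Let_def \<tau>_def \<zeta>_def h_def L_def)

text \<open>If the second threshold lies below the value of \<sigma>2 at the zero index,
  monotonicity excludes every index.\<close>

lemma G_large_empty: "\<exists>\<xi>>1. G_ev \<alpha> q1 q2 \<sigma>1 \<sigma>2 \<xi> = {}"
proof -
  let ?x = "\<sigma>2 (\<lambda>_. 0)"
  define \<xi> where "\<xi> = ((1 + ?x) / 2) powr (1 / \<zeta>)"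
  have x: "?x > 1" by (rule \<sigma>2[OF zero_in_F_ev])
  then have \<xi>: "\<xi> > 1" "\<xi> powr \<zeta> < ?x"
    using exponents(3) by (auto simp: \<xi>_def gr_one_powr powr_powr)
  have "(k, s) \<notin> G_ev \<alpha> q1 q2 \<sigma>1 \<sigma>2 \<xi>" for k s
  proof
    assume "(k, s) \<in> G_ev \<alpha> q1 q2 \<sigma>1 \<sigma>2 \<xi>"
    then have s: "s \<in> F_ev" "2 powr (\<tau> * real k) * \<sigma>2 s \<le> \<xi> powr \<zeta>" by (simp_all add: G_large)
    have "k \<in> {k. 2 powr (\<tau> * real k) * \<sigma>2 s \<le> \<xi> powr \<zeta>}" using s by simp
    moreover have "\<xi> powr \<zeta> < \<sigma>2 s" using \<xi>(2) mono2[OF zero_in_F_ev s(1) zero_le_index] by simp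
    ultimately show False
      using dyadic_slice_empty[OF exponents(1), of "\<sigma>2 s" "\<xi> powr \<zeta>"] \<sigma>2[OF s(1)] by simp
  qed
  then show ?thesis using \<xi>(1) by auto
qed

lemma L_pos: "\<xi> > 1 \<Longrightarrow> L \<xi> > 0"
  by (simp add: L_def)

text \<open>Since \<open>\<rho> < 1\<close>, the sum of the \<rho>-th powers of
  \<open>\<sigma>2 s powr (- q2)\<close> is not controlled by \<open>N2\<close> alone. The cut gives
  \<open>1 \<le> L \<xi> * \<sigma>1 s powr (- q1)\<close>, so \<open>powr_le_split\<close> divides
  each summand into a multiple of \<open>W2 s\<close> and one of \<open>W1 s\<close>. The price is
  the factor \<open>L \<xi> powr (1 - \<rho>)\<close>.\<close>

lemma G_large_dims:
  assumes "\<xi> > 1"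
  shows "finite (G_ev \<alpha> q1 q2 \<sigma>1 \<sigma>2 \<xi>)"
    and "dims \<xi> \<le> 2 * (\<xi> powr (h / \<alpha>) * (L \<xi> powr (1 - \<rho>) * (N1 + N2)))"
proof -
  let ?A = "{s \<in> F_ev. \<sigma>1 s powr q1 \<le> L \<xi>}" and ?Y = "\<xi> powr \<zeta>"
  let ?S = "{s. s \<in> ?A \<and> \<sigma>2 s \<le> ?Y}"
  have fin: "finite ?S" by (rule finite_subset[OF _ finite_sublevel[of ?Y]]) auto
  have term_le: "(?Y / \<sigma>2 s) powr (1 / \<tau>) \<le> \<xi> powr (h / \<alpha>) * (L \<xi> powr (1 - \<rho>) * (W1 s + W2 s))"
    if s: "s \<in> ?S" for s
  proof -
    have s': "s \<in> F_ev" "\<sigma>1 s powr q1 \<le> L \<xi>" using s by auto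
    have eq: "(?Y / \<sigma>2 s) powr (1 / \<tau>) = \<xi> powr (h / \<alpha>) * (\<sigma>2 s powr (- q2)) powr \<rho>"
    proof -
      have "(?Y / \<sigma>2 s) powr (1 / \<tau>) = \<xi> powr (\<zeta> * (1 / \<tau>)) * \<sigma>2 s powr (- (1 / \<tau>))"
        using \<sigma>2[OF s'(1)] assms by (simp add: powr_divide powr_powr powr_minus field_simps)
      also have "\<dots> = \<xi> powr (h / \<alpha>) * \<sigma>2 s powr (- (q2 * \<rho>))"
        unfolding exponents(8,9) ..
      finally show ?thesis by (simp add: powr_powr)
    qed
    have "(\<sigma>2 s powr (- q2)) powr \<rho> \<le> L \<xi> powr (1 - \<rho>) * \<sigma>2 s powr (- q2) + L \<xi> powr (- \<rho>)"
      using exponents(4,5) \<sigma>2[OF s'(1)] L_pos[OF assms] by (intro powr_le_split) auto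
    also have "L \<xi> powr (1 - \<rho>) * \<sigma>2 s powr (- q2) \<le> L \<xi> powr (1 - \<rho>) * W2 s"
      by (intro mult_left_mono W_ge) simp
    also have "L \<xi> powr (- \<rho>) \<le> L \<xi> powr (1 - \<rho>) * W1 s"
    proof -
      have "1 = \<sigma>1 s powr q1 * \<sigma>1 s powr (- q1)" using \<sigma>1[OF s'(1)] by (simp add: powr_minus)
      also have "\<dots> \<le> L \<xi> * W1 s"
        using s'(2) W_ge(1)[of s] L_pos[OF assms] by (intro mult_mono) auto
      finally have "L \<xi> powr (- \<rho>) * 1 \<le> L \<xi> powr (- \<rho>) * (L \<xi> * W1 s)"
        by (rule mult_left_mono) simp
      then show ?thesis using L_pos[OF assms] powr_add[of "L \<xi>" "- \<rho>" 1] by (simp add: mult_ac)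
    qed
    finally have "(\<sigma>2 s powr (- q2)) powr \<rho> \<le> L \<xi> powr (1 - \<rho>) * (W1 s + W2 s)"
      by (simp add: algebra_simps)
    then show ?thesis unfolding eq by (rule mult_left_mono) simp
  qed
  have "(\<Sum>s\<in>?S. (?Y / \<sigma>2 s) powr (1 / \<tau>))
      \<le> (\<Sum>s\<in>?S. \<xi> powr (h / \<alpha>) * (L \<xi> powr (1 - \<rho>) * (W1 s + W2 s)))"
    by (rule sum_mono) (rule term_le)
  also have "\<dots> = \<xi> powr (h / \<alpha>) * (L \<xi> powr (1 - \<rho>) * (sum W1 ?S + sum W2 ?S))"
    by (simp only: sum_distrib_left[symmetric] sum.distrib)
  also have "\<dots> \<le> \<xi> powr (h / \<alpha>) * (L \<xi> powr (1 - \<rho>) * (N1 + N2))"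
    unfolding N1_def N2_def using fin W_nonneg
    by (intro mult_left_mono add_mono finite_sum_le_infsum W_summable) auto
  finally have le: "(\<Sum>s\<in>?S. (?Y / \<sigma>2 s) powr (1 / \<tau>))
    \<le> \<xi> powr (h / \<alpha>) * (L \<xi> powr (1 - \<rho>) * (N1 + N2))" .
  have pos: "0 < \<sigma>2 s" if "s \<in> ?A" for s using \<sigma>2[of s] that by simp
  have Y: "0 < ?Y" using assms by simp
  show "finite (G_ev \<alpha> q1 q2 \<sigma>1 \<sigma>2 \<xi>)"
    by (rule dyadic_index_set(1)[OF G_large exponents(1) Y pos fin le])
  show "dims \<xi> \<le> 2 * (\<xi> powr (h / \<alpha>) * (L \<xi> powr (1 - \<rho>) * (N1 + N2)))"
    unfolding dims_def by (rule dyadic_index_set(2)[OF G_large exponents(1) Y pos fin le])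
qed

text \<open>If \<open>s\<close> passes the cut in \<sigma>1, its slice gives the spatial error. If
  not, the whole coefficient is lost, but only its norm in X1 counts and \<sigma>1 is large. This
  second case gains a further factor \<open>1 / ln \<xi>\<close>, estimated by
  \<open>1 / ln 2\<close>; hence \<open>\<xi> \<ge> 2\<close>.\<close>

lemma G_large_err:
  assumes "\<xi> \<ge> 2"
  shows "err \<xi> \<le> \<xi> powr (- h) * (T2 + T1 / ln 2)"
proof (rule err_le)
  have \<xi>: "\<xi> > 1" using assms by simp
  show "finite (G_ev \<alpha> q1 q2 \<sigma>1 \<sigma>2 \<xi>)" by (rule G_large_dims(1)[OF \<xi>])
  let ?g1 = "\<lambda>\<nu>. (W1 \<nu> + S1 \<nu>) / 2" and ?g2 = "\<lambda>\<nu>. C3 * ((W2 \<nu> + S2 \<nu>) / 2)"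
  have e: "x / ln 2 = inverse (ln 2) * x" for x :: real by (rule divide_inverse_commute)
  show "((\<lambda>\<nu>. \<xi> powr (- h) * (?g2 \<nu> + ?g1 \<nu> / ln 2)) has_sum \<xi> powr (- h) * (T2 + T1 / ln 2)) F_ev"
    unfolding e by (intro has_sum_cmult_right has_sum_add T1_has_sum T2_has_sum)
  fix \<nu> s assume \<nu>: "\<nu> \<in> F_ev" and s: "s \<in> F_ev" "s \<le> \<nu>"
  let ?r = "norm (residual emb P (G_ev \<alpha> q1 q2 \<sigma>1 \<sigma>2 \<xi>) s (c \<nu>))"
  have pos: "\<sigma>1 s > 1" "\<sigma>1 \<nu> > 1" "\<sigma>1 s \<le> \<sigma>1 \<nu>" "\<sigma>2 s > 1" "\<sigma>2 \<nu> > 1" "\<sigma>2 s \<le> \<sigma>2 \<nu>"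
    using \<sigma>1 mono1 \<sigma>2 mono2 \<nu> s by auto
  have ln2: "ln 2 > (0::real)" by simp
  have g: "?g1 \<nu> \<ge> 0" "?g2 \<nu> \<ge> 0"
    using C3_pos W_nonneg[of \<nu>] by (auto simp: S1_def S2_def)
  show "p \<nu> * ?r \<le> \<xi> powr (- h) * (?g2 \<nu> + ?g1 \<nu> / ln 2)"
  proof (cases "\<sigma>1 s powr q1 \<le> L \<xi>")
    case True
    have "?r \<le> C3 * ((\<sigma>2 s / \<xi> powr \<zeta>) powr (\<alpha> / \<tau>) * norm (c \<nu>))"
      unfolding C3_def
      by (rule residual_bound[where emb=emb and P=P and w="c \<nu>"])
         (use G_large s pos \<xi> True exponents(1) \<alpha> C0 C2 emb_bound P_approx in auto)
    also have "(\<sigma>2 s / \<xi> powr \<zeta>) powr (\<alpha> / \<tau>) = \<xi> powr (- h) * \<sigma>2 s powr (1 - q2 / 2)"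
      unfolding exponents(6) using \<xi> pos exponents(7)
      by (simp add: powr_divide powr_powr powr_minus_divide)
    also have "\<sigma>2 s powr (1 - q2 / 2) \<le> \<sigma>2 \<nu> powr (1 - q2 / 2)"
      using pos q by (intro powr_mono2) auto
    finally have "?r \<le> C3 * ((\<xi> powr (- h) * \<sigma>2 \<nu> powr (1 - q2 / 2)) * norm (c \<nu>))"
      using C3_pos by (simp add: mult_left_mono mult_right_mono)
    then have "p \<nu> * ?r \<le> p \<nu> * (C3 * ((\<xi> powr (- h) * \<sigma>2 \<nu> powr (1 - q2 / 2)) * norm (c \<nu>)))"
      using p_ge_1[of \<nu>] by (intro mult_left_mono) auto
    also have "\<dots> = \<xi> powr (- h) * (C3 * (p \<nu> * (\<sigma>2 \<nu> powr (1 - q2 / 2) * norm (c \<nu>))))"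
      by (simp add: mult_ac)
    also have "\<dots> \<le> \<xi> powr (- h) * ?g2 \<nu>"
      unfolding W2_def S2_def using pos C3_pos by (intro mult_left_mono weighted_young) auto
    also have "\<dots> \<le> \<xi> powr (- h) * (?g2 \<nu> + ?g1 \<nu> / ln 2)"
      using g ln2 by (intro mult_left_mono) auto
    finally show ?thesis .
  next
    case False
    then have "{k. (k, s) \<in> G_ev \<alpha> q1 q2 \<sigma>1 \<sigma>2 \<xi>} = {}" by (simp add: G_large)
    then have r: "?r = norm (emb (c \<nu>))" by (simp add: residual_def)
    have "L \<xi> \<le> \<sigma>1 \<nu> powr q1"
      using False pos q powr_mono2[of q1 "\<sigma>1 s" "\<sigma>1 \<nu>"] by simp
    then have "L \<xi> powr h \<le> (\<sigma>1 \<nu> powr q1) powr h"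
      using L_pos[OF \<xi>] exponents(2) by (intro powr_mono2) auto
    also have "\<dots> = \<sigma>1 \<nu> powr (1 - q1 / 2)" by (simp add: powr_powr exponents(10))
    \<comment> \<open>The power \<open>1 / h\<close> of the logarithm in the cut leaves exactly one
      factor \<open>ln \<xi>\<close> here.\<close>
    also have "L \<xi> powr h = \<xi> powr h * ln \<xi>"
      using \<xi> exponents(2) by (simp add: L_def powr_mult powr_powr)
    finally have "\<xi> powr h * ln \<xi> \<le> \<sigma>1 \<nu> powr (1 - q1 / 2)" .
    moreover have "\<xi> powr h * ln 2 \<le> \<xi> powr h * ln \<xi>"
      using assms by (intro mult_left_mono) auto
    ultimately have "\<xi> powr h * ln 2 \<le> \<sigma>1 \<nu> powr (1 - q1 / 2)" by (rule order_trans[rotated])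
    then have "1 \<le> \<xi> powr (- h) * \<sigma>1 \<nu> powr (1 - q1 / 2) / ln 2"
      using \<xi> ln2 by (simp add: powr_minus field_simps)
    then have "1 * (p \<nu> * norm (emb (c \<nu>)))
        \<le> (\<xi> powr (- h) * \<sigma>1 \<nu> powr (1 - q1 / 2) / ln 2) * (p \<nu> * norm (emb (c \<nu>)))"
      using p_ge_1[of \<nu>] by (intro mult_right_mono) auto
    also have "\<dots> = \<xi> powr (- h) * ((p \<nu> * (\<sigma>1 \<nu> powr (1 - q1 / 2) * norm (emb (c \<nu>)))) / ln 2)"
      by simp
    also have "\<dots> \<le> \<xi> powr (- h) * (?g1 \<nu> / ln 2)"
      unfolding W1_def S1_def using pos ln2 by (intro mult_left_mono divide_right_mono weighted_young) auto
    also have "\<dots> \<le> \<xi> powr (- h) * (?g2 \<nu> + ?g1 \<nu> / ln 2)"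
      using g by (intro mult_left_mono) auto
    finally show ?thesis unfolding r by simp
  qed
qed

text \<open>Collecting \<open>\<xi> powr (h / \<alpha>)\<close> and
  \<open>L \<xi> powr (1 - \<rho>)\<close> gives the exponents \<open>E\<close> of \<xi> and
  \<omega> of its logarithm. \<open>threshold_rate\<close> turns them into \<open>h / E\<close> and
  \<open>\<omega> * h / E\<close>, which are \<beta> and \<kappa>.\<close>

lemma rate_large:
  "\<exists>C>0. \<forall>n\<ge>1. \<exists>\<xi>>1. finite (G_ev \<alpha> q1 q2 \<sigma>1 \<sigma>2 \<xi>) \<and> dims \<xi> \<le> real n \<and> err \<xi> \<le> C * rate \<alpha> q1 q2 n"
proof -
  obtain \<xi>0 where \<xi>0: "\<xi>0 > 1" "G_ev \<alpha> q1 q2 \<sigma>1 \<sigma>2 \<xi>0 = {}" using G_large_empty by blast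
  define E where "E = h / \<alpha> + (1 - \<rho>)"
  define \<omega> where "\<omega> = (1 / h) * (1 - \<rho>)"
  define B where "B = 2 * (N1 + N2) + 1"
  \<comment> \<open>\<open>E \<ge> 1\<close> means \<open>\<rho> \<le> h / \<alpha>\<close>, which
    is \<open>q1 \<le> q2\<close> in disguise.\<close>
  have E: "E \<ge> 1"
  proof -
    have "1 / q1 \<ge> 1 / q2" using q by (simp add: field_simps)
    then have "\<rho> \<le> h / \<alpha>" unfolding \<rho>_def h_def using \<alpha> by (intro divide_right_mono) auto
    then show ?thesis by (simp add: E_def)
  qed
  have "\<exists>C>0. \<forall>n\<ge>1. \<exists>\<xi>>1. dims \<xi> \<le> real n \<and>
    err \<xi> \<le> C * (real n powr (- (h / E)) * ln (real (max n 2)) powr (\<omega> * h / E))"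
  proof (rule threshold_rate[where B=B and T="T2 + T1 / ln 2" and ?E0.0="norm (emb (c (\<lambda>_. 0)))" and ?\<xi>0.0=\<xi>0])
    fix \<xi> :: real assume \<xi>: "\<xi> \<ge> 2"
    have "dims \<xi> \<le> 2 * (\<xi> powr (h / \<alpha>) * (L \<xi> powr (1 - \<rho>) * (N1 + N2)))"
      using \<xi> by (intro G_large_dims(2)) auto
    also have "\<dots> = (2 * (N1 + N2)) * (\<xi> powr E * ln \<xi> powr \<omega>)"
      using \<xi> by (simp add: L_def E_def \<omega>_def powr_mult powr_powr powr_add)
    also have "\<dots> \<le> B * (\<xi> powr E * ln \<xi> powr \<omega>)"
      by (rule mult_right_mono) (auto simp: B_def)
    finally show "dims \<xi> \<le> B * (\<xi> powr E * ln \<xi> powr \<omega>)" .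
    show "err \<xi> \<le> (T2 + T1 / ln 2) * \<xi> powr (- h)"
      using G_large_err[OF \<xi>] by (simp add: mult.commute)
  qed (use exponents E N_nonneg T_nonneg \<xi>0 in \<open>auto simp: B_def \<omega>_def dims_empty err_empty\<close>)
  moreover have "h / E = beta_exp \<alpha> q1 q2" "\<omega> * h / E = kappa_exp \<alpha> q1 q2"
  proof -
    have E': "E = (\<alpha> + 1 / q1 - 1 / q2) / \<alpha>"
      using \<alpha> by (simp add: E_def h_def \<rho>_def field_simps)
    show "h / E = beta_exp \<alpha> q1 q2"
      unfolding E' beta_exp_def h_def using \<alpha> by simp
    have "\<omega> * h = 1 - \<rho>" using exponents(2) by (simp add: \<omega>_def)
    also have "\<dots> = (\<alpha> + 1 / 2 - 1 / q2) / \<alpha>" using \<alpha> by (simp add: \<rho>_def field_simps)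
    finally show "\<omega> * h / E = kappa_exp \<alpha> q1 q2"
      unfolding E' kappa_exp_def using \<alpha> by simp
  qed
  ultimately have "\<exists>C>0. \<forall>n\<ge>1. \<exists>\<xi>>1. dims \<xi> \<le> real n \<and> err \<xi> \<le> C * rate \<alpha> q1 q2 n"
    using large by (simp add: rate_def)
  then show ?thesis using G_large_dims(1) by meson
qed

lemma kappa_bounds: "0 < kappa_exp \<alpha> q1 q2" "kappa_exp \<alpha> q1 q2 < 1"
proof -
  have "\<alpha> + 1 / 2 - 1 / q2 > 0" "\<alpha> + 1 / 2 - 1 / q2 < \<alpha> + 1 / q1 - 1 / q2"
    using large exponents(2) by (auto simp: h_def)
  then show "0 < kappa_exp \<alpha> q1 q2" "kappa_exp \<alpha> q1 q2 < 1" by (auto simp: kappa_exp_def)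
qed

end

lemma quadrature_rate:
  "\<exists>C>0. \<forall>n\<ge>1. \<exists>\<xi>>1. finite (G_ev \<alpha> q1 q2 \<sigma>1 \<sigma>2 \<xi>) \<and>
    fun_has_dim_le D (approx_space a b V (G_ev \<alpha> q1 q2 \<sigma>1 \<sigma>2 \<xi>)) n \<and> err \<xi> \<le> C * rate \<alpha> q1 q2 n"
proof -
  have "\<exists>C>0. \<forall>n\<ge>1. \<exists>\<xi>>1. finite (G_ev \<alpha> q1 q2 \<sigma>1 \<sigma>2 \<xi>) \<and> dims \<xi> \<le> real n \<and> err \<xi> \<le> C * rate \<alpha> q1 q2 n"
    using rate_small rate_large by blast
  moreover have "fun_has_dim_le D (approx_space a b V (G_ev \<alpha> q1 q2 \<sigma>1 \<sigma>2 \<xi>)) n"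
    if "finite (G_ev \<alpha> q1 q2 \<sigma>1 \<sigma>2 \<xi>)" "dims \<xi> \<le> real n" for \<xi> n
    using that(2) unfolding dims_def of_nat_le_iff by (rule approx_space_dim_le[OF V that(1)])
  ultimately show ?thesis by meson
qed

end


theorem theorem2p11:
  fixes a b :: "nat \<Rightarrow> real"
    and lamJ :: "real \<Rightarrow> real \<Rightarrow> real"
    and lam\<^sub>0 \<theta>\<^sub>0 \<epsilon> C\<^sub>\<epsilon> \<theta> lam :: real
    and emb :: "'x2::{real_inner, complete_space} \<Rightarrow> 'x1::{real_inner, complete_space}"
    and v :: "(nat \<Rightarrow> real) \<Rightarrow> 'x2"
    and V :: "nat \<Rightarrow> 'x1 set" and P :: "nat \<Rightarrow> 'x1 \<Rightarrow> 'x1"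
    and \<alpha> C\<^sub>0 C\<^sub>1 C\<^sub>2 q\<^sub>1 q\<^sub>2 M\<^sub>1 M\<^sub>2 :: real
    and \<sigma>\<^sub>1 \<sigma>\<^sub>2 :: "(nat \<Rightarrow> nat) \<Rightarrow> real"
  \<comment> \<open>the Jacobi measure\<close>
  assumes "bounded (range a)" and "bounded (range b)"
    and "(INF j. a j) > -1" and "(INF j. b j) > -1"
    and "\<forall>j. a j = b j"
  \<comment> \<open>the weight parameters\<close>
    and "\<forall>j. lamJ (a j) (b j) > 0"
    and "\<forall>j k. \<forall>y\<in>{-1..1}. \<bar>jacobi_J (a j) (b j) k y\<bar>
           \<le> (1 + lamJ (a j) (b j) * real k) powr (Max {a j, b j, - 1 / 2} + 1 / 2)"
    and "bdd_above (range (\<lambda>j. lamJ (a j) (b j)))"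
    and "lam\<^sub>0 = (SUP j. lamJ (a j) (b j))"
    and "\<theta>\<^sub>0 = Max {SUP j. a j, SUP j. b j, - 1 / 2} + 1 / 2"
    and "\<epsilon> > 0" and "C\<^sub>\<epsilon> > 0"
    and "\<forall>k::nat\<ge>1. 2 * (1 + lam\<^sub>0 * real k) powr \<theta>\<^sub>0 * ln (2 * real k + 3)
           \<le> (C\<^sub>\<epsilon> * real k + 1) powr (\<theta>\<^sub>0 + \<epsilon>)"
    and "\<theta> = \<theta>\<^sub>0 + 1 + \<epsilon>" and "lam = C\<^sub>\<epsilon> + 1"
  \<comment> \<open>the function\<close>
    and "in_L2 (jacobi_prod a b) v"
    and "even_jacobi_expansion a b v"
  \<comment> \<open>(1)\<close>
    and "linear emb" and "inj emb"
    and "C\<^sub>0 > 0" and "\<forall>w. norm (emb w) \<le> C\<^sub>0 * norm w"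
  \<comment> \<open>(2)\<close>
    and "\<forall>m. subspace (V m)" and "\<forall>m. has_dim_le (V m) m" and "V 0 = {0}"
    and "\<forall>m. linear (P m)" and "\<forall>m w. P m w \<in> V m" and "\<forall>w. P 0 w = 0"
    and "\<alpha> > 0" and "C\<^sub>1 > 0" and "C\<^sub>2 > 0"
    and "\<forall>m w. norm (P m (emb w)) \<le> C\<^sub>1 * norm (emb w)"
    and "\<forall>m\<ge>1. \<forall>w. norm (emb w - P m (emb w)) \<le> C\<^sub>2 * real m powr (- \<alpha>) * norm w"
  \<comment> \<open>(3)\<close>
    and "0 < q\<^sub>1" and "q\<^sub>1 \<le> q\<^sub>2" and "q\<^sub>1 < 2" and "q\<^sub>2 < 2"
    and "\<forall>\<nu>\<in>F_ev. \<sigma>\<^sub>1 \<nu> > 1" and "\<forall>\<nu>\<in>F_ev. \<sigma>\<^sub>2 \<nu> > 1"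
    and "\<forall>\<nu>\<in>F_ev. \<forall>\<nu>'\<in>F_ev. \<nu>' \<le> \<nu> \<longrightarrow> \<sigma>\<^sub>1 \<nu>' \<le> \<sigma>\<^sub>1 \<nu> \<and> \<sigma>\<^sub>2 \<nu>' \<le> \<sigma>\<^sub>2 \<nu>"
    and "(\<lambda>\<nu>. (\<sigma>\<^sub>1 \<nu> * norm (emb (jacobi_coeff a b v \<nu>)))\<^sup>2) summable_on F_ev"
    and "(\<Sum>\<^sub>\<infinity>\<nu>\<in>F_ev. (\<sigma>\<^sub>1 \<nu> * norm (emb (jacobi_coeff a b v \<nu>)))\<^sup>2) \<le> M\<^sub>1"
    and "(\<lambda>\<nu>. (\<sigma>\<^sub>2 \<nu> * norm (jacobi_coeff a b v \<nu>))\<^sup>2) summable_on F_ev"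
    and "(\<Sum>\<^sub>\<infinity>\<nu>\<in>F_ev. (\<sigma>\<^sub>2 \<nu> * norm (jacobi_coeff a b v \<nu>))\<^sup>2) \<le> M\<^sub>2"
    and "(\<lambda>\<nu>. (p_weight \<theta> lam \<nu> powr (2 / q\<^sub>1) / \<sigma>\<^sub>1 \<nu>) powr q\<^sub>1) summable_on F_ev"
    and "(\<lambda>\<nu>. (p_weight \<theta> lam \<nu> powr (2 / q\<^sub>2) / \<sigma>\<^sub>2 \<nu>) powr q\<^sub>2) summable_on F_ev"
  shows "(\<alpha> > 1 / q\<^sub>2 - 1 / 2 \<longrightarrow> 0 < kappa_exp \<alpha> q\<^sub>1 q\<^sub>2 \<and> kappa_exp \<alpha> q\<^sub>1 q\<^sub>2 < 1) \<and>
    (\<exists>C>0.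
      (\<forall>n\<ge>1. \<exists>\<xi>>1. let G = G_ev \<alpha> q\<^sub>1 q\<^sub>2 \<sigma>\<^sub>1 \<sigma>\<^sub>2 \<xi> in
         finite G \<and> fun_has_dim_le (space (jacobi_prod a b)) (approx_space a b V G) n \<and>
         norm (emb (bint (jacobi_prod a b) v) - sparse_quad a b emb P G (cont_rep a b v))
           \<le> C * rate \<alpha> q\<^sub>1 q\<^sub>2 n) \<and>
      (\<forall>\<phi> :: 'x1 \<Rightarrow> real. bounded_linear \<phi> \<longrightarrow>
        (\<forall>n\<ge>1. \<exists>\<xi>>1. let G = G_ev \<alpha> q\<^sub>1 q\<^sub>2 \<sigma>\<^sub>1 \<sigma>\<^sub>2 \<xi> in
           finite G \<and> fun_has_dim_le (space (jacobi_prod a b)) (approx_space a b V G) n \<and>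
           \<bar>bint (jacobi_prod a b) (\<lambda>y. \<phi> (emb (v y)))
              - \<phi> (sparse_quad a b emb P G (cont_rep a b v))\<bar>
             \<le> C * onorm \<phi> * rate \<alpha> q\<^sub>1 q\<^sub>2 n)))"
proof -
  have bdd: "bdd_below (range a)" "bdd_below (range b)" "bdd_above (range a)" "bdd_above (range b)"
    using assms(1,2) by (auto intro: bounded_imp_bdd_below bounded_imp_bdd_above)
  have a: "a j > -1" for j
    using assms(3) cINF_lower[OF bdd(1), of j] by simp
  have b: "b j > -1" for j
    using assms(4) cINF_lower[OF bdd(2), of j] by simp
  have lam_le: "lamJ (a j) (b j) \<le> lam\<^sub>0" for j
    unfolding assms(9) by (rule cSUP_upper[OF UNIV_I assms(8)])
  have \<theta>0: "\<theta>\<^sub>0 \<ge> 0"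
  proof -
    have "- 1 / 2 \<le> Max {SUP j. a j, SUP j. b j, - 1 / 2 :: real}" by (rule Max_ge) auto
    then show ?thesis unfolding assms(10) by simp
  qed
  have exponent_le: "Max {a j, b j, - 1 / 2} + 1 / 2 \<le> \<theta>\<^sub>0" for j
  proof -
    have "Max {a j, b j, - 1 / 2} \<le> Max {SUP j. a j, SUP j. b j, - 1 / 2}"
      using cSUP_upper[OF UNIV_I bdd(3), of j] cSUP_upper[OF UNIV_I bdd(4), of j]
      by (auto simp: le_max_iff_disj)
    then show ?thesis unfolding assms(10) by simp
  qed
  have J_bound: "\<bar>jacobi_J (a j) (b j) k y\<bar> \<le> (1 + lam\<^sub>0 * real k) powr \<theta>\<^sub>0" if "y \<in> {-1..1}" for j k y
  proof -
    have pos: "0 \<le> lamJ (a j) (b j) * real k" "lamJ (a j) (b j) * real k \<le> lam\<^sub>0 * real k"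
      using assms(6) lam_le[of j] by (auto intro!: mult_right_mono mult_nonneg_nonneg simp: less_imp_le)
    have "\<bar>jacobi_J (a j) (b j) k y\<bar>
        \<le> (1 + lamJ (a j) (b j) * real k) powr (Max {a j, b j, - 1 / 2} + 1 / 2)"
      using assms(7) that by blast
    also have "\<dots> \<le> (1 + lamJ (a j) (b j) * real k) powr \<theta>\<^sub>0"
      using pos by (intro powr_mono exponent_le) auto
    also have "\<dots> \<le> (1 + lam\<^sub>0 * real k) powr \<theta>\<^sub>0"
      using pos \<theta>0 by (intro powr_mono2) auto
    finally show ?thesis .
  qed
  interpret jacobi_quadrature a b \<theta> lam
    unfolding assms(14,15)
    by (rule jacobi_quadratureI[OF a b \<theta>0 assms(11,12) J_bound]) (use assms(13) in auto)
  interpret sparse_quadrature a b \<theta> lam emb v V P \<alpha> C\<^sub>0 C\<^sub>1 C\<^sub>2 q\<^sub>1 q\<^sub>2 \<sigma>\<^sub>1 \<sigma>\<^sub>2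
    by (intro sparse_quadrature.intro sparse_quadrature_axioms.intro jacobi_quadrature_axioms)
      (fact assms(18,20,28,30,33,34,35,36,40,42,44,45)
        | use assms(21,23,25,31,32,37,38,39) in blast)+
  let ?I = "bint (jacobi_prod a b) v"
  let ?Q = "\<lambda>G. sparse_quad a b emb P G (cont_rep a b v)"
  interpret prod: prob_space "jacobi_prod a b"
    unfolding jacobi_prod_def by (intro prob_space_PiM prob_space_jacobi_measure a b)
  \<comment> \<open>This makes \<open>bint\<close> of \<open>v\<close> a genuine integral, so that
    it commutes with bounded linear maps.\<close>
  obtain x where x: "has_bint (jacobi_prod a b) v x"
    using has_bint_in_L2[OF prod.finite_measure_axioms assms(16)] by blast
  \<comment> \<open>At the zero index \<open>J_multi\<close> is an empty product, so the coefficient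
    is the integral itself.\<close>
  have "jacobi_coeff a b v (\<lambda>_. 0) = ?I"
    by (simp add: jacobi_coeff_def J_multi_def msupp_def)
  then have err_eq: "err \<xi> = norm (emb ?I - ?Q (G_ev \<alpha> q\<^sub>1 q\<^sub>2 \<sigma>\<^sub>1 \<sigma>\<^sub>2 \<xi>))" for \<xi>
    by (simp add: err_def)
  obtain C where C: "C > 0" "\<And>n. n \<ge> 1 \<Longrightarrow> \<exists>\<xi>>1. finite (G_ev \<alpha> q\<^sub>1 q\<^sub>2 \<sigma>\<^sub>1 \<sigma>\<^sub>2 \<xi>) \<and>
      fun_has_dim_le (space (jacobi_prod a b)) (approx_space a b V (G_ev \<alpha> q\<^sub>1 q\<^sub>2 \<sigma>\<^sub>1 \<sigma>\<^sub>2 \<xi>)) n \<and>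
      err \<xi> \<le> C * rate \<alpha> q\<^sub>1 q\<^sub>2 n"
    using quadrature_rate by blast
  \<comment> \<open>Part (ii) inherits the threshold of part (i): the functional commutes with the
    integral and its operator norm multiplies the vector error, so one \<open>C\<close> serves every
    functional.\<close>
  have functional: "\<bar>bint (jacobi_prod a b) (\<lambda>y. \<phi> (emb (v y))) - \<phi> (?Q G)\<bar>
      \<le> C * onorm \<phi> * r" if \<phi>: "bounded_linear \<phi>" and r: "norm (emb ?I - ?Q G) \<le> C * r"
    for \<phi> :: "'x1 \<Rightarrow> real" and G r
  proof -
    have "has_bint (jacobi_prod a b) (\<lambda>y. \<phi> (emb (v y))) (\<phi> (emb x))"
      by (rule has_bint_bounded_linear[OF bounded_linear_compose[OF \<phi> bounded_linear_emb] x])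
    then have "bint (jacobi_prod a b) (\<lambda>y. \<phi> (emb (v y))) = \<phi> (emb ?I)"
      using bint_eqI[OF x] bint_eqI by blast
    then have "\<bar>bint (jacobi_prod a b) (\<lambda>y. \<phi> (emb (v y))) - \<phi> (?Q G)\<bar> = norm (\<phi> (emb ?I - ?Q G))"
      by (simp add: linear_diff[OF bounded_linear.linear[OF \<phi>]])
    also have "\<dots> \<le> onorm \<phi> * norm (emb ?I - ?Q G)" by (rule onorm[OF \<phi>])
    also have "\<dots> \<le> onorm \<phi> * (C * r)" by (rule mult_left_mono[OF r onorm_pos_le[OF \<phi>]])
    finally show ?thesis by (simp add: mult_ac)
  qed
  have kappa: "\<alpha> > 1 / q\<^sub>2 - 1 / 2 \<longrightarrow> 0 < kappa_exp \<alpha> q\<^sub>1 q\<^sub>2 \<and> kappa_exp \<alpha> q\<^sub>1 q\<^sub>2 < 1"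
    using kappa_bounds by simp
  have vector: "\<forall>n\<ge>1. \<exists>\<xi>>1. let G = G_ev \<alpha> q\<^sub>1 q\<^sub>2 \<sigma>\<^sub>1 \<sigma>\<^sub>2 \<xi> in
         finite G \<and> fun_has_dim_le (space (jacobi_prod a b)) (approx_space a b V G) n \<and>
         norm (emb ?I - ?Q G) \<le> C * rate \<alpha> q\<^sub>1 q\<^sub>2 n"
  proof (intro allI impI)
    fix n :: nat assume "n \<ge> 1"
    from C(2)[OF this] obtain \<xi> where "\<xi> > 1" "finite (G_ev \<alpha> q\<^sub>1 q\<^sub>2 \<sigma>\<^sub>1 \<sigma>\<^sub>2 \<xi>)"
      "fun_has_dim_le (space (jacobi_prod a b)) (approx_space a b V (G_ev \<alpha> q\<^sub>1 q\<^sub>2 \<sigma>\<^sub>1 \<sigma>\<^sub>2 \<xi>)) n"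
      "norm (emb ?I - ?Q (G_ev \<alpha> q\<^sub>1 q\<^sub>2 \<sigma>\<^sub>1 \<sigma>\<^sub>2 \<xi>)) \<le> C * rate \<alpha> q\<^sub>1 q\<^sub>2 n"
      unfolding err_eq by (elim exE conjE) (rule that)
    then show "\<exists>\<xi>>1. let G = G_ev \<alpha> q\<^sub>1 q\<^sub>2 \<sigma>\<^sub>1 \<sigma>\<^sub>2 \<xi> in
         finite G \<and> fun_has_dim_le (space (jacobi_prod a b)) (approx_space a b V G) n \<and>
         norm (emb ?I - ?Q G) \<le> C * rate \<alpha> q\<^sub>1 q\<^sub>2 n"
      unfolding Let_def by (intro exI[of _ \<xi>] conjI)
  qed
  have scalar: "\<forall>\<phi> :: 'x1 \<Rightarrow> real. bounded_linear \<phi> \<longrightarrow> (\<forall>n\<ge>1. \<exists>\<xi>>1.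
      let G = G_ev \<alpha> q\<^sub>1 q\<^sub>2 \<sigma>\<^sub>1 \<sigma>\<^sub>2 \<xi> in
           finite G \<and> fun_has_dim_le (space (jacobi_prod a b)) (approx_space a b V G) n \<and>
           \<bar>bint (jacobi_prod a b) (\<lambda>y. \<phi> (emb (v y))) - \<phi> (?Q G)\<bar>
             \<le> C * onorm \<phi> * rate \<alpha> q\<^sub>1 q\<^sub>2 n)"
  proof (intro allI impI)
    fix \<phi> :: "'x1 \<Rightarrow> real" and n :: nat assume \<phi>: "bounded_linear \<phi>" and "n \<ge> 1"
    from C(2)[OF this(2)] obtain \<xi> where "\<xi> > 1" "finite (G_ev \<alpha> q\<^sub>1 q\<^sub>2 \<sigma>\<^sub>1 \<sigma>\<^sub>2 \<xi>)"
      "fun_has_dim_le (space (jacobi_prod a b)) (approx_space a b V (G_ev \<alpha> q\<^sub>1 q\<^sub>2 \<sigma>\<^sub>1 \<sigma>\<^sub>2 \<xi>)) n"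
      "norm (emb ?I - ?Q (G_ev \<alpha> q\<^sub>1 q\<^sub>2 \<sigma>\<^sub>1 \<sigma>\<^sub>2 \<xi>)) \<le> C * rate \<alpha> q\<^sub>1 q\<^sub>2 n"
      unfolding err_eq by (elim exE conjE) (rule that)
    then show "\<exists>\<xi>>1. let G = G_ev \<alpha> q\<^sub>1 q\<^sub>2 \<sigma>\<^sub>1 \<sigma>\<^sub>2 \<xi> in
           finite G \<and> fun_has_dim_le (space (jacobi_prod a b)) (approx_space a b V G) n \<and>
           \<bar>bint (jacobi_prod a b) (\<lambda>y. \<phi> (emb (v y))) - \<phi> (?Q G)\<bar>
             \<le> C * onorm \<phi> * rate \<alpha> q\<^sub>1 q\<^sub>2 n"
      unfolding Let_def by (intro exI[of _ \<xi>] conjI functional[OF \<phi>])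
  qed
  show ?thesis
    by (rule conjI[OF kappa], rule exI[of _ C], rule conjI[OF C(1) conjI[OF vector scalar]])
qed

end
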